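(* Let $V$ be an algebraic subvariety of $\mathbb{C}^N$ of pure dimension $n$, with closure $X$ in $\mathbb{P}^N$, and let $F_1,\ldots,F_m$ be polynomials in $\mathbb{C}^N$ of degrees $d_1\ge\cdots\ge d_m$. For each $j$ let $f_j$ be the section of $\mathcal{O}(d_j)|_X$ induced by $F_j$. Assume that $f_1,\ldots,f_m$ have no common zeros on $X$. Then for each polynomial $\Phi$ in $\mathbb{C}^N$ there are polynomials $Q_1,\ldots,Q_m$ in $\mathbb{C}^N$ such that $$F_1Q_1+\cdots+F_mQ_m=\Phi\quad\text{on } V$$ and, for every $j$, $$\deg(F_jQ_j)\le\max\bigl(\deg\Phi,\ d_1+\cdots+d_{n+1}-(n+1)+\operatorname{reg}X\bigr).$$
   Context: View $\mathbb{C}^N\subset\mathbb{P}^N$ with homogeneous coordinates $[z_0:\cdots:z_N]$ as the set $z_0\ne0$. Varieties are reduced. The $F_j$ are nonzero. The section $f_j$ of $\mathcal{O}(d_j)|_X$ is the restriction to $X$ of the homogenization $z_0^{d_j}F_j(z_1/z_0,\ldots,z_N/z_0)$. If $m<n+1$ (which, under the hypothesis, can only happen if some $F_j$ is a nonzero constant), set $d_j=0$ for $j>m$. Regularity: let $S=\mathbb{C}[z_0,\ldots,z_N]$. If a graded $S$-module has minimal graded free resolution $\cdots\to\bigoplus_iS(-d_k^i)\to\cdots\to\bigoplus_iS(-d_0^i)$, its regularity is $\max_{k,i}(d_k^i-k)$. For a homogeneous ideal $J\subset S$, $\operatorname{reg}J=\operatorname{reg}(S/J)+1$. $\operatorname{reg}X$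 is defined as $\operatorname{reg}J_X=\operatorname{reg}(S/J_X)+1$, where $J_X\subset S$ is the homogeneous ideal of $X$ (so $\operatorname{reg}\mathbb{P}^N=1$). *)

theory Defs
  imports "HOL-Analysis.Analysis" "HOL-Library.Poly_Mapping"
begin

section \<open>Polynomials\<close>

text \<open>
  Polynomials over the complex numbers in the variables \<open>'v\<close>, as finitely supported maps from
  exponent vectors to coefficients. The ring \<open>'n cpoly\<close> is the coordinate ring of affine
  \<open>N\<close>-space, \<open>N = CARD('n)\<close>. The ring \<open>S\<close> is \<open>'n option cpoly\<close>: the variable \<open>None\<close> is
  \<open>z\<^sub>0\<close>, the variables \<open>Some i\<close> are \<open>z\<^sub>1, \<dots>, z\<^sub>N\<close>.
\<close>
type_synonym 'v cpoly = "('v \<Rightarrow>\<^sub>0 nat) \<Rightarrow>\<^sub>0 complex"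

definition poly_at :: "'v::finite cpoly \<Rightarrow> complex^'v \<Rightarrow> complex" where
  "poly_at p x = (\<Sum>a\<in>Poly_Mapping.keys p. Poly_Mapping.lookup p a * (\<Prod>v\<in>UNIV. (x $ v) ^ Poly_Mapping.lookup a v))"

definition mon_degree :: "('v::finite \<Rightarrow>\<^sub>0 nat) \<Rightarrow> nat" where
  "mon_degree a = (\<Sum>v\<in>UNIV. Poly_Mapping.lookup a v)"

text \<open>The zero polynomial gets degree \<open>0\<close>.\<close>
definition total_degree :: "'v::finite cpoly \<Rightarrow> nat" where
  "total_degree p = Max (insert 0 (mon_degree ` Poly_Mapping.keys p))"

text \<open>The degree is an integer, so the forms of a negative degree are just \<open>0\<close>.\<close>
definition homogeneous :: "int \<Rightarrow> 'v::finite cpoly \<Rightarrow> bool" where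
  "homogeneous t p \<longleftrightarrow> (\<forall>a\<in>Poly_Mapping.keys p. int (mon_degree a) = t)"

text \<open>\<open>homogenize d p\<close> is \<open>z\<^sub>0\<^sup>d p(z\<^sub>1/z\<^sub>0, \<dots>, z\<^sub>N/z\<^sub>0)\<close>; meaningful for \<open>total_degree p \<le> d\<close>.\<close>
definition homogenize_mon :: "nat \<Rightarrow> ('n::finite \<Rightarrow>\<^sub>0 nat) \<Rightarrow> ('n option \<Rightarrow>\<^sub>0 nat)" where
  "homogenize_mon d a = Poly_Mapping.Abs_poly_mapping
     (\<lambda>v. case v of None \<Rightarrow> d - mon_degree a | Some i \<Rightarrow> Poly_Mapping.lookup a i)"

definition homogenize :: "nat \<Rightarrow> 'n::finite cpoly \<Rightarrow> 'n option cpoly" where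
  "homogenize d p = (\<Sum>a\<in>Poly_Mapping.keys p. Poly_Mapping.single (homogenize_mon d a) (Poly_Mapping.lookup p a))"

section \<open>Affine varieties and their dimension\<close>

definition affine_variety :: "(complex^'n::finite) set \<Rightarrow> bool" where
  "affine_variety V \<longleftrightarrow> (\<exists>P. V = {x. \<forall>p\<in>P. poly_at p x = 0})"

definition irreducible_variety :: "(complex^'n::finite) set \<Rightarrow> bool" where
  "irreducible_variety Z \<longleftrightarrow> affine_variety Z \<and> Z \<noteq> {} \<and>
     (\<forall>A B. affine_variety A \<and> affine_variety B \<and> Z = A \<union> B \<longrightarrow> Z = A \<or> Z = B)"

definition irreducible_component :: "(complex^'n::finite) set \<Rightarrow> (complex^'n) set \<Rightarrow> bool" where
  "irreducible_component Z V \<longleftrightarrow> irreducible_variety Z \<and> Z \<subseteq> V \<and>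
     (\<forall>W. irreducible_variety W \<and> Z \<subseteq> W \<and> W \<subseteq> V \<longrightarrow> W = Z)"

definition variety_dim :: "(complex^'n::finite) set \<Rightarrow> enat" where
  "variety_dim Z = Sup {enat k | k. \<exists>C :: nat \<Rightarrow> (complex^'n) set.
     (\<forall>i\<le>k. irreducible_variety (C i) \<and> C i \<subseteq> Z) \<and> (\<forall>i<k. C i \<subset> C (Suc i))}"

text \<open>By this definition the empty variety has every pure dimension.\<close>
definition pure_dimensional :: "(complex^'n::finite) set \<Rightarrow> nat \<Rightarrow> bool" where
  "pure_dimensional V n \<longleftrightarrow> (\<forall>Z. irreducible_component Z V \<longrightarrow> variety_dim Z = enat n)"

section \<open>Projective closure and homogeneous ideal\<close>

text \<open>
  A subset of projective space is represented by the set of all homogeneous coordinate vectors of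
  its points, that is, by a set of nonzero vectors that is stable under nonzero scalars.
\<close>
definition projective_variety :: "(complex^('n::finite option)) set \<Rightarrow> bool" where
  "projective_variety X \<longleftrightarrow> (\<exists>H. (\<forall>h\<in>H. \<exists>t. homogeneous t h) \<and>
     X = {z. z \<noteq> 0 \<and> (\<forall>h\<in>H. poly_at h z = 0)})"

definition affine_chart :: "complex^'n::finite \<Rightarrow> complex^('n option)" where
  "affine_chart x = (\<chi> v. case v of None \<Rightarrow> 1 | Some i \<Rightarrow> x $ i)"

text \<open>Closure in the Zariski topology; for an affine variety it is also the Euclidean closure.\<close>
definition projective_closure :: "(complex^'n::finite) set \<Rightarrow> (complex^('n option)) set" where
  "projective_closure V = \<Inter>{X. projective_variety X \<and> affine_chart ` V \<subseteq> X}"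

text \<open>
  As \<open>X\<close> contains all coordinate vectors of its points, a polynomial that vanishes on it has all
  its homogeneous components vanishing on it. For empty \<open>X\<close> the ideal is the whole ring.
\<close>
definition homogeneous_ideal :: "(complex^('n::finite option)) set \<Rightarrow> 'n option cpoly set" where
  "homogeneous_ideal X = {p. \<forall>z\<in>X. poly_at p z = 0}"

section \<open>Minimal graded free resolutions and regularity\<close>

text \<open>
  The data of a graded free resolution of \<open>S/J\<close>, where \<open>S = 'v cpoly\<close>. The module in homological
  degree \<open>k\<close> is the direct sum of \<open>S(- twist k i)\<close> over \<open>i < rk k\<close>. The matrix of its
  differential into homological degree \<open>k - 1\<close> is \<open>dmat k\<close> for \<open>k \<ge> 1\<close>; \<open>dmat 0\<close> is not used.
  The map from homological degree \<open>0\<close> onto \<open>S/J\<close> sends the basis element \<open>i\<close> to the class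
  of \<open>augm i\<close>.
\<close>
record 'v resolution =
  rk :: "nat \<Rightarrow> nat"
  twist :: "nat \<Rightarrow> nat \<Rightarrow> int"
  dmat :: "nat \<Rightarrow> nat \<Rightarrow> nat \<Rightarrow> 'v cpoly"
  augm :: "nat \<Rightarrow> 'v cpoly"

definition chain_module :: "'v::finite resolution \<Rightarrow> nat \<Rightarrow> (nat \<Rightarrow> 'v cpoly) set" where
  "chain_module R k = {u. \<forall>i\<ge>rk R k. u i = 0}"

definition differential :: "'v::finite resolution \<Rightarrow> nat \<Rightarrow> (nat \<Rightarrow> 'v cpoly) \<Rightarrow> (nat \<Rightarrow> 'v cpoly)" where
  "differential R k u = (\<lambda>i. if i < rk R (k - 1) then \<Sum>j<rk R k. dmat R k i j * u j else 0)"

definition augmentation :: "'v::finite resolution \<Rightarrow> (nat \<Rightarrow> 'v cpoly) \<Rightarrow> 'v cpoly" where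
  "augmentation R u = (\<Sum>i<rk R 0. augm R i * u i)"

definition graded_free_resolution :: "'v::finite resolution \<Rightarrow> 'v cpoly set \<Rightarrow> bool" where
  "graded_free_resolution R J \<longleftrightarrow>
     (\<forall>i<rk R 0. homogeneous (twist R 0 i) (augm R i)) \<and>
     (\<forall>k\<ge>1. \<forall>i<rk R (k - 1). \<forall>j<rk R k.
        homogeneous (twist R k j - twist R (k - 1) i) (dmat R k i j)) \<and>
     (\<forall>p. \<exists>u\<in>chain_module R 0. p - augmentation R u \<in> J) \<and>
     {u \<in> chain_module R 0. augmentation R u \<in> J} = differential R 1 ` chain_module R 1 \<and>
     (\<forall>k\<ge>1. {u \<in> chain_module R k. differential R k u = (\<lambda>_. 0)}
        = differential R (Suc k) ` chain_module R (Suc k))"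

text \<open>
  Minimality: the differentials map into \<open>\<mm>\<close> times the next module, \<open>\<mm>\<close> being the ideal of the
  variables, so no matrix entry has a constant term.
\<close>
definition minimal_resolution :: "'v::finite resolution \<Rightarrow> 'v cpoly set \<Rightarrow> bool" where
  "minimal_resolution R J \<longleftrightarrow> graded_free_resolution R J \<and>
     (\<forall>k\<ge>1. \<forall>i<rk R (k - 1). \<forall>j<rk R k. Poly_Mapping.lookup (dmat R k i j) 0 = 0)"

text \<open>
  The regularity of \<open>S/J\<close>. Minimal graded free resolutions are isomorphic, so the twists do not
  depend on the choice. By the syzygy theorem the supremum is a maximum, except that it is
  \<open>-\<infinity>\<close> for the zero module.
\<close>
definition quotient_regularity :: "'v::finite cpoly set \<Rightarrow> ereal" where
  "quotient_regularity J =
     (let R = (SOME R. minimal_resolution R J)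
      in SUP (k, i)\<in>{(k, i). i < rk R k}. ereal (real_of_int (twist R k i - int k)))"

definition ideal_regularity :: "'v::finite cpoly set \<Rightarrow> ereal" where
  "ideal_regularity J = quotient_regularity J + 1"

definition projective_regularity :: "(complex^('n::finite option)) set \<Rightarrow> ereal" where
  "projective_regularity X = ideal_regularity (homogeneous_ideal X)"

end

theory Submission
  imports Defs "HOL-Library.Function_Algebras"
    "HOL-Computational_Algebra.Fundamental_Theorem_Algebra" "HOL-Computational_Algebra.Primes"
begin

text \<open>
  Let \<open>A = S/J\<close> be the homogeneous coordinate ring of \<open>X\<close>. After homogenizing, it suffices that the forms
  \<open>f\<^sub>j\<close> generate \<open>A\<close> in every degree above \<open>reg A + \<Sum>(d\<^sub>i - 1)\<close>, the sum being over \<open>i \<le> n + 1\<close>. As the \<open>f\<^sub>j\<close> have no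
  common zeros and \<open>X\<close> has dimension \<open>n\<close>, there are forms \<open>g\<^sub>1, \<dots>, g\<^bsub>n+1\<^esub>\<close> in the ideal of the \<open>f\<^sub>j\<close>, with
  \<open>deg g\<^sub>i = d\<^sub>i\<close>, that still have no common zeros on \<open>X\<close>: avoid finitely many primes at each step. The dimension
  theory that is needed compares chains of primes with the growth of the quotient rings.

  Now take the iterated mapping cone of the \<open>g\<^sub>i\<close> on a graded free resolution of \<open>A\<close>. It is a complex of free
  modules whose term in homological degree \<open>k\<close> is generated in degrees at most \<open>R + k\<close>, where
  \<open>R = reg A + \<Sum>(d\<^sub>i - 1)\<close>, and its homology is torsion with respect to the ideal of the variables. Killing the variables
  one after another shows that for such a complex \<open>H\<^sub>k\<close> vanishes in degrees above \<open>R + k\<close>: once all the variables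
  are killed this is clear, and a step back makes a variable injective on a torsion module. For \<open>k = 0\<close> this is
  the claim.

  The Nullstellensatz uses that \<open>\<complex>\<close> is uncountable: if \<open>x - c\<close> is invertible in a countably
  generated algebra for all \<open>c\<close>, then the inverses are linearly dependent.
\<close>

text \<open>The obstacle is that \<open>A\<close> need not be Cohen-Macaulay: the forms
  \<open>g_i\<close> need not be a regular sequence, and the mapping cones need not be exact. What
  survives is that a power of every variable kills their homology, and the way back from the
  quotient by all variables asks for nothing more. Degrees are measured as internal degree minus
  homological degree. The generators of a minimal resolution of \<open>A\<close> then have degrees
  at most \<open>reg A\<close>, and the copy added by a cone over a form of degree \<open>d\<close>
  is shifted by \<open>d\<close> internally and by 1 homologically; this \<open>d - 1\<close> is the
  origin of the sum. Only degrees strictly above \<open>R\<close> are controlled; as degrees are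
  integers, \<open>reg X = reg A + 1\<close> turns this into the stated maximum. The number
  \<open>n + 1\<close> is the dimension of the affine cone over \<open>X\<close>. Prime avoidance
  can keep the degree \<open>d_i\<close> because later forms, having smaller or equal degree, are
  multiplied up by a power of a variable; this is where the ordering of the degrees enters. If the
  supremum defining the regularity were infinite, the bound would be void and the Nullstellensatz
  would already give the \<open>Q_j\<close>.\<close>

abbreviation lookup where "lookup \<equiv> Poly_Mapping.lookup"
abbreviation keys where "keys \<equiv> Poly_Mapping.keys"
abbreviation single where "single \<equiv> Poly_Mapping.single"

section \<open>Evaluation of polynomials and arithmetic of their monomials\<close>

definition Cst :: "complex \<Rightarrow> 'v cpoly" where "Cst c = single 0 c"
definition Var :: "'v \<Rightarrow> 'v cpoly" where "Var v = single (single v 1) 1"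
definition mon_at :: "('v::finite \<Rightarrow>\<^sub>0 nat) \<Rightarrow> complex^'v \<Rightarrow> complex" where
  "mon_at a x = (\<Prod>v\<in>UNIV. (x $ v) ^ lookup a v)"

lemma sum_single_keys:
  assumes "finite A" "keys p \<subseteq> A"
  shows "p = (\<Sum>a\<in>A. single a (lookup p a))"
proof (rule poly_mapping_eqI)
  fix k
  show "lookup p k = lookup (\<Sum>a\<in>A. single a (lookup p a)) k"
    using assms by (auto simp: lookup_sum lookup_single when_def in_keys_iff)
qed

lemmas sum_single_keys_self = sum_single_keys[OF finite_keys order_refl]

lemma mon_at_add: "mon_at (a + b) x = mon_at a x * mon_at b x"
  by (simp add: mon_at_def lookup_add power_add prod.distrib)

lemma mon_at_zero [simp]: "mon_at 0 x = 1"
  by (simp add: mon_at_def)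

lemma poly_at_alt:
  assumes "finite A" "keys p \<subseteq> A"
  shows "poly_at p x = (\<Sum>a\<in>A. lookup p a * mon_at a x)"
  unfolding poly_at_def mon_at_def
  by (rule sum.mono_neutral_left) (use assms in \<open>auto simp: in_keys_iff\<close>)

lemma poly_at_add [simp]: "poly_at (p + q) x = poly_at p x + poly_at q x"
proof -
  have "poly_at (p + q) x = (\<Sum>a\<in>keys p \<union> keys q. lookup (p + q) a * mon_at a x)"
    by (rule poly_at_alt) (use keys_add[of p q] in auto)
  moreover have "poly_at p x = (\<Sum>a\<in>keys p \<union> keys q. lookup p a * mon_at a x)"
    by (rule poly_at_alt) auto
  moreover have "poly_at q x = (\<Sum>a\<in>keys p \<union> keys q. lookup q a * mon_at a x)"
    by (rule poly_at_alt) auto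
  ultimately show ?thesis by (simp add: lookup_add distrib_right sum.distrib)
qed

lemma poly_at_zero [simp]: "poly_at 0 x = 0"
  by (simp add: poly_at_def)

lemma poly_at_sum [simp]: "poly_at (sum f A) x = (\<Sum>i\<in>A. poly_at (f i) x)"
  by (induction A rule: infinite_finite_induct) auto

lemma poly_at_single: "poly_at (single a c) x = c * mon_at a x"
  by (simp add: poly_at_def mon_at_def)

lemma poly_at_uminus [simp]: "poly_at (- p) x = - poly_at p x"
  using poly_at_add[of p "-p" x] by (simp add: eq_neg_iff_add_eq_0 add.commute)

lemma poly_at_diff [simp]: "poly_at (p - q) x = poly_at p x - poly_at q x"
  using poly_at_add[of p "-q" x] by simp

lemma poly_at_mult [simp]: "poly_at (p * q) x = poly_at p x * poly_at q x"
proof -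
  have "p * q = (\<Sum>a\<in>keys p. single a (lookup p a)) * (\<Sum>b\<in>keys q. single b (lookup q b))"
    using sum_single_keys_self[of p] sum_single_keys_self[of q] by simp
  also have "\<dots> = (\<Sum>a\<in>keys p. \<Sum>b\<in>keys q. single (a + b) (lookup p a * lookup q b))"
    by (simp add: sum_product mult_single)
  finally have "poly_at (p * q) x = (\<Sum>a\<in>keys p. \<Sum>b\<in>keys q. (lookup p a * mon_at a x) * (lookup q b * mon_at b x))"
    by (simp add: poly_at_single mon_at_add mult_ac)
  then show ?thesis
    by (simp add: poly_at_alt[OF finite_keys order_refl] sum_product)
qed

lemma poly_at_Cst [simp]: "poly_at (Cst c) x = c"
  by (simp add: Cst_def poly_at_single)

lemma poly_at_Var [simp]: "poly_at (Var v) x = x $ v"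
proof -
  have "(\<Prod>w\<in>UNIV. (x $ w) ^ lookup (single v 1 :: 'a \<Rightarrow>\<^sub>0 nat) w) = (\<Prod>w\<in>UNIV. if w = v then x $ w else 1)"
    by (rule prod.cong) (auto simp: lookup_single when_def)
  then show ?thesis by (simp add: Var_def poly_at_single mon_at_def)
qed

lemma Cst_0 [simp]: "Cst 0 = 0" and Cst_1 [simp]: "Cst 1 = 1"
  by (simp_all add: Cst_def)

lemma Cst_add: "Cst (a + b) = Cst a + Cst b"
  by (simp add: Cst_def single_add)

lemma Cst_uminus: "Cst (- a) = - Cst a"
  by (simp add: Cst_def single_uminus)

lemma Cst_mult: "Cst (a * b) = Cst a * Cst b"
  by (simp add: Cst_def mult_single)

lemma poly_at_one [simp]: "poly_at 1 x = 1"
  using poly_at_Cst[of 1 x] by simp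

lemma poly_at_power [simp]: "poly_at (p ^ k) x = poly_at p x ^ k"
  by (induction k) auto

lemma poly_at_prod [simp]: "poly_at (prod f A) x = (\<Prod>i\<in>A. poly_at (f i) x)"
  by (induction A rule: infinite_finite_induct) auto

lemma lookup_single_mult: "lookup (single a c * p) (a + b) = c * lookup p b" for a b :: "'v \<Rightarrow>\<^sub>0 nat"
proof -
  have "single a c * p = (\<Sum>k\<in>keys p. single (a + k) (c * lookup p k))"
    by (subst sum_single_keys_self[of p]) (simp add: sum_distrib_left mult_single)
  then have "lookup (single a c * p) (a + b) = (\<Sum>k\<in>keys p. (c * lookup p k when a + k = a + b))"
    by (simp add: lookup_sum lookup_single)
  also have "\<dots> = (\<Sum>k\<in>keys p. if k = b then c * lookup p k else 0)"
    by (rule sum.cong) (auto simp: when_def)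
  finally show ?thesis by (auto simp: in_keys_iff)
qed

lemma keys_single_mult: "keys (single a c * p) \<subseteq> (\<lambda>b. a + b) ` keys p" for a :: "'v \<Rightarrow>\<^sub>0 nat"
  using keys_mult[of "single a c" p] by (auto split: if_splits)

lemma lookup_Cst_mult [simp]: "lookup (Cst c * p) a = c * lookup p a" for p :: "'v cpoly"
  using lookup_single_mult[of 0 c p a] by (simp add: Cst_def)

lemma keys_multD:
  fixes p q :: "'v cpoly"
  assumes "k \<in> keys (p * q)"
  obtains a b where "a \<in> keys p" "b \<in> keys q" "k = a + b"
  using keys_mult[of p q] assms by blast

lemma single_eq_Cst_mult: "single a c = Cst c * single a 1" for a :: "'v \<Rightarrow>\<^sub>0 nat"
  by (simp add: Cst_def mult_single)

lemma keys_addD: "k \<in> keys (p + q) \<Longrightarrow> k \<in> keys p \<or> k \<in> keys q"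
  using keys_add[of p q] by blast

lemma keys_sumD: "k \<in> keys (sum f A) \<Longrightarrow> \<exists>i\<in>A. k \<in> keys (f i)" for f :: "'i \<Rightarrow> 'v cpoly"
  using keys_sum[of f A] by blast

section \<open>Degrees and homogeneous components\<close>

lemma mon_degree_add [simp]: "mon_degree (a + b) = mon_degree a + mon_degree b"
  by (simp add: mon_degree_def lookup_add sum.distrib)

lemma mon_degree_zero [simp]: "mon_degree 0 = 0"
  by (simp add: mon_degree_def)

lemma mon_degree_single [simp]: "mon_degree (single v k) = k"
proof -
  have "mon_degree (single v k) = (\<Sum>w\<in>UNIV. if w = v then k else 0)"
    unfolding mon_degree_def by (rule sum.cong) (auto simp: lookup_single when_def)
  then show ?thesis by simp
qed

lemma lookup_le_mon_degree: "lookup a v \<le> mon_degree a" for v :: "'v::finite"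
  unfolding mon_degree_def by (rule member_le_sum) auto

lemma mon_degree_eq_0_iff [simp]: "mon_degree a = 0 \<longleftrightarrow> a = 0"
  by (auto simp: mon_degree_def intro: poly_mapping_eqI)

lemma finite_mon_degree_le: "finite {a :: 'v::finite \<Rightarrow>\<^sub>0 nat. mon_degree a \<le> D}"
proof -
  have "lookup ` {a :: 'v \<Rightarrow>\<^sub>0 nat. mon_degree a \<le> D} \<subseteq> PiE UNIV (\<lambda>_. {..D})"
    using lookup_le_mon_degree order_trans by fastforce
  then have "finite (lookup ` {a :: 'v \<Rightarrow>\<^sub>0 nat. mon_degree a \<le> D})"
    by (rule finite_subset) (auto intro: finite_PiE)
  then show ?thesis
    by (rule finite_imageD) (auto simp: inj_on_def poly_mapping_eqI)
qed

lemma total_degree_le_iff: "total_degree p \<le> D \<longleftrightarrow> (\<forall>a\<in>keys p. mon_degree a \<le> D)"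
  by (auto simp: total_degree_def)

lemma mon_degree_le_total_degree: "a \<in> keys p \<Longrightarrow> mon_degree a \<le> total_degree p"
  using total_degree_le_iff by blast

lemma total_degree_mult_le: "total_degree (p * q) \<le> total_degree p + total_degree q"
  unfolding total_degree_le_iff
  by (auto elim!: keys_multD intro!: add_mono mon_degree_le_total_degree)

lemma total_degree_sum_le: "(\<And>i. i \<in> A \<Longrightarrow> total_degree (f i) \<le> D) \<Longrightarrow> total_degree (sum f A) \<le> D"
  unfolding total_degree_le_iff by (auto dest: keys_sumD)

lemma total_degree_zero [simp]: "total_degree 0 = 0"
  by (simp add: total_degree_def)

lemma total_degree_single_le: "total_degree (single a c) \<le> mon_degree a"
  unfolding total_degree_le_iff by auto

lemma total_degree_Cst [simp]: "total_degree (Cst c) = 0"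
  using total_degree_single_le[of 0 c] by (simp add: Cst_def)

lemma total_degree_one [simp]: "total_degree 1 = 0"
  using total_degree_Cst[of 1] by simp

lemma total_degree_Cst_mult_le: "total_degree (Cst c * p) \<le> total_degree p"
  using total_degree_mult_le[of "Cst c" p] by simp

lemma total_degree_power_le: "total_degree (p ^ k) \<le> k * total_degree p"
proof (induction k)
  case (Suc k)
  then show ?case using total_degree_mult_le[of p "p ^ k"] by simp
qed simp

lemma total_degree_prod_le: "total_degree (prod f A) \<le> (\<Sum>i\<in>A. total_degree (f i))"
proof (induction A rule: infinite_finite_induct)
  case (insert x F)
  then show ?case using total_degree_mult_le[of "f x" "prod f F"] by simp
qed auto

text \<open>The degree \<open>t\<close> is an integer, so \<open>hcomp (t - d)\<close> makes sense
  for all \<open>t\<close> and \<open>d\<close>; components of negative degree are 0.\<close>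

definition hcomp :: "int \<Rightarrow> 'v::finite cpoly \<Rightarrow> 'v cpoly" where
  "hcomp t p = (\<Sum>a\<in>{a\<in>keys p. int (mon_degree a) = t}. single a (lookup p a))"

lemma lookup_hcomp: "lookup (hcomp t p) a = (if int (mon_degree a) = t then lookup p a else 0)"
  unfolding hcomp_def by (auto simp: lookup_sum lookup_single when_def in_keys_iff)

lemma keys_hcomp: "keys (hcomp t p) = {a\<in>keys p. int (mon_degree a) = t}"
  by (auto simp: in_keys_iff lookup_hcomp split: if_splits)

lemma homogeneous_hcomp [simp]: "homogeneous t (hcomp t p)"
  by (auto simp: homogeneous_def keys_hcomp)

lemma hcomp_add [simp]: "hcomp t (p + q) = hcomp t p + hcomp t q"
  by (rule poly_mapping_eqI) (simp add: lookup_hcomp lookup_add)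

lemma hcomp_zero [simp]: "hcomp t 0 = 0"
  by (rule poly_mapping_eqI) (simp add: lookup_hcomp)

lemma hcomp_uminus [simp]: "hcomp t (- p) = - hcomp t p"
  by (rule poly_mapping_eqI) (simp add: lookup_hcomp)

lemma hcomp_diff [simp]: "hcomp t (p - q) = hcomp t p - hcomp t q"
  by (rule poly_mapping_eqI) (simp add: lookup_hcomp lookup_minus)

lemma hcomp_sum: "hcomp t (sum f A) = (\<Sum>i\<in>A. hcomp t (f i))"
  by (induction A rule: infinite_finite_induct) auto

lemma hcomp_Cst_mult: "hcomp t (Cst c * p) = Cst c * hcomp t p"
  by (rule poly_mapping_eqI) (simp add: lookup_hcomp)

lemma hcomp_homogeneous: "homogeneous s p \<Longrightarrow> hcomp t p = (if s = t then p else 0)"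
  by (rule poly_mapping_eqI) (auto simp: lookup_hcomp homogeneous_def in_keys_iff)

lemma homogeneous_iff_hcomp: "homogeneous t p \<longleftrightarrow> hcomp t p = p"
  by (metis hcomp_homogeneous homogeneous_hcomp)

lemma homogeneous_mult: "homogeneous s p \<Longrightarrow> homogeneous t q \<Longrightarrow> homogeneous (s + t) (p * q)"
  unfolding homogeneous_def by (auto elim!: keys_multD)

lemma homogeneous_add: "homogeneous t p \<Longrightarrow> homogeneous t q \<Longrightarrow> homogeneous t (p + q)"
  unfolding homogeneous_def by (auto dest: keys_addD)

lemma homogeneous_sum: "(\<And>i. i \<in> A \<Longrightarrow> homogeneous t (f i)) \<Longrightarrow> homogeneous t (sum f A)"
  unfolding homogeneous_def by (auto dest: keys_sumD)

lemma homogeneous_Cst: "homogeneous 0 (Cst c)"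
  by (simp add: homogeneous_def Cst_def)

lemma homogeneous_one: "homogeneous 0 1"
  by (simp add: homogeneous_def)

lemma homogeneous_Var: "homogeneous 1 (Var v)"
  by (simp add: homogeneous_def Var_def)

lemma homogeneous_power: "homogeneous t p \<Longrightarrow> homogeneous (int k * t) (p ^ k)"
proof (induction k)
  case (Suc k)
  then show ?case using homogeneous_mult[of t p "int k * t" "p ^ k"] by (simp add: algebra_simps)
qed (simp add: homogeneous_one)

lemma sum_hcomp: "total_degree p \<le> D \<Longrightarrow> p = (\<Sum>s\<le>D. hcomp (int s) p)"
  by (rule poly_mapping_eqI) (auto simp: lookup_sum lookup_hcomp total_degree_le_iff in_keys_iff)

lemma hcomp_neg: "t < 0 \<Longrightarrow> hcomp t p = 0"
  by (rule poly_mapping_eqI) (simp add: lookup_hcomp)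

lemma hcomp_mult_homogeneous:
  assumes "homogeneous d q"
  shows "hcomp t (p * q) = hcomp (t - d) p * q"
proof -
  \<comment> \<open>The cutoff reaches \<open>t - d\<close> as well, so that the one component that
    contributes occurs in the sum.\<close>
  define D where "D = max (total_degree p) (nat (t - d))"
  have p: "p = (\<Sum>s\<le>D. hcomp (int s) p)" by (rule sum_hcomp) (simp add: D_def)
  have "hcomp t (p * q) = (\<Sum>s\<le>D. hcomp t (hcomp (int s) p * q))"
    by (subst p) (simp add: sum_distrib_right hcomp_sum)
  also have "\<dots> = (\<Sum>s\<le>D. if int s + d = t then hcomp (int s) p * q else 0)"
    by (rule sum.cong) (auto simp: hcomp_homogeneous[OF homogeneous_mult[OF homogeneous_hcomp assms]])
  also have "\<dots> = hcomp (t - d) p * q"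
  proof (cases "t - d < 0")
    case True
    then show ?thesis by (subst hcomp_neg[OF True]) (simp add: sum.neutral)
  next
    case False
    have "(\<Sum>s\<le>D. if int s + d = t then hcomp (int s) p * q else 0)
        = (\<Sum>s\<le>D. if s = nat (t - d) then hcomp (t - d) p * q else 0)"
      by (rule sum.cong) (use False in auto)
    also have "\<dots> = hcomp (t - d) p * q" by (simp add: D_def)
    finally show ?thesis .
  qed
  finally show ?thesis .
qed

lemma hcomp_homogeneous_mult: "homogeneous d q \<Longrightarrow> hcomp t (q * p) = q * hcomp (t - d) p"
  by (metis hcomp_mult_homogeneous mult.commute)

lemma hcomp_hcomp: "hcomp t (hcomp s p) = (if s = t then hcomp s p else 0)"
  by (rule hcomp_homogeneous) simp

lemma homogeneous_total_degree_le: "homogeneous t p \<Longrightarrow> t \<le> int D \<Longrightarrow> total_degree p \<le> D"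
  by (auto simp: total_degree_le_iff homogeneous_def)

lemma mon_at_scale: "mon_at a (\<chi> v. c * x $ v) = c ^ mon_degree a * mon_at a x"
  by (simp add: mon_at_def mon_degree_def power_mult_distrib prod.distrib power_sum)

lemma poly_at_homogeneous_scale:
  assumes "homogeneous (int t) p"
  shows "poly_at p (\<chi> v. c * x $ v) = c ^ t * poly_at p x"
proof -
  have "lookup p a * mon_at a (\<chi> v. c * x $ v) = c ^ t * (lookup p a * mon_at a x)" if "a \<in> keys p" for a
    using that assms by (auto simp: homogeneous_def mon_at_scale)
  then show ?thesis
    unfolding poly_at_alt[OF finite_keys order_refl] sum_distrib_left by (rule sum.cong[OF refl])
qed

section \<open>A multiplicative weight on monomials\<close>

text \<open>Distinct primes for the variables turn exponent vectors into positive integers, with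
  addition becoming multiplication.\<close>

lemma ex_inj_prime: "\<exists>f :: 'v::finite \<Rightarrow> nat. inj f \<and> (\<forall>v. prime (f v))"
proof -
  obtain B :: "nat set" where B: "finite B" "card B = card (UNIV :: 'v set)" "B \<subseteq> {p. prime p}"
    using infinite_arbitrarily_large[OF primes_infinite] by metis
  obtain h where "bij_betw h (UNIV :: 'v set) B"
    using finite_same_card_bij[OF finite B(1) B(2)[symmetric]] by blast
  then show ?thesis using B(3) by (auto simp: bij_betw_def intro!: exI[of _ h])
qed

definition var_prime :: "'v::finite \<Rightarrow> nat" where
  "var_prime = (SOME f. inj f \<and> (\<forall>v. prime (f v)))"

lemma inj_var_prime: "inj (var_prime :: 'v::finite \<Rightarrow> nat)"
  and prime_var_prime: "prime (var_prime (v :: 'v))"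
proof -
  have "inj (var_prime :: 'v \<Rightarrow> nat) \<and> (\<forall>v :: 'v. prime (var_prime v))"
    unfolding var_prime_def by (rule someI_ex[OF ex_inj_prime])
  then show "inj (var_prime :: 'v \<Rightarrow> nat)" "prime (var_prime (v :: 'v))" by auto
qed

text \<open>By unique factorization this orders the monomials by a well-order that is compatible with
  multiplication; it replaces a monomial order.\<close>
definition weight :: "('v::finite \<Rightarrow>\<^sub>0 nat) \<Rightarrow> nat" where
  "weight a = (\<Prod>v\<in>UNIV. var_prime v ^ lookup a v)"

lemma weight_add: "weight (a + b) = weight a * weight b"
  by (simp add: weight_def lookup_add power_add prod.distrib)

lemma weight_pos: "weight a > 0"
  unfolding weight_def by (intro prod_pos ballI zero_less_power prime_gt_0_nat prime_var_prime)

lemma multiplicity_weight: "multiplicity (var_prime v) (weight a) = lookup a v" for v :: "'v::finite"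
proof -
  have "weight a = (\<Prod>p\<in>range (var_prime :: 'v \<Rightarrow> nat). p ^ lookup a (inv var_prime p))"
    unfolding weight_def by (subst prod.reindex) (auto simp: inj_var_prime inv_f_f[OF inj_var_prime])
  also have "multiplicity (var_prime v) \<dots> = lookup a v"
    by (subst multiplicity_prod_prime_powers) (auto simp: prime_var_prime inj_var_prime)
  finally show ?thesis .
qed

lemma weight_inj: "weight a = weight b \<Longrightarrow> a = b"
  by (metis multiplicity_weight poly_mapping_eqI)

definition lead :: "'v::finite cpoly \<Rightarrow> ('v \<Rightarrow>\<^sub>0 nat)" where
  "lead p = (SOME a. a \<in> keys p \<and> (\<forall>b\<in>keys p. weight b \<le> weight a))"

lemma lead:
  assumes "p \<noteq> 0"
  shows "lead p \<in> keys p" "b \<in> keys p \<Longrightarrow> weight b \<le> weight (lead p)"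
proof -
  have "finite (weight ` keys p)" "weight ` keys p \<noteq> {}" using assms by auto
  from Max_in[OF this] obtain a where "a \<in> keys p" "weight a = Max (weight ` keys p)" by auto
  then have "\<exists>a. a \<in> keys p \<and> (\<forall>b\<in>keys p. weight b \<le> weight a)" by auto
  from someI_ex[OF this] show "lead p \<in> keys p" "b \<in> keys p \<Longrightarrow> weight b \<le> weight (lead p)"
    unfolding lead_def by auto
qed

text \<open>At this point the monomial with exponent \<open>a\<close> takes the value
  \<open>weight a ^ s\<close>, so for large \<open>s\<close> the leading monomial dominates all
  others.\<close>

definition prime_point :: "nat \<Rightarrow> complex^'v::finite" where
  "prime_point s = (\<chi> v. of_nat (var_prime v) ^ s)"

lemma mon_at_prime_point: "mon_at a (prime_point s) = of_nat (weight a) ^ s"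
proof -
  have "mon_at a (prime_point s) = (\<Prod>v\<in>UNIV. (of_nat (var_prime v) ^ lookup a v) ^ s)"
    unfolding mon_at_def prime_point_def by (rule prod.cong) (simp_all, metis mult.commute power_mult)
  also have "\<dots> = (of_nat (weight a)) ^ s"
    by (simp only: weight_def of_nat_prod of_nat_power prod_power_distrib)
  finally show ?thesis .
qed

text \<open>After division by the \<open>s\<close>-th power of the largest weight, every term but
  the leading one tends to 0, and the limit is the leading coefficient.\<close>

lemma eventually_poly_at_prime_point:
  assumes "p \<noteq> 0"
  shows "eventually (\<lambda>s. poly_at p (prime_point s) \<noteq> 0) sequentially"
proof -
  define w where "w = weight (lead p)"
  have w: "w > 0" by (simp add: w_def weight_pos)
  have "(\<lambda>s. \<Sum>a\<in>keys p. lookup p a * (of_nat (weight a) / of_nat w) ^ s) \<longlonglongrightarrow> (\<Sum>a\<in>keys p. if a = lead p then lookup p a else 0)"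
  proof (rule tendsto_sum)
    fix a assume a: "a \<in> keys p"
    show "(\<lambda>s. lookup p a * (of_nat (weight a) / of_nat w) ^ s) \<longlonglongrightarrow> (if a = lead p then lookup p a else 0)"
    proof (cases "a = lead p")
      case True
      then show ?thesis using w by (simp add: w_def)
    next
      case False
      have "weight a < w"
        using lead(2)[OF assms a] weight_inj[of a "lead p"] False by (force simp: w_def)
      then have "norm (of_nat (weight a) / of_nat w :: complex) < 1" by (simp add: norm_divide)
      from tendsto_mult[OF tendsto_const[of "lookup p a"] LIMSEQ_power_zero[OF this]]
      show ?thesis using False by simp
    qed
  qed
  moreover have "(\<Sum>a\<in>keys p. if a = lead p then lookup p a else 0) \<noteq> 0"
    using lead(1)[OF assms] by (simp add: in_keys_iff)
  ultimately have "eventually (\<lambda>s. (\<Sum>a\<in>keys p. lookup p a * (of_nat (weight a) / of_nat w) ^ s) \<noteq> 0) sequentially"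
    by (rule tendsto_imp_eventually_ne)
  then show ?thesis
  proof (rule eventually_mono)
    fix s assume *: "(\<Sum>a\<in>keys p. lookup p a * (of_nat (weight a) / of_nat w) ^ s) \<noteq> 0"
    have "(\<Sum>a\<in>keys p. lookup p a * (of_nat (weight a) / of_nat w) ^ s) = poly_at p (prime_point s) / of_nat w ^ s"
      by (simp add: poly_at_alt[OF finite_keys order_refl] mon_at_prime_point sum_divide_distrib power_divide)
    with * show "poly_at p (prime_point s) \<noteq> 0" by auto
  qed
qed

lemma ex_poly_at_nonzero: "p \<noteq> 0 \<Longrightarrow> \<exists>x. poly_at p x \<noteq> 0"
proof -
  assume "p \<noteq> 0"
  then obtain N where "\<forall>s\<ge>N. poly_at p (prime_point s) \<noteq> 0"
    using eventually_poly_at_prime_point[of p] unfolding eventually_sequentially by auto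
  then show ?thesis by blast
qed

text \<open>Each nonzero factor is nonzero at all late points \<open>prime_point s\<close>, so two
  such factors are nonzero at a common point, and so is their product.\<close>

lemma cpoly_mult_eq_0D:
  fixes p q :: "'v::finite cpoly"
  assumes "p * q = 0" shows "p = 0 \<or> q = 0"
proof (rule ccontr)
  assume "\<not> ?thesis"
  then have "eventually (\<lambda>s. poly_at p (prime_point s) \<noteq> 0 \<and> poly_at q (prime_point s) \<noteq> 0) sequentially"
    by (auto intro!: eventually_conj eventually_poly_at_prime_point)
  then obtain s where "poly_at p (prime_point s) \<noteq> 0" "poly_at q (prime_point s) \<noteq> 0"
    unfolding eventually_sequentially by auto
  then have "poly_at (p * q) (prime_point s) \<noteq> 0" by simp
  with assms show False by simp
qed

section \<open>Ideals and the basis theorem\<close>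

definition is_ideal :: "'v cpoly set \<Rightarrow> bool" where
  "is_ideal I \<longleftrightarrow> 0 \<in> I \<and> (\<forall>p\<in>I. \<forall>q\<in>I. p + q \<in> I) \<and> (\<forall>p\<in>I. \<forall>c. c * p \<in> I)"

lemma is_ideal_zero: "is_ideal I \<Longrightarrow> 0 \<in> I"
  and is_ideal_add: "is_ideal I \<Longrightarrow> p \<in> I \<Longrightarrow> q \<in> I \<Longrightarrow> p + q \<in> I"
  and is_ideal_mult: "is_ideal I \<Longrightarrow> p \<in> I \<Longrightarrow> c * p \<in> I"
  by (auto simp: is_ideal_def)

lemma is_ideal_mult_right: "is_ideal I \<Longrightarrow> p \<in> I \<Longrightarrow> p * c \<in> I"
  using is_ideal_mult by (metis mult.commute)

lemma is_ideal_uminus: "is_ideal I \<Longrightarrow> p \<in> I \<Longrightarrow> - p \<in> I"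
  using is_ideal_mult[of I p "-1"] by simp

lemma is_ideal_diff: "is_ideal I \<Longrightarrow> p \<in> I \<Longrightarrow> q \<in> I \<Longrightarrow> p - q \<in> I"
  using is_ideal_add[of I p "-q"] is_ideal_uminus[of I q] by simp

lemma is_ideal_sum: "is_ideal I \<Longrightarrow> (\<And>i. i \<in> A \<Longrightarrow> f i \<in> I) \<Longrightarrow> sum f A \<in> I"
  by (induction A rule: infinite_finite_induct) (auto intro: is_ideal_zero is_ideal_add)

lemma is_ideal_add_iff: "is_ideal I \<Longrightarrow> q \<in> I \<Longrightarrow> p + q \<in> I \<longleftrightarrow> p \<in> I"
  using is_ideal_add is_ideal_diff by (metis add_diff_cancel_right')

lemma is_ideal_eq_UNIV: "is_ideal I \<Longrightarrow> 1 \<in> I \<Longrightarrow> I = UNIV"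
  using is_ideal_mult[of I 1] by auto

lemma is_ideal_Cst: "is_ideal I \<Longrightarrow> Cst c \<in> I \<Longrightarrow> c \<noteq> 0 \<Longrightarrow> I = UNIV"
  using is_ideal_mult[of I "Cst c" "Cst (inverse c)"] is_ideal_eq_UNIV[of I] by (simp flip: Cst_mult)

definition adjoin :: "'v cpoly set \<Rightarrow> 'v cpoly \<Rightarrow> 'v cpoly set" where
  "adjoin I a = {p + c * a | p c. p \<in> I}"

lemma is_ideal_adjoin:
  assumes "is_ideal I" shows "is_ideal (adjoin I a)"
  unfolding is_ideal_def
proof (intro conjI ballI allI)
  have "0 = 0 + 0 * a \<and> 0 \<in> I" using is_ideal_zero[OF assms] by simp
  then show "0 \<in> adjoin I a" unfolding adjoin_def by blast
next
  fix p q assume "p \<in> adjoin I a" "q \<in> adjoin I a"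
  then obtain p' c q' e where "p = p' + c * a" "q = q' + e * a" "p' \<in> I" "q' \<in> I" by (auto simp: adjoin_def)
  then have "p + q = (p' + q') + (c + e) * a" "p' + q' \<in> I" by (auto simp: algebra_simps is_ideal_add[OF assms])
  then show "p + q \<in> adjoin I a" unfolding adjoin_def by blast
next
  fix p c assume "p \<in> adjoin I a"
  then obtain p' e where "p = p' + e * a" "p' \<in> I" by (auto simp: adjoin_def)
  then have "c * p = c * p' + (c * e) * a" "c * p' \<in> I" by (auto simp: algebra_simps is_ideal_mult[OF assms])
  then show "c * p \<in> adjoin I a" unfolding adjoin_def by blast
qed

lemma adjoin_superset: "I \<subseteq> adjoin I a"
proof
  fix p assume "p \<in> I"
  then have "p = p + 0 * a \<and> p \<in> I" by simp
  then show "p \<in> adjoin I a" unfolding adjoin_def by blast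
qed

lemma adjoin_self: "is_ideal I \<Longrightarrow> a \<in> adjoin I a"
  using is_ideal_zero[of I] unfolding adjoin_def by (metis (mono_tags, lifting) add.left_neutral mem_Collect_eq mult_1)

lemma adjoin_least: "is_ideal K \<Longrightarrow> I \<subseteq> K \<Longrightarrow> a \<in> K \<Longrightarrow> adjoin I a \<subseteq> K"
  unfolding adjoin_def by (auto intro: is_ideal_add is_ideal_mult)

section \<open>Dickson's lemma, the basis theorem and Noetherian induction\<close>

lemma nat_seq_mono_subseq:
  fixes s :: "nat \<Rightarrow> nat"
  shows "\<exists>r :: nat \<Rightarrow> nat. strict_mono r \<and> mono (\<lambda>i. s (r i))"
proof -
  obtain f where f: "strict_mono f" "monoseq (\<lambda>n. s (f n))" using seq_monosub[of s] by auto
  show ?thesis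
  proof (cases "mono (\<lambda>i. s (f i))")
    case True then show ?thesis using f by (intro exI[of _ f]) simp
  next
    case False
    then have dec: "\<And>i j. i \<le> j \<Longrightarrow> s (f j) \<le> s (f i)"
      using f(2) unfolding monoseq_def mono_def by auto
    \<comment> \<open>A decreasing sequence of naturals is constant from an index where it attains
      its minimum.\<close>
    obtain N where N: "\<And>i. s (f N) \<le> s (f i)"
      using ex_has_least_nat[of "\<lambda>_. True" 0 "\<lambda>i. s (f i)"] by auto
    have "s (f (N + i)) = s (f N)" for i using N dec[of N "N + i"] by (simp add: le_antisym)
    then have "mono (\<lambda>i. s (f (N + i)))" by (simp add: mono_def)
    moreover have "strict_mono (\<lambda>i. f (N + i))" using f(1) by (simp add: strict_mono_def)
    ultimately show ?thesis by blast
  qed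
qed

text \<open>Subsequences of monotone sequences stay monotone, so the sequence can be thinned out for
  one coordinate after another.\<close>

lemma dickson_subseq:
  fixes s :: "nat \<Rightarrow> 'v \<Rightarrow> nat"
  assumes "finite A"
  shows "\<exists>r :: nat \<Rightarrow> nat. strict_mono r \<and> (\<forall>v\<in>A. mono (\<lambda>i. s (r i) v))"
  using assms
proof (induction A)
  case empty
  show ?case by (intro exI[of _ "\<lambda>x. x"]) (simp add: strict_mono_def)
next
  case (insert x F)
  then obtain r :: "nat \<Rightarrow> nat" where r: "strict_mono r" "\<forall>v\<in>F. mono (\<lambda>i. s (r i) v)" by auto
  obtain q :: "nat \<Rightarrow> nat" where q: "strict_mono q" "mono (\<lambda>i. s (r (q i)) x)"
    using nat_seq_mono_subseq[of "\<lambda>i. s (r i) x"] by blast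
  have "mono (\<lambda>i. s (r (q i)) v)" if "v \<in> F" for v
    using r(2) that q(1) by (auto simp: mono_def strict_mono_less_eq)
  moreover have "strict_mono (\<lambda>i. r (q i))" using r(1) q(1) by (simp add: strict_mono_def)
  ultimately show ?case using q(2) by (intro exI[of _ "\<lambda>i. r (q i)"]) auto
qed

lemma dickson:
  fixes L :: "('v::finite \<Rightarrow>\<^sub>0 nat) set"
  shows "\<exists>L0. finite L0 \<and> L0 \<subseteq> L \<and> (\<forall>a\<in>L. \<exists>b\<in>L0. \<forall>v. lookup b v \<le> lookup a v)"
proof (rule ccontr)
  assume "\<not> ?thesis"
  then have no: "\<And>L0. finite L0 \<Longrightarrow> L0 \<subseteq> L \<Longrightarrow> \<exists>a\<in>L. \<forall>b\<in>L0. \<not> (\<forall>v. lookup b v \<le> lookup a v)"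
    by simp
  \<comment> \<open>If no finite subset suffices, terms can be chosen one by one so that no earlier
    term divides a later one. A coordinatewise monotone subsequence contradicts this.\<close>
  define P where "P f x r \<longleftrightarrow> r \<in> L \<and> (\<forall>i<x. \<not> (\<forall>v. lookup (f i) v \<le> lookup r v))" for f :: "nat \<Rightarrow> _" and x r
  have "\<exists>f. \<forall>x. P f x (f x)"
  proof (rule dependent_wellorder_choice)
    fix x and f :: "nat \<Rightarrow> ('v \<Rightarrow>\<^sub>0 nat)" assume "\<And>y. y < x \<Longrightarrow> P f y (f y)"
    then have "f ` {..<x} \<subseteq> L" by (auto simp: P_def)
    from no[OF _ this] show "\<exists>r. P f x r" unfolding P_def by auto
  qed (auto simp: P_def)
  then obtain f where "\<forall>x. P f x (f x)" by (rule exE)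
  then have f: "\<And>x. P f x (f x)" by simp
  obtain r :: "nat \<Rightarrow> nat" where r: "strict_mono r" "\<forall>v\<in>UNIV. mono (\<lambda>i. lookup (f (r i)) v)"
    using dickson_subseq[of UNIV "\<lambda>i. lookup (f i)"] by auto
  have "r 0 < r 1" using r(1) by (simp add: strict_mono_def)
  moreover have "\<forall>v. lookup (f (r 0)) v \<le> lookup (f (r 1)) v" using r(2) by (simp add: mono_def)
  ultimately show False using f[of "r 1"] unfolding P_def by auto
qed

text \<open>This is the division algorithm. Dickson's lemma picks finitely many leading exponents
  that divide all others; subtracting a multiple of the matching basis element lowers the weight of
  the leading exponent, and weights are natural numbers.\<close>

theorem hilbert_basis:
  fixes I :: "'v::finite cpoly set"
  assumes I: "is_ideal I"
  shows "\<exists>B. finite B \<and> B \<subseteq> I \<and> (\<forall>p\<in>I. \<exists>c. p = (\<Sum>b\<in>B. c b * b))"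
proof -
  obtain L0 where L0: "finite L0" "L0 \<subseteq> lead ` (I - {0})"
    "\<And>a. a \<in> lead ` (I - {0}) \<Longrightarrow> \<exists>b\<in>L0. \<forall>v. lookup b v \<le> lookup a v"
    using dickson[of "lead ` (I - {0})"] by auto
  have "\<forall>a\<in>L0. \<exists>p. p \<in> I \<and> p \<noteq> 0 \<and> lead p = a" using L0(2) by auto
  then obtain g where g: "\<And>a. a \<in> L0 \<Longrightarrow> g a \<in> I \<and> g a \<noteq> 0 \<and> lead (g a) = a" by metis
  define B where "B = g ` L0"
  have B: "finite B" "B \<subseteq> I" using L0(1) g by (auto simp: B_def)
  have comb: "\<exists>c. p = (\<Sum>b\<in>B. c b * b)" if "p \<in> I" "p \<noteq> 0 \<longrightarrow> weight (lead p) = n" for p n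
    using that
  proof (induction n arbitrary: p rule: less_induct)
    case (less n)
    show ?case
    proof (cases "p = 0")
      case True then show ?thesis by (intro exI[of _ "\<lambda>_. 0"]) simp
    next
      case False
      define a where "a = lead p"
      obtain b where b: "b \<in> L0" "\<forall>v. lookup b v \<le> lookup a v" using L0(3)[of a] False less.prems(1) by (auto simp: a_def)
      define e where "e = a - b"
      have ea: "a = e + b" by (rule poly_mapping_eqI) (use b(2) in \<open>simp add: e_def lookup_add lookup_minus\<close>)
      \<comment> \<open>The coefficient makes the terms at \<open>a\<close> cancel, and since
        \<open>weight\<close> is multiplicative no term of larger weight than \<open>a\<close>
        arises.\<close>
      define h where "h = single e (lookup p a / lookup (g b) b)"
      define q where "q = p - h * g b"
      have gb: "g b \<in> I" "g b \<noteq> 0" "lead (g b) = b" "g b \<in> B" using g[OF b(1)] b(1) by (auto simp: B_def)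
      have qI: "q \<in> I" unfolding q_def using less.prems(1) gb(1) I by (auto intro: is_ideal_diff is_ideal_mult)
      have "lookup (g b) b \<noteq> 0" using lead(1)[OF gb(2)] gb(3) by (simp add: in_keys_iff)
      then have qa: "lookup q a = 0" unfolding q_def h_def ea by (simp add: lookup_minus lookup_single_mult)
      have wq: "weight k \<le> weight a" if k: "k \<in> keys q" for k
      proof -
        have "k \<in> keys p \<or> k \<in> keys (h * g b)" using k unfolding q_def in_keys_iff lookup_minus by auto
        then show ?thesis
        proof
          assume "k \<in> keys p" then show ?thesis using lead(2)[OF False] by (simp add: a_def)
        next
          assume "k \<in> keys (h * g b)"
          then obtain k' where "k = e + k'" "k' \<in> keys (g b)" using keys_single_mult unfolding h_def by blast
          then show ?thesis using lead(2)[OF gb(2), of k'] gb(3) by (simp add: ea weight_add)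
        qed
      qed
      have small: "weight (lead q) < n" if "q \<noteq> 0"
      proof -
        have "lead q \<noteq> a" using lead(1)[OF that] qa by (auto simp: in_keys_iff)
        then have "weight (lead q) \<noteq> weight a" using weight_inj by blast
        then show ?thesis using wq[OF lead(1)[OF that]] less.prems(2) False by (simp add: a_def)
      qed
      have "\<exists>c. q = (\<Sum>b\<in>B. c b * b)"
      proof (cases "q = 0")
        case True then show ?thesis by (intro exI[of _ "\<lambda>_. 0"]) simp
      next
        case False
        then show ?thesis using less.IH[OF small[OF False] qI] by blast
      qed
      then obtain c where c: "q = (\<Sum>b\<in>B. c b * b)" by blast
      have "(\<Sum>x\<in>B. (c x + (if x = g b then h else 0)) * x) = q + h * g b"
      proof -
        have "(\<Sum>x\<in>B. (if x = g b then h else 0) * x) = (\<Sum>x\<in>B. if x = g b then h * g b else 0)"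
          by (rule sum.cong) auto
        also have "\<dots> = h * g b" using B(1) gb(4) by simp
        finally show ?thesis by (simp add: distrib_right sum.distrib c)
      qed
      then have "p = (\<Sum>x\<in>B. (c x + (if x = g b then h else 0)) * x)" by (simp add: q_def)
      then show ?thesis by (rule exI[of _ "\<lambda>x. c x + (if x = g b then h else 0)"])
    qed
  qed
  show ?thesis using B comb by (intro exI[of _ B]) auto
qed

text \<open>Otherwise there is a strictly increasing sequence of ideals; its union is generated by
  finitely many elements, which all lie in one member, and the sequence stops there.\<close>

lemma ideal_maximal_element:
  fixes \<I> :: "'v::finite cpoly set set"
  assumes "\<I> \<noteq> {}" "\<And>I. I \<in> \<I> \<Longrightarrow> is_ideal I"
  shows "\<exists>I\<in>\<I>. \<forall>K\<in>\<I>. I \<subseteq> K \<longrightarrow> K = I"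
proof (rule ccontr)
  assume "\<not> ?thesis"
  then have no: "\<And>I. I \<in> \<I> \<Longrightarrow> \<exists>K\<in>\<I>. I \<subset> K" by auto
  obtain I0 where "I0 \<in> \<I>" using assms by blast
  have "\<exists>f. \<forall>n::nat. f n \<in> \<I> \<and> f n \<subset> f (Suc n)"
    by (rule dependent_nat_choice) (use \<open>I0 \<in> \<I>\<close> no in auto)
  then obtain f :: "nat \<Rightarrow> 'v cpoly set" where "\<forall>n. f n \<in> \<I> \<and> f n \<subset> f (Suc n)" by (rule exE)
  then have f: "\<And>n. f n \<in> \<I>" "\<And>n. f n \<subset> f (Suc n)" by auto
  have mono: "i \<le> j \<Longrightarrow> f i \<subseteq> f j" for i j using lift_Suc_mono_le[of f i j] f(2) by blast
  define U where "U = (\<Union>n. f n)"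
  have "is_ideal U"
    unfolding is_ideal_def
  proof (intro conjI ballI allI)
    show "0 \<in> U" using assms(2)[OF f(1)[of 0]] is_ideal_zero by (auto simp: U_def)
  next
    fix p q assume "p \<in> U" "q \<in> U"
    then obtain i j where "p \<in> f i" "q \<in> f j" by (auto simp: U_def)
    then have "p \<in> f (max i j)" "q \<in> f (max i j)" using mono[of i "max i j"] mono[of j "max i j"] by auto
    then show "p + q \<in> U" using is_ideal_add[OF assms(2)[OF f(1)]] by (auto simp: U_def)
  next
    fix p c assume "p \<in> U"
    then show "c * p \<in> U" using is_ideal_mult[OF assms(2)[OF f(1)]] by (auto simp: U_def)
  qed
  from hilbert_basis[OF this]
  obtain B where B: "finite B" "B \<subseteq> U" "\<forall>p\<in>U. \<exists>c. p = (\<Sum>b\<in>B. c b * b)"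
    by (elim exE conjE)
  have "\<exists>N. B \<subseteq> f N"
    using B(1,2)
  proof (induction B)
    case (insert x F)
    then obtain N i where "F \<subseteq> f N" "x \<in> f i" by (auto simp: U_def)
    then have "insert x F \<subseteq> f (max N i)" using mono[of N "max N i"] mono[of i "max N i"] by auto
    then show ?case by blast
  qed auto
  then obtain N where N: "B \<subseteq> f N" by blast
  have "U \<subseteq> f N"
  proof
    fix p assume "p \<in> U"
    then obtain c where "p = (\<Sum>b\<in>B. c b * b)" using B(3) by auto
    then show "p \<in> f N" using N assms(2)[OF f(1)[of N]] by (auto intro!: is_ideal_sum is_ideal_mult)
  qed
  then have "f (Suc N) \<subseteq> f N" by (auto simp: U_def)
  with f(2)[of N] show False by blast
qed

lemma ideal_induct [consumes 1, case_names step]: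
  fixes I :: "'v::finite cpoly set"
  assumes "is_ideal I" and step: "\<And>I. is_ideal I \<Longrightarrow> (\<And>K. is_ideal K \<Longrightarrow> I \<subset> K \<Longrightarrow> P K) \<Longrightarrow> P I"
  shows "P I"
proof (rule ccontr)
  assume "\<not> P I"
  then have "{I. is_ideal I \<and> \<not> P I} \<noteq> {}" using assms(1) by blast
  from ideal_maximal_element[OF this]
  obtain M where M: "is_ideal M" "\<not> P M" "\<forall>K. is_ideal K \<and> \<not> P K \<longrightarrow> M \<subseteq> K \<longrightarrow> K = M"
    by auto
  have "P K" if "is_ideal K" "M \<subset> K" for K using M(3) that by auto
  from step[OF M(1) this] M(2) show False by simp
qed

section \<open>Submodules of free modules\<close>

definition smul :: "'v cpoly \<Rightarrow> (nat \<Rightarrow> 'v cpoly) \<Rightarrow> (nat \<Rightarrow> 'v cpoly)" where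
  "smul p u = (\<lambda>i. p * u i)"

lemma smul_apply: "smul p u i = p * u i"
  by (simp add: smul_def)

interpretation fmod: module "smul :: 'v cpoly \<Rightarrow> _"
  by standard (auto simp: fun_eq_iff algebra_simps smul_apply)

lemma sum_fun_apply [simp]: "sum f A x = (\<Sum>i\<in>A. f i x)" for f :: "'i \<Rightarrow> 'b \<Rightarrow> 'c::comm_monoid_add"
  by (induction A rule: infinite_finite_induct) auto

text \<open>Induction on the rank. The last coordinates form an ideal; lifts of its generators,
  together with generators of the submodule where the last coordinate vanishes, generate the
  whole.\<close>

lemma submodule_finitely_generated:
  fixes M :: "(nat \<Rightarrow> 'v::finite cpoly) set"
  assumes "fmod.subspace M" "\<And>u i. u \<in> M \<Longrightarrow> r \<le> i \<Longrightarrow> u i = 0"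
  shows "\<exists>B. finite B \<and> B \<subseteq> M \<and> M \<subseteq> fmod.span B"
  using assms
proof (induction r arbitrary: M)
  case 0
  then have "M \<subseteq> {0}" by (auto simp: fun_eq_iff)
  then show ?case unfolding fmod.span_empty[symmetric] by blast
next
  case (Suc r)
  define I where "I = (\<lambda>u. u r) ` M"
  have I: "is_ideal I"
    unfolding is_ideal_def
  proof (intro conjI ballI allI)
    show "0 \<in> I" unfolding I_def by (rule image_eqI[OF _ fmod.subspace_0[OF Suc.prems(1)]]) simp
  next
    fix p q assume "p \<in> I" "q \<in> I"
    then obtain u w where "u \<in> M" "w \<in> M" "p = u r" "q = w r" by (auto simp: I_def)
    moreover from this have "u + w \<in> M" using fmod.subspace_add[OF Suc.prems(1)] by blast
    ultimately show "p + q \<in> I" unfolding I_def by (intro image_eqI[of _ _ "u + w"]) simp_all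
  next
    fix p c assume "p \<in> I"
    then obtain u where "u \<in> M" "p = u r" by (auto simp: I_def)
    moreover from this have "smul c u \<in> M" using fmod.subspace_scale[OF Suc.prems(1)] by blast
    ultimately show "c * p \<in> I" unfolding I_def by (intro image_eqI[of _ _ "smul c u"]) (simp_all add: smul_apply)
  qed
  from hilbert_basis[OF I]
  obtain B where B: "finite B" "B \<subseteq> I" "\<forall>p\<in>I. \<exists>c. p = (\<Sum>b\<in>B. c b * b)"
    by (elim exE conjE)
  have "\<forall>b\<in>B. \<exists>u. u \<in> M \<and> u r = b" using B(2) by (auto simp: I_def)
  then obtain l where l: "\<And>b. b \<in> B \<Longrightarrow> l b \<in> M \<and> l b r = b" by metis
  define M' where "M' = {u\<in>M. u r = 0}"
  have "fmod.subspace M'"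
    using Suc.prems(1) unfolding fmod.subspace_def M'_def by (auto simp: smul_apply)
  moreover have "u i = 0" if "u \<in> M'" "r \<le> i" for u i
    using that Suc.prems(2)[of u i] by (cases "i = r") (auto simp: M'_def)
  ultimately obtain B' where B': "finite B'" "B' \<subseteq> M'" "M' \<subseteq> fmod.span B'"
    using Suc.IH[of M'] by blast
  have "M \<subseteq> fmod.span (B' \<union> l ` B)"
  proof
    fix u assume u: "u \<in> M"
    then have "u r \<in> I" by (simp add: I_def)
    with B(3) obtain c where c: "u r = (\<Sum>b\<in>B. c b * b)" by auto
    define w where "w = (\<Sum>b\<in>B. smul (c b) (l b))"
    have "w \<in> M" unfolding w_def using l Suc.prems(1) by (intro fmod.subspace_sum fmod.subspace_scale) auto
    moreover have "w r = u r" using l by (simp add: w_def c smul_apply)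
    ultimately have "u - w \<in> M'" using u Suc.prems(1) by (simp add: M'_def fmod.subspace_diff)
    then have "u - w \<in> fmod.span (B' \<union> l ` B)" using B'(3) fmod.span_mono[OF Un_upper1, of B' "l ` B"] by blast
    moreover have "w \<in> fmod.span (B' \<union> l ` B)"
      unfolding w_def by (intro fmod.span_sum fmod.span_scale fmod.span_base) auto
    ultimately show "u \<in> fmod.span (B' \<union> l ` B)" using fmod.span_add by fastforce
  qed
  then show ?case using B'(1,2) B(1) l by (intro exI[of _ "B' \<union> l ` B"]) (auto simp: M'_def)
qed

section \<open>Prime ideals and the Nullstellensatz\<close>

definition is_prime :: "'v cpoly set \<Rightarrow> bool" where
  "is_prime Q \<longleftrightarrow> is_ideal Q \<and> 1 \<notin> Q \<and> (\<forall>p q. p * q \<in> Q \<longrightarrow> p \<in> Q \<or> q \<in> Q)"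

definition vanishing_ideal :: "(complex^'v::finite) set \<Rightarrow> 'v cpoly set" where
  "vanishing_ideal Z = {p. \<forall>z\<in>Z. poly_at p z = 0}"

definition zero_set :: "'v::finite cpoly set \<Rightarrow> (complex^'v) set" where
  "zero_set I = {x. \<forall>p\<in>I. poly_at p x = 0}"

lemma is_prime_ideal: "is_prime Q \<Longrightarrow> is_ideal Q"
  and is_prime_one: "is_prime Q \<Longrightarrow> 1 \<notin> Q"
  and is_prime_multD: "is_prime Q \<Longrightarrow> p * q \<in> Q \<Longrightarrow> p \<in> Q \<or> q \<in> Q"
  by (auto simp: is_prime_def)

lemma is_prime_powerD: "is_prime Q \<Longrightarrow> p ^ k \<in> Q \<Longrightarrow> p \<in> Q"
  by (induction k) (auto simp: is_prime_one dest: is_prime_multD)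

lemma is_prime_prodD: "is_prime Q \<Longrightarrow> prod f A \<in> Q \<Longrightarrow> \<exists>i\<in>A. f i \<in> Q"
  by (induction A rule: infinite_finite_induct) (auto simp: is_prime_one dest: is_prime_multD)

lemma is_prime_CstD: "is_prime Q \<Longrightarrow> Cst c \<in> Q \<Longrightarrow> c = 0"
  using is_ideal_Cst is_prime_ideal is_prime_one by blast

lemma is_ideal_vanishing_ideal: "is_ideal (vanishing_ideal Z)"
  by (auto simp: is_ideal_def vanishing_ideal_def)

text \<open>An ideal maximal among those that contain \<open>I\<close> and miss \<open>M\<close> is
  prime. The last clause records the maximality: every \<open>a\<close> outside \<open>Q\<close>
  divides an element of \<open>M\<close> modulo \<open>Q\<close>, which is how the Nullstellensatz
  obtains inverses.\<close>

lemma prime_avoiding: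
  fixes I :: "'v::finite cpoly set"
  assumes I: "is_ideal I" and M: "1 \<in> M" "\<And>p q. p \<in> M \<Longrightarrow> q \<in> M \<Longrightarrow> p * q \<in> M" and "I \<inter> M = {}"
  shows "\<exists>Q. is_prime Q \<and> I \<subseteq> Q \<and> Q \<inter> M = {} \<and> (\<forall>a. a \<notin> Q \<longrightarrow> (\<exists>s\<in>M. \<exists>r. s - r * a \<in> Q))"
proof -
  define \<I> where "\<I> = {K. is_ideal K \<and> I \<subseteq> K \<and> K \<inter> M = {}}"
  have "\<I> \<noteq> {}" using assms by (auto simp: \<I>_def)
  from ideal_maximal_element[OF this]
  obtain Q where Q: "Q \<in> \<I>" "\<forall>K\<in>\<I>. Q \<subseteq> K \<longrightarrow> K = Q"
    by (auto simp: \<I>_def)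
  then have Q': "is_ideal Q" "I \<subseteq> Q" "Q \<inter> M = {}" by (auto simp: \<I>_def)
  have max: "\<exists>s\<in>M. \<exists>r. s - r * a \<in> Q" if "a \<notin> Q" for a
  proof -
    have "adjoin Q a \<noteq> Q" using adjoin_self[OF Q'(1), of a] that by auto
    then have "adjoin Q a \<notin> \<I>" using Q(2) adjoin_superset by blast
    then have "adjoin Q a \<inter> M \<noteq> {}"
      using is_ideal_adjoin[OF Q'(1)] adjoin_superset[of Q a] Q'(2) by (auto simp: \<I>_def)
    then obtain s r q where "s \<in> M" "q \<in> Q" "s = q + r * a" by (auto simp: adjoin_def)
    then have "s - r * a = q" by simp
    then show ?thesis using \<open>s \<in> M\<close> \<open>q \<in> Q\<close> by metis
  qed
  have "is_prime Q"
    unfolding is_prime_def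
  proof (intro conjI allI impI)
    show "is_ideal Q" by fact
    show "1 \<notin> Q" using Q'(3) M(1) by auto
    fix p q assume pq: "p * q \<in> Q"
    show "p \<in> Q \<or> q \<in> Q"
    proof (rule ccontr)
      assume "\<not> ?thesis"
      then obtain s r s' r' where s: "s \<in> M" "s - r * p \<in> Q" "s' \<in> M" "s' - r' * q \<in> Q"
        using max[of p] max[of q] by auto
      have "s * s' = (s - r * p) * s' + r * p * (s' - r' * q) + r * r' * (p * q)"
        by (simp add: algebra_simps)
      also have "\<dots> \<in> Q"
        by (rule is_ideal_add[OF Q'(1) is_ideal_add[OF Q'(1) is_ideal_mult_right[OF Q'(1) s(2)]
              is_ideal_mult[OF Q'(1) s(4)]] is_ideal_mult[OF Q'(1) pq]])
      finally show False using M(2)[OF s(1,3)] Q'(3) by blast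
    qed
  qed
  then show ?thesis using Q' max by (intro exI[of _ Q]) auto
qed

section \<open>Linear relations from uncountability, and the Nullstellensatz\<close>

lemma linear_relation:
  fixes M :: "'e \<Rightarrow> 'b \<Rightarrow> complex"
  assumes "finite B" "finite E" "card B < card E"
  shows "\<exists>c. (\<exists>e\<in>E. c e \<noteq> 0) \<and> (\<forall>b\<in>B. (\<Sum>e\<in>E. c e * M e b) = 0)"
  using assms
proof (induction B arbitrary: E M)
  case empty
  then have "E \<noteq> {}" by auto
  then show ?case by (intro exI[of _ "\<lambda>_. 1"]) auto
next
  case (insert b B)
  show ?case
  proof (cases "\<forall>e\<in>E. M e b = 0")
    case True
    obtain c where "\<exists>e\<in>E. c e \<noteq> 0" "\<forall>b\<in>B. (\<Sum>e\<in>E. c e * M e b) = 0"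
      using insert.IH[of E M] insert.prems insert.hyps by auto
    then show ?thesis using True by (intro exI[of _ c]) auto
  next
    case False
    then obtain e0 where e0: "e0 \<in> E" "M e0 b \<noteq> 0" by auto
    \<comment> \<open>Gaussian elimination: the pivot \<open>e0\<close> clears the coordinate
      \<open>b\<close> from all other vectors, and its own coefficient is restored
      afterwards.\<close>
    define E' where "E' = E - {e0}"
    define t where "t e = M e b / M e0 b" for e
    have E': "finite E'" "card B < card E'" using insert.prems insert.hyps e0 by (auto simp: E'_def)
    then obtain c where c: "\<exists>e\<in>E'. c e \<noteq> 0" "\<forall>x\<in>B. (\<Sum>e\<in>E'. c e * (M e x - t e * M e0 x)) = 0"
      using insert.IH[of E' "\<lambda>e x. M e x - t e * M e0 x"] by auto
    define c' where "c' = c(e0 := - (\<Sum>e\<in>E'. c e * t e))"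
    have split: "(\<Sum>e\<in>E. c' e * M e x) = (\<Sum>e\<in>E'. c e * M e x) - (\<Sum>e\<in>E'. c e * t e) * M e0 x" for x
    proof -
      have "(\<Sum>e\<in>E. c' e * M e x) = c' e0 * M e0 x + (\<Sum>e\<in>E'. c' e * M e x)"
        unfolding E'_def using insert.prems(1) e0(1) by (rule sum.remove)
      also have "(\<Sum>e\<in>E'. c' e * M e x) = (\<Sum>e\<in>E'. c e * M e x)"
        by (rule sum.cong) (auto simp: c'_def E'_def)
      finally show ?thesis by (simp add: c'_def)
    qed
    have "(\<Sum>e\<in>E. c' e * M e x) = 0" if "x \<in> insert b B" for x
    proof (cases "x = b")
      case True
      then show ?thesis using e0(2) unfolding split by (simp add: t_def sum_distrib_right)
    next
      case False
      then have "(\<Sum>e\<in>E'. c e * (M e x - t e * M e0 x)) = 0" using c(2) that by auto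
      then show ?thesis unfolding split by (simp add: algebra_simps sum_subtractf sum_distrib_right sum_distrib_left)
    qed
    moreover have "\<exists>e\<in>E. c' e \<noteq> 0" using c(1) by (auto simp: c'_def E'_def)
    ultimately show ?thesis by blast
  qed
qed

text \<open>There are countably many pairs of a key and a degree, but uncountably many reals. So
  infinitely many of the \<open>r c\<close> share both, and these lie in a space of finite
  dimension. In the Nullstellensatz the key is the exponent of the power of \<open>g\<close> that
  belongs to \<open>r c\<close>.\<close>

lemma uncountable_relation:
  fixes r :: "real \<Rightarrow> 'v::finite cpoly" and key :: "real \<Rightarrow> nat"
  shows "\<exists>E a k. finite E \<and> (\<exists>c\<in>E. a c \<noteq> 0) \<and> (\<Sum>c\<in>E. Cst (a c) * r c) = 0 \<and> (\<forall>c\<in>E. key c = k)"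
proof -
  define F where "F k D = {c. key c = k \<and> total_degree (r c) = D}" for k D
  have "\<exists>k D. infinite (F k D)"
  proof (rule ccontr)
    assume "\<not> ?thesis"
    then have "\<And>k D. countable (F k D)" by (auto intro: countable_finite)
    then have "countable (\<Union>k. \<Union>D. F k D)" by simp
    moreover have "(\<Union>k. \<Union>D. F k D) = UNIV" by (auto simp: F_def)
    ultimately show False using uncountable_UNIV_real by simp
  qed
  then obtain k D where inf: "infinite (F k D)" by blast
  define B where "B = {a :: 'v \<Rightarrow>\<^sub>0 nat. mon_degree a \<le> D}"
  obtain E where E: "finite E" "card E = Suc (card B)" "E \<subseteq> F k D"
    using infinite_arbitrarily_large[OF inf] by blast
  have "finite B" unfolding B_def by (rule finite_mon_degree_le)
  from linear_relation[OF this E(1), of "\<lambda>e b. lookup (r e) b"] obtain a where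
    a: "\<exists>e\<in>E. a e \<noteq> 0" "\<forall>b\<in>B. (\<Sum>e\<in>E. a e * lookup (r e) b) = 0" using E(2) by auto
  have "(\<Sum>c\<in>E. Cst (a c) * r c) = 0"
  proof (rule poly_mapping_eqI)
    fix b
    have "lookup (\<Sum>c\<in>E. Cst (a c) * r c) b = (\<Sum>e\<in>E. a e * lookup (r e) b)" by (simp add: lookup_sum)
    also have "\<dots> = 0"
    proof (cases "b \<in> B")
      case False
      have "lookup (r e) b = 0" if "e \<in> E" for e
      proof -
        have "total_degree (r e) = D" using that E(3) by (auto simp: F_def)
        then show ?thesis using False mon_degree_le_total_degree[of b "r e"] by (auto simp: B_def in_keys_iff)
      qed
      then show ?thesis by simp
    qed (use a in auto)
    finally show "lookup (\<Sum>c\<in>E. Cst (a c) * r c) b = lookup 0 b" by simp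
  qed
  then show ?thesis using E(1,3) a(1) by (intro exI[of _ E] exI[of _ a] exI[of _ k]) (auto simp: F_def)
qed

text \<open>Modulo \<open>Q\<close>, \<open>r c\<close> stands for the fraction
  \<open>s c / (x - c)\<close>. The relation between these fractions is multiplied by the product of
  all \<open>x - c\<close>.\<close>

lemma clear_denominators:
  fixes Q :: "'v::finite cpoly set" and s r :: "real \<Rightarrow> 'v cpoly"
  assumes "is_ideal Q" "finite E" "(\<Sum>c\<in>E. Cst (a c) * r c) = 0"
    and "\<And>c. c \<in> E \<Longrightarrow> s c - r c * (x - Cst (of_real c)) \<in> Q"
  shows "(\<Sum>c\<in>E. Cst (a c) * s c * (\<Prod>c'\<in>E - {c}. x - Cst (of_real c'))) \<in> Q"
proof -
  let ?P = "\<Prod>c'\<in>E. x - Cst (of_real c')"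
  let ?P' = "\<lambda>c. \<Prod>c'\<in>E - {c}. x - Cst (of_real c')"
  have P: "?P = (x - Cst (of_real c)) * ?P' c" if "c \<in> E" for c
    using assms(2) that by (rule prod.remove)
  have "(\<Sum>c\<in>E. Cst (a c) * (s c - r c * (x - Cst (of_real c))) * ?P' c) \<in> Q"
    using assms(1,4) by (intro is_ideal_sum is_ideal_mult_right is_ideal_mult) auto
  also have "(\<Sum>c\<in>E. Cst (a c) * (s c - r c * (x - Cst (of_real c))) * ?P' c)
      = (\<Sum>c\<in>E. Cst (a c) * s c * ?P' c - Cst (a c) * r c * ?P)"
    by (rule sum.cong[OF refl]) (simp add: P algebra_simps)
  also have "\<dots> = (\<Sum>c\<in>E. Cst (a c) * s c * ?P' c)"
    using assms(3) by (simp add: sum_subtractf flip: sum_distrib_right)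
  finally show ?thesis .
qed

definition upoly_at :: "'v cpoly \<Rightarrow> complex poly \<Rightarrow> 'v cpoly" where
  "upoly_at x p = poly (map_poly Cst p) x"

lemma upoly_at_pCons [simp]: "upoly_at x (pCons a p) = Cst a + x * upoly_at x p"
  by (simp add: upoly_at_def map_poly_pCons)

lemma upoly_at_0 [simp]: "upoly_at x 0 = 0"
  by (simp add: upoly_at_def)

lemma upoly_at_1 [simp]: "upoly_at x 1 = 1"
  using upoly_at_pCons[of x 1 0] by (simp add: one_pCons)

lemma upoly_at_add [simp]: "upoly_at x (p + q) = upoly_at x p + upoly_at x q" for x :: "'v cpoly"
proof -
  have "map_poly (Cst :: _ \<Rightarrow> 'v cpoly) (p + q) = map_poly Cst p + map_poly Cst q"
    by (rule poly_eqI) (simp add: coeff_map_poly Cst_add)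
  then show ?thesis by (simp add: upoly_at_def)
qed

lemma upoly_at_smult [simp]: "upoly_at x (smult a p) = Cst a * upoly_at x p" for x :: "'v cpoly"
proof -
  have "map_poly (Cst :: _ \<Rightarrow> 'v cpoly) (smult a p) = smult (Cst a) (map_poly Cst p)"
    by (rule poly_eqI) (simp add: coeff_map_poly Cst_mult)
  then show ?thesis by (simp add: upoly_at_def)
qed

lemma upoly_at_mult [simp]: "upoly_at x (p * q) = upoly_at x p * upoly_at x q"
  by (induction p) (auto simp: algebra_simps)

lemma upoly_at_sum: "upoly_at x (sum f A) = (\<Sum>i\<in>A. upoly_at x (f i))"
  by (induction A rule: infinite_finite_induct) auto

lemma upoly_at_prod: "upoly_at x (prod f A) = (\<Prod>i\<in>A. upoly_at x (f i))"
  by (induction A rule: infinite_finite_induct) auto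

text \<open>Over the complex numbers \<open>p\<close> splits into linear factors, and a prime ideal
  that contains the product contains the value of one of them.\<close>

lemma prime_contains_linear:
  assumes Q: "is_prime Q" and "p \<noteq> 0" "upoly_at x p \<in> Q"
  shows "\<exists>c. x - Cst c \<in> Q"
  using assms(2,3)
proof (induction "degree p" arbitrary: p)
  case 0
  then obtain a where "p = [:a:]" by (metis degree_eq_zeroE)
  then show ?case using 0 is_prime_CstD[OF Q, of a] by auto
next
  case (Suc d)
  have "\<not> constant (poly p)" using Suc.hyps(2) by (simp add: constant_degree)
  then obtain z where "poly p z = 0" using fundamental_theorem_of_algebra by blast
  then obtain q where q: "p = [:- z, 1:] * q" by (auto simp: poly_eq_0_iff_dvd)
  have "q \<noteq> 0" using q Suc.prems by auto
  have "degree p = Suc (degree q)" unfolding q using \<open>q \<noteq> 0\<close> by (subst degree_mult_eq) auto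
  have "upoly_at x p = (x - Cst z) * upoly_at x q" unfolding q upoly_at_mult by (simp add: Cst_uminus)
  then have "x - Cst z \<in> Q \<or> upoly_at x q \<in> Q" using Suc.prems(2) is_prime_multD[OF Q] by metis
  then show ?case using Suc.hyps(1)[of q] \<open>q \<noteq> 0\<close> \<open>degree p = Suc (degree q)\<close> Suc.hyps(2) by auto
qed

lemma cpoly_eqI: "(\<And>x. poly_at p x = poly_at q x) \<Longrightarrow> p = q"
  using ex_poly_at_nonzero[of "p - q"] by auto

lemma single_eq_prod_Var: "single a 1 = (\<Prod>v\<in>UNIV. Var v ^ lookup a v)" for a :: "'v::finite \<Rightarrow>\<^sub>0 nat"
  by (rule cpoly_eqI) (simp add: poly_at_single mon_at_def)

lemma cpoly_induct [case_names Cst Var add mult]: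
  fixes p :: "'v::finite cpoly"
  assumes "\<And>c. P (Cst c)" "\<And>v. P (Var v)" "\<And>p q. P p \<Longrightarrow> P q \<Longrightarrow> P (p + q)" "\<And>p q. P p \<Longrightarrow> P q \<Longrightarrow> P (p * q)"
  shows "P p"
proof -
  have pow: "P (q ^ k)" if "P q" for q k
    using assms(1)[of 1] that by (induction k) (auto intro: assms)
  have prod: "P (prod f A)" if "\<And>i. P (f i)" for f and A :: "'v set"
    using assms(1)[of 1] that by (induction A rule: infinite_finite_induct) (auto intro: assms)
  have sing: "P (single a c)" for a c
    by (subst single_eq_Cst_mult, subst single_eq_prod_Var) (intro assms prod pow)
  have sum: "P (sum f A)" if "\<And>i. P (f i)" for f and A :: "('v \<Rightarrow>\<^sub>0 nat) set"
    using assms(1)[of 0] that by (induction A rule: infinite_finite_induct) (auto intro: assms)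
  show ?thesis by (subst sum_single_keys_self) (intro sum sing)
qed

text \<open>If no power of \<open>g\<close> lies in \<open>I\<close>, take a prime \<open>Q\<close>
  over \<open>I\<close> that is maximal among the ideals missing these powers. Uncountability forces
  every variable to be constant modulo \<open>Q\<close>, so \<open>Q\<close> is the ideal of a zero
  \<open>y\<close> of \<open>I\<close>; as \<open>g\<close> vanishes at \<open>y\<close>, it lies in
  \<open>Q\<close>, a contradiction.\<close>

theorem nullstellensatz:
  fixes I :: "'v::finite cpoly set"
  assumes I: "is_ideal I" and g: "\<And>x. x \<in> zero_set I \<Longrightarrow> poly_at g x = 0"
  shows "\<exists>k. g ^ k \<in> I"
proof (rule ccontr)
  assume no: "\<not> ?thesis"
  define M where "M = range (\<lambda>k. g ^ k)"
  have "1 \<in> M" unfolding M_def by (rule range_eqI[of _ _ 0]) simp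
  moreover have "p * q \<in> M" if "p \<in> M" "q \<in> M" for p q
    using that by (auto simp: M_def simp flip: power_add)
  moreover have "I \<inter> M = {}" using no by (auto simp: M_def)
  ultimately have "\<exists>Q. is_prime Q \<and> I \<subseteq> Q \<and> Q \<inter> M = {} \<and> (\<forall>a. a \<notin> Q \<longrightarrow> (\<exists>s\<in>M. \<exists>r. s - r * a \<in> Q))"
    by (rule prime_avoiding[OF I])
  then obtain Q where Q: "is_prime Q" "I \<subseteq> Q" "Q \<inter> M = {}" "\<forall>a. a \<notin> Q \<longrightarrow> (\<exists>s\<in>M. \<exists>r. s - r * a \<in> Q)"
    by (elim exE conjE)
  note idl = is_prime_ideal[OF Q(1)]
  have gk: "g ^ k \<notin> Q" for k using Q(3) by (auto simp: M_def)
  have lin: "\<exists>c. Var v - Cst c \<in> Q" for v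
  proof (rule ccontr)
    assume none: "\<not> ?thesis"
    then have "\<forall>c::real. \<exists>k r. g ^ k - r * (Var v - Cst (of_real c)) \<in> Q"
      using Q(4) unfolding M_def by auto
    then have "\<exists>k r. \<forall>c::real. g ^ k c - r c * (Var v - Cst (of_real c)) \<in> Q" by metis
    then obtain k r where kr: "\<forall>c::real. g ^ k c - r c * (Var v - Cst (of_real c)) \<in> Q" by (elim exE)
    obtain E a k0 where E: "finite E" "\<exists>c\<in>E. a c \<noteq> 0" "(\<Sum>c\<in>E. Cst (a c) * r c) = 0" "\<forall>c\<in>E. k c = k0"
      using uncountable_relation[of r k] by auto
    \<comment> \<open>The numerator of the sum of the fractions \<open>a c / (x - c)\<close>. At
      \<open>c0\<close> only the summand for \<open>c0\<close> survives, hence it is not the zero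
      polynomial.\<close>
    define q where "q = (\<Sum>c\<in>E. smult (a c) (\<Prod>c'\<in>E - {c}. [:- of_real c', 1:]))"
    have "(\<Sum>c\<in>E. Cst (a c) * g ^ k0 * (\<Prod>c'\<in>E - {c}. Var v - Cst (of_real c'))) \<in> Q"
    proof (rule clear_denominators[OF idl E(1,3)])
      fix c assume "c \<in> E"
      then show "g ^ k0 - r c * (Var v - Cst (of_real c)) \<in> Q" using kr E(4) by metis
    qed
    also have "(\<Sum>c\<in>E. Cst (a c) * g ^ k0 * (\<Prod>c'\<in>E - {c}. Var v - Cst (of_real c'))) = g ^ k0 * upoly_at (Var v) q"
      by (simp add: q_def upoly_at_sum upoly_at_prod Cst_uminus sum_distrib_left mult_ac)
    finally have "upoly_at (Var v) q \<in> Q" using is_prime_multD[OF Q(1)] gk by blast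
    moreover have "q \<noteq> 0"
    proof -
      obtain c0 where c0: "c0 \<in> E" "a c0 \<noteq> 0" using E(2) by blast
      have z: "(\<Prod>c'\<in>E - {c}. of_real c0 - of_real c') = (0::complex)" if "c \<in> E - {c0}" for c
        using that c0(1) E(1) by (intro prod_zero) auto
      have "poly q (of_real c0) = (\<Sum>c\<in>E. a c * (\<Prod>c'\<in>E - {c}. of_real c0 - of_real c'))"
        by (simp add: q_def poly_sum poly_prod)
      also have "\<dots> = a c0 * (\<Prod>c'\<in>E - {c0}. of_real c0 - of_real c') + (\<Sum>c\<in>E - {c0}. a c * (\<Prod>c'\<in>E - {c}. of_real c0 - of_real c'))"
        using E(1) c0(1) by (rule sum.remove)
      also have "\<dots> = a c0 * (\<Prod>c'\<in>E - {c0}. of_real c0 - of_real c')" using z by simp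
      also have "\<dots> \<noteq> 0" using c0 E(1) by auto
      finally show ?thesis by auto
    qed
    ultimately show False using prime_contains_linear[OF Q(1)] none by blast
  qed
  then have "\<exists>c. \<forall>v. Var v - Cst (c v) \<in> Q" by metis
  then obtain c where c: "\<forall>v. Var v - Cst (c v) \<in> Q" by (elim exE)
  define y where "y = (\<chi> v. c v)"
  \<comment> \<open>Modulo \<open>Q\<close> every polynomial equals its value at \<open>y\<close>,
    since the variables do.\<close>
  have ev: "p - Cst (poly_at p y) \<in> Q" for p
  proof (induction p rule: cpoly_induct)
    case (Cst c)
    then show ?case by (simp add: is_ideal_zero[OF idl])
  next
    case (Var v)
    then show ?case using c by (simp add: y_def)
  next
    case (add p q)
    then show ?case using is_ideal_add[OF idl add] by (simp add: Cst_add algebra_simps)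
  next
    case (mult p q)
    have "p * q - Cst (poly_at (p * q) y) = (p - Cst (poly_at p y)) * q + Cst (poly_at p y) * (q - Cst (poly_at q y))"
      by (simp add: Cst_mult algebra_simps)
    then show ?case using mult by (simp add: is_ideal_add[OF idl] is_ideal_mult[OF idl] is_ideal_mult_right[OF idl])
  qed
  have inQ: "p \<in> Q \<Longrightarrow> poly_at p y = 0" for p
  proof -
    assume "p \<in> Q"
    from is_ideal_diff[OF idl this ev[of p]] show ?thesis using is_prime_CstD[OF Q(1)] by simp
  qed
  then have "y \<in> zero_set I" using Q(2) unfolding zero_set_def by auto
  then have "g \<in> Q" using ev[of g] g by simp
  then show False using gk[of 1] by simp
qed

section \<open>Irreducible varieties, components and prime ideals\<close>

lemma vanishing_ideal_zero_set: "is_prime Q \<Longrightarrow> vanishing_ideal (zero_set Q) = Q"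
proof
  assume Q: "is_prime Q"
  show "Q \<subseteq> vanishing_ideal (zero_set Q)" by (auto simp: vanishing_ideal_def zero_set_def)
  show "vanishing_ideal (zero_set Q) \<subseteq> Q"
  proof
    fix p assume "p \<in> vanishing_ideal (zero_set Q)"
    then have "\<exists>k. p ^ k \<in> Q" by (intro nullstellensatz[OF is_prime_ideal[OF Q]]) (auto simp: vanishing_ideal_def)
    then show "p \<in> Q" using is_prime_powerD[OF Q] by blast
  qed
qed

lemma zero_set_vanishing_ideal: "affine_variety V \<Longrightarrow> zero_set (vanishing_ideal V) = V"
  unfolding affine_variety_def zero_set_def vanishing_ideal_def by blast

lemma affine_variety_zero_set: "affine_variety (zero_set I)"
  unfolding affine_variety_def zero_set_def by blast

lemma vanishing_ideal_mono: "A \<subseteq> B \<Longrightarrow> vanishing_ideal B \<subseteq> vanishing_ideal A"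
  by (auto simp: vanishing_ideal_def)

lemma zero_set_mono: "A \<subseteq> B \<Longrightarrow> zero_set B \<subseteq> zero_set A"
  by (auto simp: zero_set_def)

lemma irreducible_zero_set:
  assumes Q: "is_prime Q" shows "irreducible_variety (zero_set Q)"
  unfolding irreducible_variety_def
proof (intro conjI allI impI affine_variety_zero_set)
  show "zero_set Q \<noteq> {}"
  proof
    assume "zero_set Q = {}"
    then have "1 \<in> vanishing_ideal (zero_set Q)" by (simp add: vanishing_ideal_def)
    then show False using vanishing_ideal_zero_set[OF Q] is_prime_one[OF Q] by simp
  qed
next
  fix A B assume AB: "affine_variety A \<and> affine_variety B \<and> zero_set Q = A \<union> B"
  show "zero_set Q = A \<or> zero_set Q = B"
  proof (rule ccontr)
    assume "\<not> ?thesis"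
    then obtain y z where yz: "y \<in> zero_set Q" "y \<notin> A" "z \<in> zero_set Q" "z \<notin> B" using AB by blast
    have "y \<notin> zero_set (vanishing_ideal A)" "z \<notin> zero_set (vanishing_ideal B)"
      using yz AB by (simp_all add: zero_set_vanishing_ideal)
    then obtain p q where pq: "p \<in> vanishing_ideal A" "poly_at p y \<noteq> 0" "q \<in> vanishing_ideal B" "poly_at q z \<noteq> 0"
      by (auto simp: zero_set_def)
    have "p * q \<in> vanishing_ideal (zero_set Q)" using pq AB by (auto simp: vanishing_ideal_def)
    then have "p \<in> Q \<or> q \<in> Q" using vanishing_ideal_zero_set[OF Q] is_prime_multD[OF Q] by simp
    then show False using pq yz by (auto simp: zero_set_def)
  qed
qed

lemma is_prime_vanishing_ideal:
  assumes "irreducible_variety Z" shows "is_prime (vanishing_ideal Z)"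
  unfolding is_prime_def
proof (intro conjI allI impI is_ideal_vanishing_ideal)
  show "1 \<notin> vanishing_ideal Z" using assms by (auto simp: irreducible_variety_def vanishing_ideal_def)
next
  fix p q assume pq: "p * q \<in> vanishing_ideal Z"
  have aff: "affine_variety (Z \<inter> {x. poly_at r x = 0})" for r
  proof -
    obtain P where "Z = {x. \<forall>p\<in>P. poly_at p x = 0}" using assms by (auto simp: irreducible_variety_def affine_variety_def)
    then have "Z \<inter> {x. poly_at r x = 0} = {x. \<forall>p\<in>insert r P. poly_at p x = 0}" by auto
    then show ?thesis unfolding affine_variety_def by blast
  qed
  have "Z = (Z \<inter> {x. poly_at p x = 0}) \<union> (Z \<inter> {x. poly_at q x = 0})" using pq by (auto simp: vanishing_ideal_def)
  then have "Z = Z \<inter> {x. poly_at p x = 0} \<or> Z = Z \<inter> {x. poly_at q x = 0}"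
    using assms aff unfolding irreducible_variety_def by blast
  then show "p \<in> vanishing_ideal Z \<or> q \<in> vanishing_ideal Z" by (auto simp: vanishing_ideal_def)
qed

text \<open>Noetherian induction: if \<open>p * q\<close> lies in \<open>I\<close> but neither
  factor does, a prime over \<open>I\<close> contains \<open>adjoin I p\<close> or
  \<open>adjoin I q\<close>, both larger than \<open>I\<close>. The set obtained contains all
  minimal primes over \<open>I\<close>.\<close>

lemma finite_primes_over:
  fixes I :: "'v::finite cpoly set"
  assumes "is_ideal I"
  shows "\<exists>\<P>. finite \<P> \<and> (\<forall>P\<in>\<P>. is_prime P \<and> I \<subseteq> P) \<and> (\<forall>Q. is_prime Q \<and> I \<subseteq> Q \<longrightarrow> (\<exists>P\<in>\<P>. P \<subseteq> Q))"
  using assms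
proof (induction rule: ideal_induct)
  case (step I)
  show ?case
  proof (cases "is_prime I")
    case True
    then show ?thesis by (intro exI[of _ "{I}"]) auto
  next
    case False
    show ?thesis
    proof (cases "1 \<in> I")
      case True
      then have "\<And>Q. is_prime Q \<Longrightarrow> \<not> I \<subseteq> Q" using is_prime_one by blast
      then show ?thesis by (intro exI[of _ "{}"]) auto
    next
      case False
      then obtain p q where pq: "p * q \<in> I" "p \<notin> I" "q \<notin> I"
        using \<open>\<not> is_prime I\<close> step(1) by (auto simp: is_prime_def)
      have sub: "I \<subset> adjoin I r" if "r \<notin> I" for r
        using adjoin_superset[of I r] adjoin_self[OF step(1), of r] that by blast
      obtain A where A: "finite A" "\<forall>P\<in>A. is_prime P \<and> adjoin I p \<subseteq> P" "\<forall>Q. is_prime Q \<and> adjoin I p \<subseteq> Q \<longrightarrow> (\<exists>P\<in>A. P \<subseteq> Q)"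
        using step(2)[OF is_ideal_adjoin[OF step(1)] sub[OF pq(2)]] by blast
      obtain B where B: "finite B" "\<forall>P\<in>B. is_prime P \<and> adjoin I q \<subseteq> P" "\<forall>Q. is_prime Q \<and> adjoin I q \<subseteq> Q \<longrightarrow> (\<exists>P\<in>B. P \<subseteq> Q)"
        using step(2)[OF is_ideal_adjoin[OF step(1)] sub[OF pq(3)]] by blast
      have "\<exists>P\<in>A \<union> B. P \<subseteq> Q" if Q: "is_prime Q" "I \<subseteq> Q" for Q
      proof -
        have "p \<in> Q \<or> q \<in> Q" using pq(1) Q is_prime_multD by blast
        then have "adjoin I p \<subseteq> Q \<or> adjoin I q \<subseteq> Q"
          using adjoin_least[OF is_prime_ideal[OF Q(1)] Q(2)] by blast
        then have "(\<exists>P\<in>A. P \<subseteq> Q) \<or> (\<exists>P\<in>B. P \<subseteq> Q)" using A(3)[rule_format, of Q] B(3)[rule_format, of Q] Q(1) by metis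
        then show ?thesis by auto
      qed
      moreover have "\<forall>P\<in>A \<union> B. is_prime P \<and> I \<subseteq> P" using A(2) B(2) adjoin_superset[of I] by blast
      ultimately show ?thesis using A(1) B(1) by (intro exI[of _ "A \<union> B"]) auto
    qed
  qed
qed

lemma is_prime_point: "is_prime (vanishing_ideal {x})"
  by (auto simp: is_prime_def is_ideal_vanishing_ideal) (auto simp: vanishing_ideal_def)

section \<open>Chains of prime ideals and dimension\<close>

definition prime_chain :: "(nat \<Rightarrow> 'v cpoly set) \<Rightarrow> nat \<Rightarrow> bool" where
  "prime_chain C k \<longleftrightarrow> (\<forall>i\<le>k. is_prime (C i)) \<and> (\<forall>i<k. C i \<subset> C (Suc i))"

lemma prime_chain_mono: "prime_chain C k \<Longrightarrow> i \<le> j \<Longrightarrow> j \<le> k \<Longrightarrow> C i \<subseteq> C j"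
proof (induction j)
  case (Suc j)
  then have "C j \<subset> C (Suc j)" by (simp add: prime_chain_def)
  then show ?case using Suc by (cases "i = Suc j") auto
qed simp

text \<open>Components correspond to minimal primes over \<open>vanishing_ideal V\<close>; one below
  \<open>vanishing_ideal Z\<close> is found among the finitely many primes of
  \<open>finite_primes_over\<close>.\<close>

lemma component_exists:
  assumes V: "affine_variety V" and Z: "irreducible_variety Z" "Z \<subseteq> V"
  shows "\<exists>W. irreducible_component W V \<and> Z \<subseteq> W"
proof -
  from finite_primes_over[OF is_ideal_vanishing_ideal[of V]]
  obtain \<P> where P: "finite \<P>" "\<forall>P\<in>\<P>. is_prime P \<and> vanishing_ideal V \<subseteq> P"
    "\<forall>Q. is_prime Q \<and> vanishing_ideal V \<subseteq> Q \<longrightarrow> (\<exists>P\<in>\<P>. P \<subseteq> Q)"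
    by (elim exE conjE)
  have "{P\<in>\<P>. P \<subseteq> vanishing_ideal Z} \<noteq> {}"
    using P(3) is_prime_vanishing_ideal[OF Z(1)] vanishing_ideal_mono[OF Z(2)] by auto
  then obtain P0 where P0: "P0 \<in> \<P>" "P0 \<subseteq> vanishing_ideal Z"
    "\<forall>P\<in>\<P>. P \<subseteq> vanishing_ideal Z \<longrightarrow> P \<subseteq> P0 \<longrightarrow> P0 = P"
    using finite_has_minimal[of "{P\<in>\<P>. P \<subseteq> vanishing_ideal Z}"] P(1) by auto
  have pr: "is_prime P0" "vanishing_ideal V \<subseteq> P0" using P(2) P0(1) by auto
  have ZV: "zero_set (vanishing_ideal Z) = Z" using Z(1) by (simp add: irreducible_variety_def zero_set_vanishing_ideal)
  have "irreducible_component (zero_set P0) V"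
    unfolding irreducible_component_def
  proof (intro conjI allI impI irreducible_zero_set pr(1))
    show "zero_set P0 \<subseteq> V" using zero_set_mono[OF pr(2)] zero_set_vanishing_ideal[OF V] by simp
    fix W assume W: "irreducible_variety W \<and> zero_set P0 \<subseteq> W \<and> W \<subseteq> V"
    have 1: "vanishing_ideal W \<subseteq> P0" using W vanishing_ideal_mono[of "zero_set P0" W] vanishing_ideal_zero_set[OF pr(1)] by simp
    obtain P' where "P' \<in> \<P>" "P' \<subseteq> vanishing_ideal W"
      using P(3) is_prime_vanishing_ideal[of W] vanishing_ideal_mono[of W V] W by auto
    then have "P' = P0" using P0(2,3) 1 by (metis order_trans)
    then have "vanishing_ideal W = P0" using 1 \<open>P' \<subseteq> vanishing_ideal W\<close> by blast
    then show "W = zero_set P0" using W zero_set_vanishing_ideal[of W] by (simp add: irreducible_variety_def)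
  qed
  moreover have "Z \<subseteq> zero_set P0" using zero_set_mono[OF P0(2)] ZV by simp
  ultimately show ?thesis by blast
qed

text \<open>Taking zero sets turns the chain round; all of them lie in the zero set of
  \<open>C 0\<close>, hence in one component, whose dimension is \<open>n\<close>.\<close>

lemma prime_chain_le_dim:
  assumes V: "affine_variety V" "pure_dimensional V n" and C: "prime_chain C k" "vanishing_ideal V \<subseteq> C 0"
  shows "k \<le> n"
proof -
  have irr: "irreducible_variety (zero_set (C i))" if "i \<le> k" for i
    using C(1) that by (auto simp: prime_chain_def irreducible_zero_set)
  have "zero_set (C 0) \<subseteq> V" using zero_set_mono[OF C(2)] zero_set_vanishing_ideal[OF V(1)] by simp
  then obtain W where W: "irreducible_component W V" "zero_set (C 0) \<subseteq> W"
    using component_exists[OF V(1) irr[of 0]] by blast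
  have "variety_dim W = enat n" using V(2) W(1) by (auto simp: pure_dimensional_def)
  moreover have "enat k \<le> variety_dim W"
    unfolding variety_dim_def
  proof (rule Sup_upper, clarify, rule exI[of _ k], rule conjI[OF refl], rule exI[of _ "\<lambda>i. zero_set (C (k - i))"], intro conjI allI impI)
    fix i assume "i \<le> k"
    show "irreducible_variety (zero_set (C (k - i)))" by (rule irr) simp
    have "zero_set (C (k - i)) \<subseteq> zero_set (C 0)" by (intro zero_set_mono prime_chain_mono[OF C(1)]) simp_all
    then show "zero_set (C (k - i)) \<subseteq> W" using W(2) by blast
  next
    fix i assume i: "i < k"
    define j where "j = k - Suc i"
    have j: "k - i = Suc j" "j < k" using i by (auto simp: j_def)
    have "C j \<subset> C (Suc j)" "is_prime (C j)" "is_prime (C (Suc j))" using C(1) j by (auto simp: prime_chain_def)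
    moreover have "zero_set (C (Suc j)) \<noteq> zero_set (C j)"
      using calculation vanishing_ideal_zero_set by (metis psubsetE)
    ultimately have "zero_set (C (Suc j)) \<subset> zero_set (C j)" using zero_set_mono by blast
    then show "zero_set (C (k - i)) \<subset> zero_set (C (k - Suc i))" using j by (simp add: j_def)
  qed
  ultimately show ?thesis by simp
qed

lemma ex_prime_chain_dim:
  assumes V: "affine_variety V" "pure_dimensional V n" "V \<noteq> {}"
  shows "\<exists>C. prime_chain C n \<and> vanishing_ideal V \<subseteq> C 0"
proof -
  obtain x where "x \<in> V" using V(3) by blast
  have "irreducible_variety (zero_set (vanishing_ideal {x}))" by (intro irreducible_zero_set is_prime_point)
  moreover have "zero_set (vanishing_ideal {x}) \<subseteq> V"
    using zero_set_mono[OF vanishing_ideal_mono[of "{x}" V]] zero_set_vanishing_ideal[OF V(1)] \<open>x \<in> V\<close> by simp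
  ultimately obtain W where W: "irreducible_component W V" using component_exists[OF V(1)] by blast
  define K where "K = {enat k | k. \<exists>C :: nat \<Rightarrow> (complex^'a) set.
     (\<forall>i\<le>k. irreducible_variety (C i) \<and> C i \<subseteq> W) \<and> (\<forall>i<k. C i \<subset> C (Suc i))}"
  have "Sup K = enat n" using V(2) W by (simp add: pure_dimensional_def variety_dim_def K_def)
  \<comment> \<open>A finite supremum of a nonempty set of extended naturals is attained; for the
    empty set it would be 0 by default.\<close>
  moreover have "enat 0 \<in> K"
    unfolding K_def using W by (auto simp: irreducible_component_def zero_enat_def[symmetric] intro!: exI[of _ 0] exI[of _ "\<lambda>_. W"])
  ultimately have "enat n \<in> K"
    unfolding Sup_enat_def by (auto split: if_splits dest: Max_in)
  then obtain D where D: "\<forall>i\<le>n. irreducible_variety (D i) \<and> D i \<subseteq> W" "\<forall>i<n. D i \<subset> D (Suc i)"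
    unfolding K_def by auto
  define C where "C i = vanishing_ideal (D (n - i))" for i
  have "prime_chain C n"
    unfolding prime_chain_def
  proof (intro conjI allI impI)
    fix i assume "i \<le> n" show "is_prime (C i)" unfolding C_def using D by (intro is_prime_vanishing_ideal) auto
  next
    fix i assume i: "i < n"
    define j where "j = n - Suc i"
    have j: "n - i = Suc j" "j < n" using i by (auto simp: j_def)
    have "D j \<subset> D (Suc j)" using D(2) j by simp
    moreover have "vanishing_ideal (D (Suc j)) \<noteq> vanishing_ideal (D j)"
      using D(1) j zero_set_vanishing_ideal calculation
      by (metis Suc_leI irreducible_variety_def less_imp_le psubsetE)
    ultimately show "C i \<subset> C (Suc i)" unfolding C_def j j_def[symmetric] using vanishing_ideal_mono by blast
  qed
  moreover have "vanishing_ideal V \<subseteq> C 0"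
    unfolding C_def using D(1) W by (intro vanishing_ideal_mono) (auto simp: irreducible_component_def)
  ultimately show ?thesis by blast
qed

section \<open>Growth of quotients\<close>

definition clinear_form :: "('v cpoly \<Rightarrow> complex) \<Rightarrow> bool" where
  "clinear_form l \<longleftrightarrow> (\<forall>p q. l (p + q) = l p + l q) \<and> (\<forall>c p. l (Cst c * p) = c * l p)"

lemma clinear_form_add: "clinear_form l \<Longrightarrow> l (p + q) = l p + l q"
  and clinear_form_Cst_mult: "clinear_form l \<Longrightarrow> l (Cst c * p) = c * l p"
  by (auto simp: clinear_form_def)

lemma clinear_form_sum: "clinear_form l \<Longrightarrow> l (sum f A) = (\<Sum>i\<in>A. l (f i))"
proof (induction A rule: infinite_finite_induct)
  case (infinite A)
  then show ?case using clinear_form_Cst_mult[of l 0 0] by simp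
next
  case empty
  then show ?case using clinear_form_Cst_mult[of l 0 0] by simp
qed (simp add: clinear_form_add)

text \<open>Up to a constant factor, the degree-at-most-\<open>T\<close> part of the quotient by \<open>I\<close> has dimension
  at most \<open>(T + 1)\<^sup>m\<close>.\<close>
definition growth :: "'v::finite cpoly set \<Rightarrow> nat \<Rightarrow> bool" where
  "growth I m \<longleftrightarrow> (\<exists>C::nat. \<forall>T. \<exists>\<Lambda>. finite \<Lambda> \<and> card \<Lambda> \<le> C * (T + 1) ^ m \<and> (\<forall>l\<in>\<Lambda>. clinear_form l) \<and>
     (\<forall>q. total_degree q \<le> T \<and> (\<forall>l\<in>\<Lambda>. l q = 0) \<longrightarrow> q \<in> I))"

lemma growth_mono:
  assumes "growth I m" "I \<subseteq> K" "m \<le> k"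
  shows "growth K k"
proof -
  obtain C :: nat where C: "\<forall>T. \<exists>\<Lambda>. finite \<Lambda> \<and> card \<Lambda> \<le> C * (T + 1) ^ m \<and> (\<forall>l\<in>\<Lambda>. clinear_form l) \<and>
     (\<forall>q. total_degree q \<le> T \<and> (\<forall>l\<in>\<Lambda>. l q = 0) \<longrightarrow> q \<in> I)"
    using assms(1) unfolding growth_def by (elim exE)
  show ?thesis
    unfolding growth_def
  proof (rule exI[of _ C], rule allI)
    fix T
    obtain \<Lambda> where L: "finite \<Lambda>" "card \<Lambda> \<le> C * (T + 1) ^ m" "\<forall>l\<in>\<Lambda>. clinear_form l"
      "\<forall>q. total_degree q \<le> T \<and> (\<forall>l\<in>\<Lambda>. l q = 0) \<longrightarrow> q \<in> I"
      using C[rule_format, of T] by (elim exE conjE)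
    have "C * (T + 1) ^ m \<le> C * (T + 1) ^ k"
      using assms(3) by (intro mult_le_mono2 power_increasing) simp_all
    then show "\<exists>\<Lambda>. finite \<Lambda> \<and> card \<Lambda> \<le> C * (T + 1) ^ k \<and> (\<forall>l\<in>\<Lambda>. clinear_form l) \<and>
     (\<forall>q. total_degree q \<le> T \<and> (\<forall>l\<in>\<Lambda>. l q = 0) \<longrightarrow> q \<in> K)"
      using L assms(2) order_trans[OF L(2)] by (intro exI[of _ \<Lambda>]) blast
  qed
qed

lemma growth_Int:
  assumes "growth I m" "growth K m"
  shows "growth (I \<inter> K) m"
proof -
  obtain C :: nat where C: "\<forall>T. \<exists>\<Lambda>. finite \<Lambda> \<and> card \<Lambda> \<le> C * (T + 1) ^ m \<and> (\<forall>l\<in>\<Lambda>. clinear_form l) \<and>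
     (\<forall>q. total_degree q \<le> T \<and> (\<forall>l\<in>\<Lambda>. l q = 0) \<longrightarrow> q \<in> I)"
    using assms(1) unfolding growth_def by (elim exE)
  obtain D :: nat where D: "\<forall>T. \<exists>\<Lambda>. finite \<Lambda> \<and> card \<Lambda> \<le> D * (T + 1) ^ m \<and> (\<forall>l\<in>\<Lambda>. clinear_form l) \<and>
     (\<forall>q. total_degree q \<le> T \<and> (\<forall>l\<in>\<Lambda>. l q = 0) \<longrightarrow> q \<in> K)"
    using assms(2) unfolding growth_def by (elim exE)
  show ?thesis
    unfolding growth_def
  proof (rule exI[of _ "C + D"], rule allI)
    fix T
    obtain A where A: "finite A" "card A \<le> C * (T + 1) ^ m" "\<forall>l\<in>A. clinear_form l"
      "\<forall>q. total_degree q \<le> T \<and> (\<forall>l\<in>A. l q = 0) \<longrightarrow> q \<in> I"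
      using C[rule_format, of T] by (elim exE conjE)
    obtain B where B: "finite B" "card B \<le> D * (T + 1) ^ m" "\<forall>l\<in>B. clinear_form l"
      "\<forall>q. total_degree q \<le> T \<and> (\<forall>l\<in>B. l q = 0) \<longrightarrow> q \<in> K"
      using D[rule_format, of T] by (elim exE conjE)
    have "card (A \<union> B) \<le> (C + D) * (T + 1) ^ m"
      using card_Un_le[of A B] A(2) B(2) unfolding add_mult_distrib by linarith
    then show "\<exists>\<Lambda>. finite \<Lambda> \<and> card \<Lambda> \<le> (C + D) * (T + 1) ^ m \<and> (\<forall>l\<in>\<Lambda>. clinear_form l) \<and>
     (\<forall>q. total_degree q \<le> T \<and> (\<forall>l\<in>\<Lambda>. l q = 0) \<longrightarrow> q \<in> I \<inter> K)"
      using A B by (intro exI[of _ "A \<union> B"]) auto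
  qed
qed

lemma growth_UNIV: "growth UNIV m"
  unfolding growth_def by (intro exI[of _ 0] allI exI[of _ "{}"]) simp

lemma growth_Inter:
  assumes "finite \<P>" "\<And>P. P \<in> \<P> \<Longrightarrow> growth P m"
  shows "growth (\<Inter>\<P>) m"
  using assms by (induction \<P>) (simp_all add: growth_UNIV growth_Int)

section \<open>Algebraic independence\<close>

text \<open>All exponents run below a common \<open>L\<close>; as \<open>L\<close> is arbitrary,
  this covers every polynomial relation modulo \<open>I\<close>. Exponent vectors are extensional
  functions, which makes the index set of the sum finite.\<close>

definition alg_independent :: "'v cpoly set \<Rightarrow> (nat \<Rightarrow> 'v cpoly) \<Rightarrow> nat \<Rightarrow> bool" where
  "alg_independent I h k \<longleftrightarrow> (\<forall>L c. (\<Sum>e\<in>PiE {..<k} (\<lambda>_. {..<L}). Cst (c e) * (\<Prod>i<k. h i ^ e i)) \<in> I \<longrightarrow>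
     (\<forall>e\<in>PiE {..<k} (\<lambda>_. {..<L}). c e = 0))"

text \<open>Counting: there are \<open>L ^ k\<close> products of powers of the \<open>h i\<close>
  with exponents below \<open>L\<close>, all of degree at most \<open>L * D\<close>, while the
  growth bound allows only a constant times \<open>L ^ m\<close> independent ones modulo
  \<open>I\<close>.\<close>

lemma alg_independent_le_growth:
  fixes I :: "'v::finite cpoly set"
  assumes "alg_independent I h k" "growth I m"
  shows "k \<le> m"
proof (rule ccontr)
  assume "\<not> k \<le> m"
  then have km: "Suc m \<le> k" by simp
  obtain C :: nat where C: "\<forall>T. \<exists>\<Lambda>. finite \<Lambda> \<and> card \<Lambda> \<le> C * (T + 1) ^ m \<and> (\<forall>l\<in>\<Lambda>. clinear_form l) \<and>
     (\<forall>q. total_degree q \<le> T \<and> (\<forall>l\<in>\<Lambda>. l q = 0) \<longrightarrow> q \<in> I)"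
    using assms(2) unfolding growth_def by (elim exE)
  define D where "D = (\<Sum>i<k. total_degree (h i))"
  \<comment> \<open>One more than \<open>C * (D + 1) ^ m\<close>, so that
    \<open>C * (L * D + 1) ^ m\<close> is at most \<open>L ^ m * (L - 1)\<close>, which is below
    \<open>L ^ Suc m\<close>.\<close>
  define L where "L = C * (D + 1) ^ m + 1"
  define E where "E = PiE {..<k} (\<lambda>_. {..<L})"
  define g where "g e = (\<Prod>i<k. h i ^ e i)" for e :: "nat \<Rightarrow> nat"
  obtain \<Lambda> where \<Lambda>: "finite \<Lambda>" "card \<Lambda> \<le> C * (L * D + 1) ^ m" "\<forall>l\<in>\<Lambda>. clinear_form l"
      "\<forall>q. total_degree q \<le> L * D \<and> (\<forall>l\<in>\<Lambda>. l q = 0) \<longrightarrow> q \<in> I"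
    using C[rule_format, of "L * D"] by (elim exE conjE)
  have E: "finite E" "card E = L ^ k" unfolding E_def by (auto simp: finite_PiE card_PiE)
  have "L \<ge> 1" by (simp add: L_def)
  have "(L * D + 1) ^ m \<le> (L * (D + 1)) ^ m" using \<open>L \<ge> 1\<close> by (intro power_mono) auto
  also have "\<dots> = L ^ m * (D + 1) ^ m" by (rule power_mult_distrib)
  finally have "C * (L * D + 1) ^ m \<le> C * (L ^ m * (D + 1) ^ m)" by (rule mult_le_mono2)
  also have "\<dots> = L ^ m * (C * (D + 1) ^ m)" by (simp only: mult_ac)
  also have "\<dots> < L ^ m * L" using \<open>L \<ge> 1\<close> unfolding L_def by (intro mult_strict_left_mono) auto
  also have "\<dots> = L ^ Suc m" by simp
  also have "\<dots> \<le> L ^ k" using km \<open>L \<ge> 1\<close> by (rule power_increasing)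
  finally have "card \<Lambda> < card E" using \<Lambda>(2) E(2) by simp
  from linear_relation[OF \<Lambda>(1) E(1) this, of "\<lambda>e l. l (g e)"]
  obtain c where c: "\<exists>e\<in>E. c e \<noteq> 0" "\<forall>l\<in>\<Lambda>. (\<Sum>e\<in>E. c e * l (g e)) = 0" by auto
  have deg: "total_degree (g e) \<le> L * D" if "e \<in> E" for e
  proof -
    have "total_degree (g e) \<le> (\<Sum>i<k. total_degree (h i ^ e i))" unfolding g_def by (rule total_degree_prod_le)
    also have "\<dots> \<le> (\<Sum>i<k. L * total_degree (h i))"
    proof (rule sum_mono)
      fix i assume "i \<in> {..<k}"
      then have "e i \<le> L" using that by (auto simp: E_def PiE_iff intro: less_imp_le)
      then show "total_degree (h i ^ e i) \<le> L * total_degree (h i)"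
        using total_degree_power_le[of "h i" "e i"] mult_le_mono1 order_trans by blast
    qed
    finally show ?thesis by (simp add: D_def sum_distrib_left)
  qed
  have "(\<Sum>e\<in>E. Cst (c e) * g e) \<in> I"
  proof (rule \<Lambda>(4)[rule_format], intro conjI ballI)
    show "total_degree (\<Sum>e\<in>E. Cst (c e) * g e) \<le> L * D"
      using deg total_degree_Cst_mult_le order_trans by (intro total_degree_sum_le) blast
    fix l assume l: "l \<in> \<Lambda>"
    then have "clinear_form l" using \<Lambda>(3) by blast
    then show "l (\<Sum>e\<in>E. Cst (c e) * g e) = 0" using c(2) l by (simp add: clinear_form_sum clinear_form_Cst_mult)
  qed
  then have "\<forall>e\<in>E. c e = 0" using assms(1) unfolding alg_independent_def E_def g_def by blast
  with c(1) show False by blast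
qed

text \<open>Modulo \<open>I\<close> the new element is 0, so a relation over \<open>P\<close>
  reduces to its part free of \<open>h k\<close>, which is trivial by independence over
  \<open>I\<close>. The rest is divisible by \<open>h k\<close>, which can be cancelled because
  \<open>P\<close> is prime; then the argument repeats.\<close>

lemma alg_independent_extend:
  assumes ind: "alg_independent I h k" and I: "is_ideal I" and P: "is_prime P" "P \<subseteq> I" and x: "h k \<in> I" "h k \<notin> P"
  shows "alg_independent P h (Suc k)"
  unfolding alg_independent_def
proof (intro allI impI)
  fix L :: nat and c :: "(nat \<Rightarrow> nat) \<Rightarrow> complex"
  define E where "E = PiE {..<k} (\<lambda>_. {..<L})"
  define g where "g e = (\<Prod>i<k. h i ^ e i)" for e :: "nat \<Rightarrow> nat"
  define A where "A a = (\<Sum>e\<in>E. Cst (a e) * g e)" for a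
  assume rel: "(\<Sum>e\<in>PiE {..<Suc k} (\<lambda>_. {..<L}). Cst (c e) * (\<Prod>i<Suc k. h i ^ e i)) \<in> P"
  have key: "\<forall>j<n. \<forall>e\<in>E. a j e = 0" if "(\<Sum>j<n. A (a j) * h k ^ j) \<in> P" for n and a :: "nat \<Rightarrow> (nat \<Rightarrow> nat) \<Rightarrow> complex"
    using that
  proof (induction n arbitrary: a)
    case (Suc n)
    have eq: "(\<Sum>j<Suc n. A (a j) * h k ^ j) = A (a 0) + h k * (\<Sum>j<n. A (a (Suc j)) * h k ^ j)"
      by (subst sum.lessThan_Suc_shift) (simp add: sum_distrib_left mult_ac)
    have "A (a 0) + h k * (\<Sum>j<n. A (a (Suc j)) * h k ^ j) \<in> I" using Suc.prems P(2) unfolding eq by blast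
    then have "A (a 0) \<in> I" using is_ideal_add_iff[OF I is_ideal_mult_right[OF I x(1)]] by blast
    then have a0: "\<forall>e\<in>E. a 0 e = 0" using ind unfolding alg_independent_def A_def E_def g_def by blast
    then have "A (a 0) = 0" by (simp add: A_def)
    then have "h k * (\<Sum>j<n. A (a (Suc j)) * h k ^ j) \<in> P" using Suc.prems unfolding eq by simp
    then have "(\<Sum>j<n. A (a (Suc j)) * h k ^ j) \<in> P" using is_prime_multD[OF P(1)] x(2) by blast
    from Suc.IH[OF this] have "\<forall>j<n. \<forall>e\<in>E. a (Suc j) e = 0" .
    with a0 show ?case by (metis less_Suc_eq_0_disj)
  qed simp
  have PE: "PiE {..<Suc k} (\<lambda>_. {..<L}) = (\<lambda>(y, e). e(k := y)) ` ({..<L} \<times> E)"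
    unfolding lessThan_Suc PiE_insert_eq E_def by simp
  have inj: "inj_on (\<lambda>(y, e). e(k := y)) ({..<L} \<times> E)"
    unfolding E_def by (rule inj_combinator) simp
  have gk: "(\<Prod>i<Suc k. h i ^ ((e(k := y)) i)) = g e * h k ^ y" for e y
    by (simp add: g_def)
  have "(\<Sum>e\<in>PiE {..<Suc k} (\<lambda>_. {..<L}). Cst (c e) * (\<Prod>i<Suc k. h i ^ e i))
      = (\<Sum>(y, e)\<in>{..<L} \<times> E. Cst (c (e(k := y))) * (g e * h k ^ y))"
    unfolding PE by (subst sum.reindex[OF inj], rule sum.cong[OF refl]) (simp only: case_prod_unfold o_def gk)
  also have "\<dots> = (\<Sum>y<L. A (\<lambda>e. c (e(k := y))) * h k ^ y)"
    by (simp add: A_def sum.cartesian_product[symmetric] sum_distrib_left sum_distrib_right mult_ac)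
  finally have "\<forall>j<L. \<forall>e\<in>E. c (e(k := j)) = 0" using key rel by simp
  then show "\<forall>e\<in>PiE {..<Suc k} (\<lambda>_. {..<L}). c e = 0" unfolding PE by auto
qed

text \<open>The chain is read downwards from its top: each step supplies an element of the larger
  prime outside the smaller one, which extends the independent family.\<close>

lemma alg_independent_of_prime_chain:
  assumes C: "prime_chain C k"
  shows "\<exists>h. alg_independent (C 0) h k"
proof -
  have "\<forall>j<k. \<exists>x. x \<in> C (k - j) \<and> x \<notin> C (k - Suc j)"
  proof (intro allI impI)
    fix j assume "j < k"
    then have "C (k - Suc j) \<subset> C (Suc (k - Suc j))" using C unfolding prime_chain_def by auto
    moreover have "Suc (k - Suc j) = k - j" using \<open>j < k\<close> by simp
    ultimately show "\<exists>x. x \<in> C (k - j) \<and> x \<notin> C (k - Suc j)" by auto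
  qed
  then obtain h where h: "\<forall>j<k. h j \<in> C (k - j) \<and> h j \<notin> C (k - Suc j)" by metis
  have pr: "is_prime (C i)" if "i \<le> k" for i using C that by (auto simp: prime_chain_def)
  have "alg_independent (C (k - j)) h j" if "j \<le> k" for j
    using that
  proof (induction j)
    case 0
    show ?case
      unfolding alg_independent_def using is_prime_CstD[OF pr[of k]] by auto
  next
    case (Suc j)
    show ?case
      by (rule alg_independent_extend[OF Suc.IH is_prime_ideal[OF pr] pr prime_chain_mono[OF C]])
        (use Suc.prems h in auto)
  qed
  from this[of k] show ?thesis by auto
qed

lemma prime_chain_le_growth:
  fixes I :: "'v::finite cpoly set"
  assumes "prime_chain C k" "I \<subseteq> C 0" "growth I m"
  shows "k \<le> m"
  using alg_independent_of_prime_chain[OF assms(1)] alg_independent_le_growth growth_mono[OF assms(3,2) order_refl] by blast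

section \<open>Polynomials in some of the variables\<close>

definition poly_in :: "'v set \<Rightarrow> 'v cpoly set" where
  "poly_in B = {p. \<forall>a\<in>keys p. \<forall>v. v \<notin> B \<longrightarrow> lookup a v = 0}"

lemma poly_in_Cst [simp]: "Cst c \<in> poly_in B"
  by (simp add: poly_in_def Cst_def)

lemma poly_in_0 [simp]: "0 \<in> poly_in B" and poly_in_1 [simp]: "1 \<in> poly_in B"
  using poly_in_Cst[of 0 B] poly_in_Cst[of 1 B] by simp_all

lemma poly_in_Var [simp]: "v \<in> B \<Longrightarrow> Var v \<in> poly_in B"
  by (auto simp: poly_in_def Var_def lookup_single when_def)

lemma poly_in_add: "p \<in> poly_in B \<Longrightarrow> q \<in> poly_in B \<Longrightarrow> p + q \<in> poly_in B"
  unfolding poly_in_def by (auto dest: keys_addD)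

lemma poly_in_uminus: "p \<in> poly_in B \<Longrightarrow> - p \<in> poly_in B"
  unfolding poly_in_def by (auto simp: in_keys_iff)

lemma poly_in_diff: "p \<in> poly_in B \<Longrightarrow> q \<in> poly_in B \<Longrightarrow> p - q \<in> poly_in B"
  using poly_in_add[of p B "- q"] poly_in_uminus[of q B] by simp

lemma poly_in_mult: "p \<in> poly_in B \<Longrightarrow> q \<in> poly_in B \<Longrightarrow> p * q \<in> poly_in B"
  unfolding poly_in_def by (auto elim!: keys_multD simp: lookup_add)

lemma poly_in_sum: "(\<And>i. i \<in> A \<Longrightarrow> f i \<in> poly_in B) \<Longrightarrow> sum f A \<in> poly_in B"
  by (induction A rule: infinite_finite_induct) (auto intro: poly_in_add)

lemma poly_in_prod: "(\<And>i. i \<in> A \<Longrightarrow> f i \<in> poly_in B) \<Longrightarrow> prod f A \<in> poly_in B"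
  by (induction A rule: infinite_finite_induct) (auto intro: poly_in_mult)

lemma poly_in_mono: "B \<subseteq> B' \<Longrightarrow> poly_in B \<subseteq> poly_in B'"
  unfolding poly_in_def by blast

lemma poly_at_poly_in:
  assumes "p \<in> poly_in B" "\<And>v. v \<in> B \<Longrightarrow> x $ v = y $ v"
  shows "poly_at p x = poly_at p y"
proof -
  have "mon_at a x = mon_at a y" if "a \<in> keys p" for a
    unfolding mon_at_def
  proof (rule prod.cong[OF refl])
    fix v
    show "(x $ v) ^ lookup a v = (y $ v) ^ lookup a v"
      using assms that by (cases "v \<in> B") (auto simp: poly_in_def)
  qed
  then show ?thesis by (simp add: poly_at_alt[OF finite_keys order_refl])
qed

text \<open>Some value \<open>c\<close> can be substituted for the variable \<open>b\<close> without
  creating a relation between the variables in \<open>B\<close>. Otherwise each real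
  \<open>c\<close> gives a nonzero \<open>s c\<close> divisible by \<open>Var b - c\<close> modulo
  \<open>Q\<close>, and a linear relation between the quotients yields a nonzero element of
  \<open>Q\<close> in the variables \<open>insert b B\<close>.\<close>

lemma poly_in_specialize:
  fixes Q :: "'v::finite cpoly set"
  assumes Q: "is_prime Q" "Q \<inter> poly_in (insert b B) = {0}" and b: "b \<notin> B"
  shows "\<exists>c. adjoin Q (Var b - Cst c) \<inter> (poly_in B - {0}) = {}"
proof (rule ccontr)
  assume neg: "\<not> ?thesis"
  have "\<forall>c::real. \<exists>s r. s \<in> poly_in B \<and> s \<noteq> 0 \<and> s - r * (Var b - Cst (of_real c)) \<in> Q"
  proof
    fix c :: real
    have "adjoin Q (Var b - Cst (of_real c)) \<inter> (poly_in B - {0}) \<noteq> {}" using neg by blast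
    then obtain q r where "q \<in> Q" "q + r * (Var b - Cst (of_real c)) \<in> poly_in B" "q + r * (Var b - Cst (of_real c)) \<noteq> 0"
      by (auto simp: adjoin_def)
    then show "\<exists>s r. s \<in> poly_in B \<and> s \<noteq> 0 \<and> s - r * (Var b - Cst (of_real c)) \<in> Q"
      by (intro exI[of _ "q + r * (Var b - Cst (of_real c))"] exI[of _ r]) simp
  qed
  then have "\<exists>s r. \<forall>c::real. s c \<in> poly_in B \<and> s c \<noteq> 0 \<and> s c - r c * (Var b - Cst (of_real c)) \<in> Q" by metis
  then obtain s r where sr: "\<forall>c::real. s c \<in> poly_in B \<and> s c \<noteq> 0 \<and> s c - r c * (Var b - Cst (of_real c)) \<in> Q"
    by (elim exE)
  obtain E a where E: "finite E" "\<exists>c\<in>E. a c \<noteq> 0" "(\<Sum>c\<in>E. Cst (a c) * r c) = 0"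
    using uncountable_relation[of r "\<lambda>_. 0"] by auto
  define z where "z = (\<Sum>c\<in>E. Cst (a c) * s c * (\<Prod>c'\<in>E - {c}. Var b - Cst (of_real c')))"
  have "z \<in> Q"
    unfolding z_def using sr by (intro clear_denominators[OF is_prime_ideal[OF Q(1)] E(1,3)]) blast
  moreover have "z \<in> poly_in (insert b B)"
    unfolding z_def using sr poly_in_mono[of B "insert b B"]
    by (intro poly_in_sum poly_in_mult poly_in_prod poly_in_diff poly_in_Cst poly_in_Var) auto
  ultimately have "z = 0" using Q(2) by blast
  obtain c0 where c0: "c0 \<in> E" "a c0 \<noteq> 0" using E(2) by blast
  obtain y where y: "poly_at (s c0) y \<noteq> 0" using ex_poly_at_nonzero sr by blast
  \<comment> \<open>The coordinate \<open>b\<close> is set to \<open>c0\<close>, which kills all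
    summands of \<open>z\<close> except the one for \<open>c0\<close>; \<open>s c0\<close> does not
    involve \<open>b\<close> and keeps its nonzero value.\<close>
  define x where "x = (\<chi> v. if v = b then of_real c0 else y $ v)"
  have sx: "poly_at (s c0) x \<noteq> 0"
  proof -
    have "poly_at (s c0) x = poly_at (s c0) y"
      using sr b by (intro poly_at_poly_in[of _ B]) (auto simp: x_def)
    with y show ?thesis by simp
  qed
  have zz: "(\<Prod>c'\<in>E - {c}. of_real c0 - of_real c') = (0::complex)" if "c \<in> E - {c0}" for c
    using that c0(1) E(1) by (intro prod_zero) auto
  have "poly_at z x = (\<Sum>c\<in>E. a c * poly_at (s c) x * (\<Prod>c'\<in>E - {c}. of_real c0 - of_real c'))"
    by (simp add: z_def x_def)
  also have "\<dots> = a c0 * poly_at (s c0) x * (\<Prod>c'\<in>E - {c0}. of_real c0 - of_real c')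
      + (\<Sum>c\<in>E - {c0}. a c * poly_at (s c) x * (\<Prod>c'\<in>E - {c}. of_real c0 - of_real c'))"
    using E(1) c0(1) by (rule sum.remove)
  also have "\<dots> = a c0 * poly_at (s c0) x * (\<Prod>c'\<in>E - {c0}. of_real c0 - of_real c')" using zz by simp
  also have "\<dots> \<noteq> 0" using c0 E(1) sx by auto
  finally show False using \<open>z = 0\<close> by simp
qed

text \<open>Substituting constants for the independent variables one at a time gives a strictly
  larger prime at each step, chosen so that the remaining variables stay independent.\<close>

lemma prime_chain_of_independent_variables:
  fixes Q :: "'v::finite cpoly set"
  assumes "finite B" "is_prime Q" "Q \<inter> poly_in B = {0}"
  shows "\<exists>C. prime_chain C (card B) \<and> C 0 = Q"
  using assms
proof (induction B arbitrary: Q rule: finite_induct)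
  case empty
  then show ?case by (intro exI[of _ "\<lambda>_. Q"]) (simp add: prime_chain_def)
next
  case (insert b B)
  obtain c where c: "adjoin Q (Var b - Cst c) \<inter> (poly_in B - {0}) = {}"
    using poly_in_specialize[OF insert.prems insert.hyps(2)] by blast
  have "\<exists>Q'. is_prime Q' \<and> adjoin Q (Var b - Cst c) \<subseteq> Q' \<and> Q' \<inter> (poly_in B - {0}) = {} \<and>
      (\<forall>a. a \<notin> Q' \<longrightarrow> (\<exists>s\<in>poly_in B - {0}. \<exists>r. s - r * a \<in> Q'))"
    by (rule prime_avoiding[OF is_ideal_adjoin[OF is_prime_ideal[OF insert.prems(1)]] _ _ c])
      (auto intro: poly_in_mult dest: cpoly_mult_eq_0D)
  then obtain Q' where Q': "is_prime Q'" "adjoin Q (Var b - Cst c) \<subseteq> Q'" "Q' \<inter> (poly_in B - {0}) = {}"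
    by (elim exE conjE)
  have "Q' \<inter> poly_in B = {0}" using Q'(3) is_ideal_zero[OF is_prime_ideal[OF Q'(1)]] by auto
  from insert.IH[OF Q'(1) this] obtain C where C: "prime_chain C (card B)" "C 0 = Q'" by blast
  have QQ': "Q \<subset> Q'"
  proof -
    have "Q \<subseteq> Q'" using adjoin_superset Q'(2) by blast
    moreover have "Var b - Cst c \<in> Q'" using adjoin_self[OF is_prime_ideal[OF insert.prems(1)]] Q'(2) by blast
    moreover have "Var b - Cst c \<notin> Q"
    proof
      assume "Var b - Cst c \<in> Q"
      moreover have "Var b - Cst c \<in> poly_in (insert b B)" by (intro poly_in_diff poly_in_Var poly_in_Cst) simp
      ultimately have "Var b - Cst c = 0" using insert.prems(2) by blast
      then have "poly_at (Var b - Cst c) (\<chi> v. c + 1) = 0" by simp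
      then show False by simp
    qed
    ultimately show ?thesis by blast
  qed
  have "prime_chain (case_nat Q C) (Suc (card B))"
    unfolding prime_chain_def
  proof (intro conjI allI impI)
    fix i assume "i \<le> Suc (card B)"
    then show "is_prime (case i of 0 \<Rightarrow> Q | Suc x \<Rightarrow> C x)"
      using C(1) insert.prems(1) by (cases i) (auto simp: prime_chain_def)
  next
    fix i assume "i < Suc (card B)"
    then show "(case i of 0 \<Rightarrow> Q | Suc x \<Rightarrow> C x) \<subset> (case Suc i of 0 \<Rightarrow> Q | Suc x \<Rightarrow> C x)"
      using C QQ' by (cases i) (auto simp: prime_chain_def)
  qed
  then show ?case using insert.hyps by (intro exI[of _ "case_nat Q C"]) simp
qed

section \<open>Growth from generators\<close>

text \<open>The complex linear span of \<open>U\<close> and \<open>I\<close>; proofs about its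
  members become inductions on how the combination is built.\<close>

inductive_set cspan :: "'v cpoly set \<Rightarrow> 'v cpoly set \<Rightarrow> 'v cpoly set" for I U where
  ideal: "p \<in> I \<Longrightarrow> p \<in> cspan I U"
| base: "p \<in> U \<Longrightarrow> p \<in> cspan I U"
| add: "p \<in> cspan I U \<Longrightarrow> q \<in> cspan I U \<Longrightarrow> p + q \<in> cspan I U"
| scale: "p \<in> cspan I U \<Longrightarrow> Cst c * p \<in> cspan I U"

lemma cspan_mono:
  assumes "U \<subseteq> U'" "p \<in> cspan I U"
  shows "p \<in> cspan I U'"
  using assms(2) by induction (use assms(1) in \<open>auto intro: cspan.intros\<close>)

lemma cspan_sum: "is_ideal I \<Longrightarrow> (\<And>i. i \<in> A \<Longrightarrow> f i \<in> cspan I U) \<Longrightarrow> sum f A \<in> cspan I U"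
  by (induction A rule: infinite_finite_induct) (auto intro: cspan.add cspan.ideal is_ideal_zero)

lemma cspan_mult:
  assumes "is_ideal I" "\<And>u. u \<in> U \<Longrightarrow> g * u \<in> cspan I U'" "p \<in> cspan I U"
  shows "g * p \<in> cspan I U'"
  using assms(3)
proof induction
  case (ideal p)
  then show ?case using assms(1) by (auto intro: cspan.ideal is_ideal_mult)
next
  case (base p)
  then show ?case using assms(2) by blast
next
  case (add p q)
  then show ?case by (simp add: distrib_left cspan.add)
next
  case (scale p c)
  have "g * (Cst c * p) = Cst c * (g * p)" by (simp add: mult_ac)
  then show ?case by (simp only: cspan.scale[OF scale.IH])
qed

lemma cspan_cong: "is_ideal I \<Longrightarrow> p \<in> cspan I U \<Longrightarrow> q - p \<in> I \<Longrightarrow> q \<in> cspan I U"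
  using cspan.add[of p I U "q - p"] cspan.ideal[of "q - p" I U] by simp

lemma cspan_uminus: "p \<in> cspan I U \<Longrightarrow> - p \<in> cspan I U"
  using cspan.scale[of p I U "-1"] by (simp add: Cst_uminus)

lemma cspan_coeffs:
  assumes I: "is_ideal I" and "finite U" "p \<in> cspan I U"
  shows "\<exists>c. p - (\<Sum>u\<in>U. Cst (c u) * u) \<in> I"
  using assms(3)
proof induction
  case (ideal p)
  then show ?case by (intro exI[of _ "\<lambda>_. 0"]) simp
next
  case (base p)
  have "(\<Sum>u\<in>U. Cst (if u = p then 1 else 0) * u) = (\<Sum>u\<in>U. if u = p then u else 0)"
    by (rule sum.cong) auto
  also have "\<dots> = p" using base assms(2) by simp
  finally show ?case using is_ideal_zero[OF I] by (intro exI[of _ "\<lambda>u. if u = p then 1 else 0"]) simp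
next
  case (add p q)
  then obtain c e where ce: "p - (\<Sum>u\<in>U. Cst (c u) * u) \<in> I" "q - (\<Sum>u\<in>U. Cst (e u) * u) \<in> I" by blast
  have "p + q - (\<Sum>u\<in>U. Cst (c u + e u) * u) = (p - (\<Sum>u\<in>U. Cst (c u) * u)) + (q - (\<Sum>u\<in>U. Cst (e u) * u))"
    by (simp add: Cst_add distrib_right sum.distrib)
  then have "p + q - (\<Sum>u\<in>U. Cst (c u + e u) * u) \<in> I" by (simp only: is_ideal_add[OF I ce])
  then show ?case by (rule exI[of _ "\<lambda>u. c u + e u"])
next
  case (scale p c)
  then obtain e where e: "p - (\<Sum>u\<in>U. Cst (e u) * u) \<in> I" by blast
  have "Cst c * p - (\<Sum>u\<in>U. Cst (c * e u) * u) = Cst c * (p - (\<Sum>u\<in>U. Cst (e u) * u))"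
    by (simp add: Cst_mult right_diff_distrib sum_distrib_left mult_ac)
  then have "Cst c * p - (\<Sum>u\<in>U. Cst (c * e u) * u) \<in> I" by (simp only: is_ideal_mult[OF I e])
  then show ?case by (rule exI[of _ "\<lambda>u. c * e u"])
qed

definition power_prod :: "('k \<Rightarrow> 'v cpoly) \<Rightarrow> 'k set \<Rightarrow> ('k \<Rightarrow> nat) \<Rightarrow> 'v cpoly" where
  "power_prod f K \<alpha> = (\<Prod>k\<in>K. f k ^ \<alpha> k)"

text \<open>The exponents range over a box, so the number of products grows with order
  \<open>card K\<close> in \<open>C\<close>.\<close>

definition bounded_products :: "('k \<Rightarrow> 'v cpoly) \<Rightarrow> 'k set \<Rightarrow> 'v cpoly set \<Rightarrow> nat \<Rightarrow> 'v cpoly set" where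
  "bounded_products f K W C = {power_prod f K \<alpha> * w | \<alpha> w. w \<in> W \<and> (\<forall>k\<in>K. \<alpha> k \<le> C)}"

lemma power_prod_mult: "power_prod f K \<alpha> * power_prod f K \<beta> = power_prod f K (\<lambda>k. \<alpha> k + \<beta> k)"
  by (simp add: power_prod_def power_add prod.distrib)

lemma bounded_products_mono: "C \<le> C' \<Longrightarrow> bounded_products f K W C \<subseteq> bounded_products f K W C'"
  unfolding bounded_products_def by (blast intro: order_trans)

lemma bounded_products_eq:
  "bounded_products f K W C = (\<lambda>(\<alpha>, w). power_prod f K \<alpha> * w) ` (PiE K (\<lambda>_. {..C}) \<times> W)"
proof (intro subset_antisym subsetI)
  fix x assume "x \<in> bounded_products f K W C"
  then obtain \<alpha> w where x: "x = power_prod f K \<alpha> * w" "w \<in> W" "\<forall>k\<in>K. \<alpha> k \<le> C" by (auto simp: bounded_products_def)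
  have "power_prod f K \<alpha> = power_prod f K (restrict \<alpha> K)" by (simp add: power_prod_def)
  then show "x \<in> (\<lambda>(\<alpha>, w). power_prod f K \<alpha> * w) ` (PiE K (\<lambda>_. {..C}) \<times> W)"
    using x by (intro image_eqI[of _ _ "(restrict \<alpha> K, w)"]) auto
qed (auto simp: bounded_products_def PiE_iff)

lemma finite_bounded_products:
  assumes "finite K" "finite W"
  shows "finite (bounded_products f K W C)" "card (bounded_products f K W C) \<le> (C + 1) ^ card K * card W"
proof -
  show "finite (bounded_products f K W C)" unfolding bounded_products_eq using assms by (auto intro!: finite_PiE)
  have "card (bounded_products f K W C) \<le> card (PiE K (\<lambda>_. {..C}) \<times> W)"
    unfolding bounded_products_eq using assms by (intro card_image_le finite_cartesian_product finite_PiE) auto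
  also have "\<dots> = (C + 1) ^ card K * card W" using assms by (simp add: card_cartesian_product card_PiE)
  finally show "card (bounded_products f K W C) \<le> (C + 1) ^ card K * card W" .
qed

lemma cspan_bounded_products_uniform:
  assumes I: "is_ideal I" and "p \<in> cspan I (\<Union>C. bounded_products f K W C)"
  shows "\<exists>C. p \<in> cspan I (bounded_products f K W C)"
  using assms(2)
proof induction
  case (add p q)
  then obtain C D where "p \<in> cspan I (bounded_products f K W C)" "q \<in> cspan I (bounded_products f K W D)" by blast
  then have "p \<in> cspan I (bounded_products f K W (max C D))" "q \<in> cspan I (bounded_products f K W (max C D))"
    using cspan_mono[OF bounded_products_mono] by (metis max.cobounded1, metis max.cobounded2)
  then show ?case using cspan.add by blast
qed (auto intro: cspan.intros)

lemma mon_decompose: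
  assumes "a \<noteq> (0 :: 'v::finite \<Rightarrow>\<^sub>0 nat)"
  shows "\<exists>v a'. single a 1 = Var v * single a' (1::complex) \<and> mon_degree a = Suc (mon_degree a')"
proof -
  obtain v where v: "lookup a v \<noteq> 0" using assms by (metis lookup_zero poly_mapping_eqI)
  define a' where "a' = a - single v 1"
  have "a = single v 1 + a'"
    by (rule poly_mapping_eqI) (use v in \<open>auto simp: a'_def lookup_add lookup_minus lookup_single when_def\<close>)
  then show ?thesis by (intro exI[of _ v] exI[of _ a']) (simp add: Var_def mult_single)
qed

text \<open>Up to the denominator \<open>p\<close>, which is no zero divisor modulo
  \<open>I\<close>, the set \<open>W\<close> generates the quotient by \<open>I\<close> over the
  subring generated by the \<open>f k\<close>. Each multiplication by a variable costs one factor
  \<open>p\<close> and raises the exponents by at most \<open>C0\<close>; hence a monomial of degree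
  at most \<open>T\<close>, multiplied by \<open>p ^ T\<close>, is a combination of products with
  exponents up to \<open>T * C0\<close>.\<close>

lemma growth_of_generators:
  fixes I :: "'v::finite cpoly set" and f :: "'k \<Rightarrow> 'v cpoly"
  assumes I: "is_ideal I" and p: "\<And>q. p * q \<in> I \<Longrightarrow> q \<in> I"
    and K: "finite K" and W: "finite W" "1 \<in> W"
    and gen1: "\<And>w. w \<in> W \<Longrightarrow> p * w \<in> cspan I (\<Union>C. bounded_products f K W C)"
    and gen: "\<And>w v. w \<in> W \<Longrightarrow> p * (Var v * w) \<in> cspan I (\<Union>C. bounded_products f K W C)"
  shows "growth I (card K)"
proof -
  let ?U = "bounded_products f K W"
  \<comment> \<open>The element 1 is included so that monomials of smaller degree can be brought to
    the same power of \<open>p\<close>.\<close>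
  define G where "G = (insert 1 (range Var) :: 'v cpoly set)"
  have finG: "finite G" by (simp add: G_def)
  have "\<forall>x\<in>G \<times> W. \<exists>C. p * (fst x * snd x) \<in> cspan I (?U C)"
    using gen1 gen by (auto simp: G_def intro!: cspan_bounded_products_uniform[OF I])
  then obtain c where c: "\<forall>x\<in>G \<times> W. p * (fst x * snd x) \<in> cspan I (?U (c x))" by metis
  define C0 where "C0 = Max (insert 0 (c ` (G \<times> W)))"
  have C0: "p * (g * w) \<in> cspan I (?U C0)" if "g \<in> G" "w \<in> W" for g w
  proof -
    have "c (g, w) \<le> C0" unfolding C0_def using that finG W(1) by (intro Max_ge) auto
    moreover have "p * (g * w) \<in> cspan I (?U (c (g, w)))" using c that by force
    ultimately show ?thesis using cspan_mono[OF bounded_products_mono] by blast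
  qed
  have step: "p * (g * q) \<in> cspan I (?U (C + C0))" if g: "g \<in> G" and q: "q \<in> cspan I (?U C)" for g q C
  proof -
    have "(p * g) * q \<in> cspan I (?U (C + C0))"
    proof (rule cspan_mult[OF I _ q])
      fix u assume "u \<in> ?U C"
      then obtain \<alpha> w where u: "u = power_prod f K \<alpha> * w" "w \<in> W" "\<forall>k\<in>K. \<alpha> k \<le> C" by (auto simp: bounded_products_def)
      have "power_prod f K \<alpha> * (p * (g * w)) \<in> cspan I (?U (C + C0))"
      proof (rule cspan_mult[OF I _ C0[OF g u(2)]])
        fix x assume "x \<in> ?U C0"
        then obtain \<beta> y where x: "x = power_prod f K \<beta> * y" "y \<in> W" "\<forall>k\<in>K. \<beta> k \<le> C0" by (auto simp: bounded_products_def)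
        have "power_prod f K \<alpha> * x = power_prod f K (\<lambda>k. \<alpha> k + \<beta> k) * y"
          unfolding x(1) by (simp only: power_prod_mult[symmetric] mult.assoc)
        moreover have "\<forall>k\<in>K. \<alpha> k + \<beta> k \<le> C + C0" using u(3) x(3) by (auto intro: add_mono)
        ultimately have "power_prod f K \<alpha> * x \<in> ?U (C + C0)" using x(2) unfolding bounded_products_def by blast
        then show "power_prod f K \<alpha> * x \<in> cspan I (?U (C + C0))" by (rule cspan.base)
      qed
      then show "(p * g) * u \<in> cspan I (?U (C + C0))" by (simp add: u(1) mult_ac)
    qed
    then show ?thesis by (simp add: mult_ac)
  qed
  have mon: "p ^ T * single a 1 \<in> cspan I (?U (T * C0))" if "mon_degree a \<le> T" for T a
    using that
  proof (induction T arbitrary: a)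
    case 0
    then have "a = 0" by simp
    have "power_prod f K (\<lambda>_. 0) * 1 \<in> ?U 0" unfolding bounded_products_def using W(2) by blast
    then show ?case using \<open>a = 0\<close> by (auto simp: power_prod_def intro: cspan.base)
  next
    case (Suc T)
    show ?case
    proof (cases "mon_degree a \<le> T")
      case True
      have "p * (1 * (p ^ T * single a 1)) \<in> cspan I (?U (T * C0 + C0))"
        by (rule step[OF _ Suc.IH[OF True]]) (simp add: G_def)
      then show ?thesis by (simp add: mult_ac add.commute)
    next
      case False
      then have "a \<noteq> 0" by auto
      then obtain v a' where a: "single a 1 = Var v * single a' (1::complex)" "mon_degree a = Suc (mon_degree a')"
        using mon_decompose by blast
      have "p * (Var v * (p ^ T * single a' 1)) \<in> cspan I (?U (T * C0 + C0))"
        by (rule step[OF _ Suc.IH]) (use Suc.prems a(2) in \<open>auto simp: G_def\<close>)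
      then show ?thesis by (simp add: a(1) mult_ac add.commute)
    qed
  qed
  show ?thesis
    unfolding growth_def
  proof (rule exI[of _ "(C0 + 1) ^ card K * card W"], rule allI)
    fix T
    define U where "U = ?U (T * C0)"
    define A where "A = {a :: 'v \<Rightarrow>\<^sub>0 nat. mon_degree a \<le> T}"
    have finU: "finite U" unfolding U_def by (rule finite_bounded_products[OF K W(1)])
    have finA: "finite A" unfolding A_def by (rule finite_mon_degree_le)
    have "\<forall>a\<in>A. \<exists>c. p ^ T * single a 1 - (\<Sum>u\<in>U. Cst (c u) * u) \<in> I"
      using cspan_coeffs[OF I finU] mon unfolding U_def A_def by blast
    then obtain c where c: "\<forall>a\<in>A. p ^ T * single a 1 - (\<Sum>u\<in>U. Cst (c a u) * u) \<in> I" unfolding bchoice_iff by (elim exE)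
    \<comment> \<open>The coefficient of \<open>u\<close> in a chosen expansion of
      \<open>p ^ T * q\<close> modulo \<open>I\<close>; if all of them vanish, then
      \<open>p ^ T * q\<close> and hence \<open>q\<close> lies in \<open>I\<close>.\<close>
    define l where "l u q = (\<Sum>a\<in>A. lookup q a * c a u)" for u and q :: "'v cpoly"
    have lin: "clinear_form (l u)" for u
      by (simp add: clinear_form_def l_def lookup_add distrib_right sum.distrib sum_distrib_left mult.assoc)
    have "card (l ` U) \<le> (C0 + 1) ^ card K * card W * (T + 1) ^ card K"
    proof -
      have "card (l ` U) \<le> card U" using finU by (rule card_image_le)
      also have "\<dots> \<le> (T * C0 + 1) ^ card K * card W" unfolding U_def by (rule finite_bounded_products[OF K W(1)])
      also have "\<dots> \<le> ((C0 + 1) * (T + 1)) ^ card K * card W"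
        by (intro mult_le_mono1 power_mono) (auto simp: algebra_simps)
      finally show ?thesis by (simp only: power_mult_distrib mult_ac)
    qed
    moreover have "q \<in> I" if q: "total_degree q \<le> T" "\<forall>m\<in>l ` U. m q = 0" for q
    proof -
      have pT: "r \<in> I" if "p ^ k * r \<in> I" for k r
        using that
      proof (induction k)
        case (Suc k)
        then have "p * (p ^ k * r) \<in> I" by (simp add: mult_ac)
        then show ?case using p Suc.IH by blast
      qed simp
      have "keys q \<subseteq> A" using q(1) by (auto simp: A_def total_degree_le_iff)
      from sum_single_keys[OF finA this] have q': "q = (\<Sum>a\<in>A. Cst (lookup q a) * single a 1)"
        by (simp flip: single_eq_Cst_mult)
      have "p ^ T * q = p ^ T * (\<Sum>a\<in>A. Cst (lookup q a) * single a 1)" using q' by (rule arg_cong)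
      then have pq: "p ^ T * q = (\<Sum>a\<in>A. Cst (lookup q a) * (p ^ T * single a 1))"
        by (simp add: sum_distrib_left mult_ac)
      have "(\<Sum>a\<in>A. Cst (lookup q a) * (p ^ T * single a 1 - (\<Sum>u\<in>U. Cst (c a u) * u))) \<in> I"
        using c by (intro is_ideal_sum[OF I] is_ideal_mult[OF I]) blast
      also have "(\<Sum>a\<in>A. Cst (lookup q a) * (p ^ T * single a 1 - (\<Sum>u\<in>U. Cst (c a u) * u)))
          = p ^ T * q - (\<Sum>a\<in>A. \<Sum>u\<in>U. Cst (lookup q a) * (Cst (c a u) * u))"
        by (simp only: right_diff_distrib sum_subtractf sum_distrib_left pq)
      also have "(\<Sum>a\<in>A. \<Sum>u\<in>U. Cst (lookup q a) * (Cst (c a u) * u)) = (\<Sum>u\<in>U. Cst (l u q) * u)"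
      proof -
        have "Cst (l u q) = (\<Sum>a\<in>A. Cst (lookup q a) * Cst (c a u) :: 'v cpoly)" for u
          unfolding l_def by (induction A rule: infinite_finite_induct) (auto simp: Cst_add Cst_mult)
        then show ?thesis by (subst sum.swap) (simp add: sum_distrib_right mult.assoc)
      qed
      also have "\<dots> = 0" using q(2) by simp
      finally have "p ^ T * q \<in> I" by simp
      then show "q \<in> I" by (rule pT)
    qed
    ultimately show "\<exists>\<Lambda>. finite \<Lambda> \<and> card \<Lambda> \<le> (C0 + 1) ^ card K * card W * (T + 1) ^ card K \<and> (\<forall>l\<in>\<Lambda>. clinear_form l) \<and>
      (\<forall>q. total_degree q \<le> T \<and> (\<forall>l\<in>\<Lambda>. l q = 0) \<longrightarrow> q \<in> I)"
      using finU lin by (intro exI[of _ "l ` U"]) blast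
  qed
qed

lemma poly_in_mult_cspan:
  fixes q :: "'v::finite cpoly"
  assumes I: "is_ideal I" and "q \<in> poly_in B" "w \<in> W"
  shows "q * w \<in> cspan I (\<Union>C. bounded_products Var B W C)"
proof -
  have "q * w = (\<Sum>a\<in>keys q. Cst (lookup q a) * (single a 1 * w))"
    by (subst sum_single_keys_self[of q]) (simp add: sum_distrib_right single_eq_Cst_mult[of _ "lookup q _"] mult.assoc)
  also have "\<dots> \<in> cspan I (\<Union>C. bounded_products Var B W C)"
  proof (intro cspan_sum[OF I] cspan.scale cspan.base)
    fix a assume a: "a \<in> keys q"
    have "single a 1 = power_prod Var B (lookup a)"
    proof -
      have "single a 1 = (\<Prod>v\<in>UNIV. Var v ^ lookup a v)" by (rule single_eq_prod_Var)
      also have "\<dots> = (\<Prod>v\<in>B. Var v ^ lookup a v)"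
        by (rule prod.mono_neutral_right) (use assms(2) a in \<open>auto simp: poly_in_def\<close>)
      finally show ?thesis by (simp add: power_prod_def)
    qed
    then have "single a 1 * w \<in> bounded_products Var B W (mon_degree a)"
      unfolding bounded_products_def using assms(3) lookup_le_mon_degree[of a]
      by (intro CollectI exI[of _ "lookup a"] exI[of _ w]) simp
    then show "single a 1 * w \<in> (\<Union>C. bounded_products Var B W C)" by blast
  qed
  finally show ?thesis .
qed

lemma poly_in_insert_expand:
  fixes r :: "'v::finite cpoly"
  assumes "r \<in> poly_in (insert v B)"
  shows "\<exists>a D. r = (\<Sum>i\<le>D. a i * Var v ^ i) \<and> (\<forall>i. a i \<in> poly_in (B - {v}))"
proof -
  define m where "m k = single (k - single v (lookup k v)) (lookup r k)" for k
  define D where "D = total_degree r"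
  define a where "a i = (\<Sum>k\<in>{k\<in>keys r. lookup k v = i}. m k)" for i
  have mk: "m k * Var v ^ lookup k v = single k (lookup r k)" for k
  proof -
    have "k = (k - single v (lookup k v)) + single v (lookup k v)"
      by (rule poly_mapping_eqI) (auto simp: lookup_add lookup_minus lookup_single when_def)
    moreover have "Var v ^ n = single (single v n) 1" for n :: nat
      by (induction n) (auto simp: Var_def mult_single single_add[symmetric])
    ultimately show ?thesis by (simp add: m_def mult_single)
  qed
  have "(\<Sum>i\<le>D. a i * Var v ^ i) = (\<Sum>i\<le>D. \<Sum>k\<in>{k\<in>keys r. lookup k v = i}. m k * Var v ^ lookup k v)"
    by (simp add: a_def sum_distrib_right)
  also have "\<dots> = (\<Sum>k\<in>keys r. m k * Var v ^ lookup k v)"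
    by (rule sum.group) (use lookup_le_mon_degree mon_degree_le_total_degree order_trans in \<open>fastforce simp: D_def\<close>)+
  also have "\<dots> = r" unfolding mk by (rule sum_single_keys_self[symmetric])
  finally have "r = (\<Sum>i\<le>D. a i * Var v ^ i)" ..
  moreover have "a i \<in> poly_in (B - {v})" for i
    unfolding a_def
  proof (rule poly_in_sum)
    fix k assume "k \<in> {k\<in>keys r. lookup k v = i}"
    then show "m k \<in> poly_in (B - {v})"
      using assms by (auto simp: m_def poly_in_def lookup_minus lookup_single when_def split: if_splits)
  qed
  ultimately show ?thesis by blast
qed

text \<open>The element \<open>r\<close> is read as a polynomial in \<open>Var v\<close>. Its
  leading coefficient is a nonzero polynomial in \<open>B\<close>, hence outside \<open>P\<close>,
  and its degree in \<open>Var v\<close> is positive since otherwise \<open>r\<close> would lie in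
  \<open>P \<inter> poly_in B\<close>.\<close>

lemma variable_relation:
  fixes P :: "'v::finite cpoly set"
  assumes "is_prime P" "P \<inter> poly_in B = {0}" "v \<notin> B" "r \<in> P" "r \<in> poly_in (insert v B)" "r \<noteq> 0"
  shows "\<exists>e a. e \<ge> 1 \<and> (\<forall>i. a i \<in> poly_in B) \<and> a e \<notin> P \<and> (\<Sum>i\<le>e. a i * Var v ^ i) \<in> P"
proof -
  obtain a D where r: "r = (\<Sum>i\<le>D. a i * Var v ^ i)" and a: "\<forall>i. a i \<in> poly_in (B - {v})"
    using poly_in_insert_expand[OF assms(5)] by blast
  have aB: "a i \<in> poly_in B" for i using a assms(3) by simp
  have "{i. i \<le> D \<and> a i \<noteq> 0} \<noteq> {}" using r assms(6) by (auto intro: sum.neutral)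
  define e where "e = Max {i. i \<le> D \<and> a i \<noteq> 0}"
  have fin: "finite {i. i \<le> D \<and> a i \<noteq> 0}" by simp
  have e: "e \<le> D" "a e \<noteq> 0" using Max_in[OF fin \<open>{i. i \<le> D \<and> a i \<noteq> 0} \<noteq> {}\<close>] by (auto simp: e_def)
  have big: "a i = 0" if "e < i" "i \<le> D" for i
    using Max_ge[OF fin, of i] that by (auto simp: e_def[symmetric])
  have re: "r = (\<Sum>i\<le>e. a i * Var v ^ i)"
    unfolding r by (rule sum.mono_neutral_right) (use e big in auto)
  have "e \<noteq> 0"
  proof
    assume "e = 0"
    then have "r \<in> poly_in B" using re aB by simp
    then show False using assms(2,4,6) by blast
  qed
  moreover have "a e \<notin> P" using e(2) aB assms(2) by blast
  ultimately show ?thesis using aB re assms(4) by (intro exI[of _ e] exI[of _ a]) auto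
qed

text \<open>A maximal set \<open>B\<close> of variables independent modulo \<open>P\<close> is a
  transcendence basis: each other variable satisfies an algebraic equation with coefficients in
  \<open>poly_in B\<close>.\<close>

lemma growth_prime:
  fixes P :: "'v::finite cpoly set"
  assumes P: "is_prime P" and n: "\<And>B. P \<inter> poly_in B = {0} \<Longrightarrow> card B \<le> n"
  shows "growth P n"
proof -
  note I = is_prime_ideal[OF P]
  have "P \<inter> poly_in {} = {0}"
  proof -
    have "p = 0" if "p \<in> P" "p \<in> poly_in {}" for p
    proof -
      have "p = Cst (lookup p 0)"
        by (rule poly_mapping_eqI)
          (use that(2) in \<open>force simp: Cst_def lookup_single when_def poly_in_def in_keys_iff intro: poly_mapping_eqI\<close>)
      then show ?thesis using is_prime_CstD[OF P] that(1) by (metis Cst_0)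
    qed
    then show ?thesis using is_ideal_zero[OF I] by auto
  qed
  then obtain B where B: "P \<inter> poly_in B = {0}" "\<forall>B'. P \<inter> poly_in B' = {0} \<longrightarrow> B \<subseteq> B' \<longrightarrow> B = B'"
    using finite_has_maximal[of "{B. P \<inter> poly_in B = {0}}"] by auto
  have rel: "\<exists>e a. e \<ge> 1 \<and> (\<forall>i. a i \<in> poly_in B) \<and> a e \<notin> P \<and> (\<Sum>i\<le>e. a i * Var v ^ i) \<in> P" if v: "v \<notin> B" for v
  proof -
    have "P \<inter> poly_in (insert v B) \<noteq> {0}" using B(2) v by blast
    then obtain r where "r \<in> P" "r \<in> poly_in (insert v B)" "r \<noteq> 0" using is_ideal_zero[OF I] by fastforce
    then show ?thesis by (rule variable_relation[OF P B(1) v])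
  qed
  have "\<forall>v. \<exists>e a. v \<notin> B \<longrightarrow> (e \<ge> 1 \<and> (\<forall>i. a i \<in> poly_in B) \<and> a e \<notin> P \<and> (\<Sum>i\<le>e. a i * Var v ^ i) \<in> P)"
    using rel by simp
  then obtain e a where ea: "\<forall>v. v \<notin> B \<longrightarrow> (e v \<ge> 1 \<and> (\<forall>i. a v i \<in> poly_in B) \<and> a v (e v) \<notin> P \<and> (\<Sum>i\<le>e v. a v i * Var v ^ i) \<in> P)"
    unfolding choice_iff by (elim exE)
  \<comment> \<open>The common denominator: the product of the leading coefficients of all the
    equations.\<close>
  define p where "p = (\<Prod>v\<in>-B. a v (e v))"
  have pP: "p \<notin> P" unfolding p_def using is_prime_prodD[OF P, of "\<lambda>v. a v (e v)" "-B"] ea by blast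
  \<comment> \<open>Outside \<open>B\<close>, only exponents below the degrees \<open>e v\<close>
    are kept; higher powers are rewritten by the equations.\<close>
  define N where "N = {b. (\<forall>v\<in>B. lookup b v = 0) \<and> (\<forall>v. v \<notin> B \<longrightarrow> lookup b v < e v)}"
  define W where "W = (\<lambda>b. single b (1::complex)) ` N"
  have "finite N"
  proof (rule finite_subset[OF _ finite_mon_degree_le])
    show "N \<subseteq> {b. mon_degree b \<le> (\<Sum>v\<in>UNIV. e v)}"
    proof
      fix b assume b: "b \<in> N"
      have "lookup b v \<le> e v" for v using b by (cases "v \<in> B") (auto simp: N_def less_imp_le)
      then show "b \<in> {b. mon_degree b \<le> (\<Sum>v\<in>UNIV. e v)}" by (auto simp: mon_degree_def intro: sum_mono)
    qed
  qed
  then have W: "finite W" by (simp add: W_def)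
  have "0 \<in> N" using ea by (force simp: N_def)
  then have W1: "1 \<in> W" unfolding W_def by (intro image_eqI[of _ _ 0]) simp_all
  have ain: "a v i \<in> poly_in B" if "v \<notin> B" for v i using ea that by blast
  have pB: "(\<Prod>v\<in>A. a v (e v)) \<in> poly_in B" if "A \<subseteq> -B" for A
    using ain that by (intro poly_in_prod) blast
  have "growth P (card B)"
  proof (rule growth_of_generators[OF I _ _ W W1, of p])
    show "q \<in> P" if "p * q \<in> P" for q using is_prime_multD[OF P that] pP by blast
    show "finite B" by simp
    show "p * w \<in> cspan P (\<Union>C. bounded_products Var B W C)" if "w \<in> W" for w
      unfolding p_def by (rule poly_in_mult_cspan[OF I pB that]) simp
    fix w v assume w: "w \<in> W"
    then obtain b where b: "w = single b 1" "b \<in> N" by (auto simp: W_def)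
    show "p * (Var v * w) \<in> cspan P (\<Union>C. bounded_products Var B W C)"
    proof (cases "v \<in> B")
      case True
      have "(p * Var v) * w \<in> cspan P (\<Union>C. bounded_products Var B W C)"
        unfolding p_def using True by (intro poly_in_mult_cspan[OF I _ w] poly_in_mult pB) auto
      then show ?thesis by (simp add: mult_ac)
    next
      case v: False
      show ?thesis
      proof (cases "lookup b v + 1 < e v")
        case True
        have "Var v * w = single (single v 1 + b) 1" by (simp add: b Var_def mult_single)
        moreover have "single v 1 + b \<in> N"
          using b(2) True v by (auto simp: N_def lookup_add lookup_single when_def)
        ultimately have "Var v * w \<in> W" unfolding W_def by blast
        then show ?thesis unfolding p_def by (intro poly_in_mult_cspan[OF I pB]) simp_all
      next
        case False
        define b' where "b' = b - single v (lookup b v)"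
        define p' where "p' = (\<Prod>u\<in>-B - {v}. a u (e u))"
        have pp: "p = a v (e v) * p'"
          unfolding p_def p'_def by (rule prod.remove) (use v in auto)
        have Vp: "Var v ^ i * single b' 1 = single (single v i + b') 1" for i
        proof -
          have "Var v ^ i = single (single v i) 1"
            by (induction i) (auto simp: Var_def mult_single single_add[symmetric])
          then show ?thesis by (simp add: mult_single)
        qed
        have inW: "Var v ^ i * single b' 1 \<in> W" if "i < e v" for i
        proof -
          have "single v i + b' \<in> N"
            using b(2) that v by (auto simp: N_def b'_def lookup_add lookup_minus lookup_single when_def)
          then show ?thesis unfolding Vp W_def by blast
        qed
        \<comment> \<open>Multiplication by \<open>Var v\<close> reaches exactly the power
          \<open>e v\<close>, so one use of the equation for \<open>v\<close>, multiplied by the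
          other leading coefficients \<open>p'\<close>, brings it back.\<close>
        have ev: "lookup b v + 1 = e v" using False b(2) v unfolding N_def by force
        have "single v (e v) + b' = single v 1 + b"
          by (rule poly_mapping_eqI) (auto simp: b'_def lookup_add lookup_minus lookup_single when_def ev[symmetric])
        then have Vw: "Var v * w = Var v ^ e v * single b' 1" unfolding Vp by (simp add: b Var_def mult_single)
        have spl: "(\<Sum>i\<le>e v. a v i * Var v ^ i) = (\<Sum>i<e v. a v i * Var v ^ i) + a v (e v) * Var v ^ e v"
          unfolding lessThan_Suc_atMost[symmetric] by simp
        have 1: "- (\<Sum>i<e v. (p' * a v i) * (Var v ^ i * single b' 1)) \<in> cspan P (\<Union>C. bounded_products Var B W C)"
          by (intro cspan_uminus cspan_sum[OF I] poly_in_mult_cspan[OF I] poly_in_mult ain v inW)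
            (auto simp: p'_def intro!: pB)
        have "p * (Var v * w) - (- (\<Sum>i<e v. (p' * a v i) * (Var v ^ i * single b' 1)))
           = (p' * single b' 1) * (\<Sum>i\<le>e v. a v i * Var v ^ i)"
          unfolding spl Vw pp by (simp add: distrib_left sum_distrib_left mult_ac)
        also have "\<dots> \<in> P" using ea v by (intro is_ideal_mult[OF I]) blast
        finally show ?thesis by (rule cspan_cong[OF I 1])
      qed
    qed
  qed
  then show ?thesis using n[OF B(1)] growth_mono by blast
qed

text \<open>The monomials of degree below \<open>T\<close> generate the quotient over the subring
  generated by the \<open>f j\<close>: multiplication by a variable leaves this set only at degree
  exactly \<open>T\<close>, where \<open>rel\<close> applies. The denominator is 1.\<close>

lemma growth_of_finite_quotient:
  fixes J :: "'v::finite cpoly set"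
  assumes J: "is_ideal J" and K: "finite K" and T: "T \<ge> 1"
    and rel: "\<And>a. mon_degree a = T \<Longrightarrow> \<exists>h. single a 1 - (\<Sum>j\<in>K. f j * h j) \<in> J \<and> (\<forall>j\<in>K. total_degree (h j) < T)"
  shows "growth J (card K)"
proof -
  define W where "W = (\<lambda>a. single a (1::complex)) ` {a :: 'v \<Rightarrow>\<^sub>0 nat. mon_degree a < T}"
  let ?S = "cspan J (\<Union>C. bounded_products f K W C)"
  have "{a :: 'v \<Rightarrow>\<^sub>0 nat. mon_degree a < T} \<subseteq> {a. mon_degree a \<le> T}" by auto
  then have W: "finite W" unfolding W_def using finite_subset finite_mon_degree_le by blast
  have W1: "1 \<in> W" unfolding W_def using T by (intro image_eqI[of _ _ 0]) simp_all
  have WS: "w \<in> ?S" if "w \<in> W" for w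
  proof -
    have "power_prod f K (\<lambda>_. 0) * w \<in> bounded_products f K W 0" unfolding bounded_products_def using that by blast
    then show ?thesis by (intro cspan.base) (auto simp: power_prod_def)
  qed
  have fS: "f j * w \<in> ?S" if "j \<in> K" "w \<in> W" for j w
  proof -
    have "power_prod f K (\<lambda>k. if k = j then 1 else 0) = (\<Prod>k\<in>K. if k = j then f k else 1)"
      unfolding power_prod_def by (rule prod.cong) auto
    also have "\<dots> = f j" using K that(1) by simp
    finally have "f j * w = power_prod f K (\<lambda>k. if k = j then 1 else 0) * w" by simp
    moreover have "\<forall>k\<in>K. (if k = j then 1 else 0) \<le> (1::nat)" by simp
    ultimately have "f j * w \<in> bounded_products f K W 1" unfolding bounded_products_def using that(2) by blast
    then show ?thesis by (intro cspan.base) blast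
  qed
  show ?thesis
  proof (rule growth_of_generators[OF J _ K W W1, of 1])
    show "1 * w \<in> ?S" if "w \<in> W" for w using WS[OF that] by simp
    fix w v assume "w \<in> W"
    then obtain b where b: "w = single b 1" "mon_degree b < T" by (auto simp: W_def)
    have Vw: "Var v * w = single (single v 1 + b) 1" by (simp add: b Var_def mult_single)
    show "1 * (Var v * w) \<in> ?S"
    proof (cases "Suc (mon_degree b) < T")
      case True
      then have "Var v * w \<in> W" unfolding Vw W_def by (intro imageI) simp
      then show ?thesis using WS by simp
    next
      case False
      then have "mon_degree (single v 1 + b) = T" using b(2) by simp
      from rel[OF this] obtain h where h: "Var v * w - (\<Sum>j\<in>K. f j * h j) \<in> J" "\<forall>j\<in>K. total_degree (h j) < T"
        unfolding Vw by blast
      have "f j * h j \<in> ?S" if j: "j \<in> K" for j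
      proof -
        have "f j * h j = (\<Sum>a\<in>keys (h j). Cst (lookup (h j) a) * (f j * single a 1))"
          by (subst sum_single_keys_self[of "h j"])
            (simp add: sum_distrib_left single_eq_Cst_mult[of _ "lookup (h j) _"] mult_ac)
        also have "\<dots> \<in> ?S"
        proof (intro cspan_sum[OF J] cspan.scale fS[OF j])
          fix a assume "a \<in> keys (h j)"
          then have "mon_degree a < T" using h(2) j mon_degree_le_total_degree[of a "h j"] by (meson le_less_trans)
          then show "single a 1 \<in> W" by (auto simp: W_def)
        qed
        finally show ?thesis .
      qed
      then have "(\<Sum>j\<in>K. f j * h j) \<in> ?S" by (rule cspan_sum[OF J])
      from cspan_cong[OF J this h(1)] show ?thesis by simp
    qed
  qed simp
qed

section \<open>Cones and the affine chart\<close>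

text \<open>The scalar 0 is allowed, so the cone over a nonempty set contains the origin, whose
  ideal later tops the prime chains.\<close>

definition cone :: "(complex^'v::finite) set \<Rightarrow> (complex^'v) set" where
  "cone Z = {(\<chi> v. c * z $ v) | c z. z \<in> Z}"

text \<open>The restriction of \<open>p\<close> to the line through \<open>z\<close>, as a
  polynomial in the scalar; its coefficients are the values of the homogeneous components at
  \<open>z\<close>.\<close>

definition radial_poly :: "'v::finite cpoly \<Rightarrow> complex^'v \<Rightarrow> complex poly" where
  "radial_poly p z = (\<Sum>s\<le>total_degree p. monom (poly_at (hcomp (int s) p) z) s)"

lemma poly_at_scale: "poly_at p (\<chi> v. c * z $ v) = (\<Sum>s\<le>total_degree p. c ^ s * poly_at (hcomp (int s) p) z)"
proof -
  have "poly_at p (\<chi> v. c * z $ v) = poly_at (\<Sum>s\<le>total_degree p. hcomp (int s) p) (\<chi> v. c * z $ v)"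
    by (simp only: sum_hcomp[OF order_refl, symmetric])
  also have "\<dots> = (\<Sum>s\<le>total_degree p. c ^ s * poly_at (hcomp (int s) p) z)"
    by (simp only: poly_at_sum poly_at_homogeneous_scale[OF homogeneous_hcomp])
  finally show ?thesis .
qed

lemma poly_radial_poly: "poly (radial_poly p z) c = poly_at p (\<chi> v. c * z $ v)"
  by (simp add: radial_poly_def poly_at_scale poly_sum poly_monom mult.commute)

lemma coeff_radial_poly: "coeff (radial_poly p z) s = poly_at (hcomp (int s) p) z"
proof -
  have "coeff (radial_poly p z) s = (\<Sum>i\<le>total_degree p. if i = s then poly_at (hcomp (int i) p) z else 0)"
    by (simp add: radial_poly_def coeff_sum coeff_monom)
  also have "\<dots> = poly_at (hcomp (int s) p) z"
  proof (cases "s \<le> total_degree p")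
    case False
    then have "hcomp (int s) p = 0"
      by (intro poly_mapping_eqI) (use mon_degree_le_total_degree[of _ p] in \<open>auto simp: lookup_hcomp in_keys_iff\<close>)
    then show ?thesis using False by simp
  qed simp
  finally show ?thesis .
qed

text \<open>A polynomial vanishes on a whole line through the origin exactly when all coefficients
  of its restriction vanish, so the ideal of a cone is homogeneous.\<close>

lemma vanishing_ideal_cone_iff: "p \<in> vanishing_ideal (cone Z) \<longleftrightarrow> (\<forall>t. hcomp t p \<in> vanishing_ideal Z)"
proof
  assume p: "p \<in> vanishing_ideal (cone Z)"
  show "\<forall>t. hcomp t p \<in> vanishing_ideal Z"
  proof
    fix t
    show "hcomp t p \<in> vanishing_ideal Z"
    proof (cases "t < 0")
      case True
      then show ?thesis by (simp add: hcomp_neg vanishing_ideal_def)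
    next
      case False
      then obtain s where s: "t = int s" by (metis nonneg_int_cases not_less)
      have "poly_at (hcomp t p) z = 0" if "z \<in> Z" for z
      proof -
        have "poly (radial_poly p z) c = 0" for c
          using p that by (auto simp: poly_radial_poly vanishing_ideal_def cone_def)
        then have "radial_poly p z = 0" by (simp add: poly_all_0_iff_0[symmetric])
        then show ?thesis using coeff_radial_poly[of p z s] s by simp
      qed
      then show ?thesis by (simp add: vanishing_ideal_def)
    qed
  qed
next
  assume "\<forall>t. hcomp t p \<in> vanishing_ideal Z"
  then show "p \<in> vanishing_ideal (cone Z)" by (auto simp: vanishing_ideal_def cone_def poly_at_scale)
qed

lemma hcomp_in_vanishing_ideal_cone: "p \<in> vanishing_ideal (cone Z) \<Longrightarrow> hcomp t p \<in> vanishing_ideal (cone Z)"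
  unfolding vanishing_ideal_cone_iff hcomp_hcomp by (auto simp: vanishing_ideal_def)

lemma homogeneous_in_vanishing_ideal_cone:
  "homogeneous t p \<Longrightarrow> p \<in> vanishing_ideal (cone Z) \<longleftrightarrow> p \<in> vanishing_ideal Z"
proof -
  assume h: "homogeneous t p"
  have "0 \<in> vanishing_ideal Z" by (simp add: vanishing_ideal_def)
  then show ?thesis
    unfolding vanishing_ideal_cone_iff hcomp_homogeneous[OF h] by auto
qed

lemma cone_mono: "A \<subseteq> B \<Longrightarrow> cone A \<subseteq> cone B"
  by (auto simp: cone_def)

lemma is_prime_vanishing_ideal_cone:
  assumes Z: "is_prime (vanishing_ideal Z)"
  shows "is_prime (vanishing_ideal (cone Z))"
  unfolding is_prime_def
proof (intro conjI allI impI is_ideal_vanishing_ideal)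
  have "Z \<noteq> {}" using is_prime_one[OF Z] by (auto simp: vanishing_ideal_def)
  then show "1 \<notin> vanishing_ideal (cone Z)" by (auto simp: vanishing_ideal_def cone_def)
next
  fix p q assume pq: "p * q \<in> vanishing_ideal (cone Z)"
  show "p \<in> vanishing_ideal (cone Z) \<or> q \<in> vanishing_ideal (cone Z)"
  proof (rule ccontr)
    assume "\<not> ?thesis"
    then obtain y z c e where yz: "y \<in> Z" "z \<in> Z"
      "poly (radial_poly p y) c \<noteq> 0" "poly (radial_poly q z) e \<noteq> 0"
      by (auto simp: vanishing_ideal_def cone_def poly_radial_poly)
    then have "radial_poly p y \<noteq> 0" "radial_poly q z \<noteq> 0" by auto
    then have "finite ({t. poly (radial_poly p y) t = 0} \<union> {t. poly (radial_poly q z) t = 0})"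
      by (simp add: poly_roots_finite)
    \<comment> \<open>The two witnesses may come with different scalars, but each fails for finitely
      many only; a common scalar \<open>t\<close> moves the question to the ideal of
      \<open>Z\<close>, which is prime.\<close>
    from ex_new_if_finite[OF infinite_UNIV_char_0 this] obtain t where
      t: "poly (radial_poly p y) t \<noteq> 0" "poly (radial_poly q z) t \<noteq> 0" by auto
    define r where "r p = (\<Sum>s\<le>total_degree p. Cst (t ^ s) * hcomp (int s) p)" for p :: "'a cpoly"
    have r: "poly_at (r p) x = poly_at p (\<chi> v. t * x $ v)" for p x
      by (simp add: r_def poly_at_scale)
    have "r p \<notin> vanishing_ideal Z" "r q \<notin> vanishing_ideal Z"
      using t yz by (auto simp: vanishing_ideal_def r poly_radial_poly)
    then have "r p * r q \<notin> vanishing_ideal Z" using is_prime_multD[OF Z] by blast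
    then obtain x where "x \<in> Z" "poly_at (p * q) (\<chi> v. t * x $ v) \<noteq> 0" by (auto simp: vanishing_ideal_def r)
    then show False using pq by (auto simp: vanishing_ideal_def cone_def)
  qed
qed

section \<open>Passing between affine and homogeneous polynomials\<close>

definition affine_mon :: "('n::finite option \<Rightarrow>\<^sub>0 nat) \<Rightarrow> ('n \<Rightarrow>\<^sub>0 nat)" where
  "affine_mon a = Poly_Mapping.Abs_poly_mapping (\<lambda>i. lookup a (Some i))"

definition dehomogenize :: "'n::finite option cpoly \<Rightarrow> 'n cpoly" where
  "dehomogenize p = (\<Sum>a\<in>keys p. single (affine_mon a) (lookup p a))"

lemma lookup_affine_mon: "lookup (affine_mon a) i = lookup a (Some i)"
  by (simp add: affine_mon_def)

lemma sum_UNIV_option: "(\<Sum>v\<in>UNIV. g v) = g None + (\<Sum>i\<in>UNIV. g (Some i))" for g :: "'n::finite option \<Rightarrow> 'b::comm_monoid_add"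
  by (simp add: UNIV_option_conv sum.reindex)

lemma prod_UNIV_option: "(\<Prod>v\<in>UNIV. g v) = g None * (\<Prod>i\<in>UNIV. g (Some i))" for g :: "'n::finite option \<Rightarrow> 'b::comm_monoid_mult"
  by (simp add: UNIV_option_conv prod.reindex)

lemma mon_at_affine_chart: "mon_at a (affine_chart x) = mon_at (affine_mon a) x"
  by (simp add: mon_at_def prod_UNIV_option affine_chart_def lookup_affine_mon)

lemma poly_at_dehomogenize: "poly_at (dehomogenize p) x = poly_at p (affine_chart x)"
  by (simp add: dehomogenize_def poly_at_single poly_at_alt[OF finite_keys order_refl, of p] mon_at_affine_chart)

lemma dehomogenize_add: "dehomogenize (p + q) = dehomogenize p + dehomogenize q"
  by (rule cpoly_eqI) (simp add: poly_at_dehomogenize)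

lemma dehomogenize_mult: "dehomogenize (p * q) = dehomogenize p * dehomogenize q"
  by (rule cpoly_eqI) (simp add: poly_at_dehomogenize)

lemma dehomogenize_Cst: "dehomogenize (Cst c) = Cst c"
  by (rule cpoly_eqI) (simp add: poly_at_dehomogenize)

lemma dehomogenize_0 [simp]: "dehomogenize 0 = 0" and dehomogenize_1 [simp]: "dehomogenize 1 = 1"
  using dehomogenize_Cst[of 0] dehomogenize_Cst[of 1] by simp_all

lemma total_degree_dehomogenize_le: "total_degree (dehomogenize p) \<le> total_degree p"
  unfolding dehomogenize_def
proof (rule total_degree_sum_le)
  fix a assume a: "a \<in> keys p"
  have "mon_degree (affine_mon a) \<le> mon_degree a"
    by (simp add: mon_degree_def sum_UNIV_option lookup_affine_mon)
  then show "total_degree (single (affine_mon a) (lookup p a)) \<le> total_degree p"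
    by (rule order_trans[OF order_trans[OF total_degree_single_le] mon_degree_le_total_degree[OF a]])
qed

lemma lookup_homogenize_mon:
  "lookup (homogenize_mon d a) v = (case v of None \<Rightarrow> d - mon_degree a | Some i \<Rightarrow> lookup a i)"
  by (simp add: homogenize_mon_def)

lemma poly_at_homogenize: "poly_at (homogenize d p) (affine_chart x) = poly_at p x"
proof -
  have "affine_mon (homogenize_mon d a) = a" for a :: "'a \<Rightarrow>\<^sub>0 nat"
    by (rule poly_mapping_eqI) (simp add: lookup_affine_mon lookup_homogenize_mon)
  then show ?thesis
    by (simp add: homogenize_def poly_at_single mon_at_affine_chart poly_at_alt[OF finite_keys order_refl, of p])
qed

lemma homogeneous_homogenize:
  assumes "total_degree p \<le> d" shows "homogeneous (int d) (homogenize d p)"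
  unfolding homogenize_def
proof (rule homogeneous_sum)
  fix a assume "a \<in> keys p"
  then have "mon_degree a \<le> d" using assms total_degree_le_iff by blast
  then have "mon_degree (homogenize_mon d a) = d"
    by (simp add: mon_degree_def[of "homogenize_mon d a"] sum_UNIV_option lookup_homogenize_mon mon_degree_def[of a, symmetric])
  then show "homogeneous (int d) (single (homogenize_mon d a) (lookup p a))"
    by (simp add: homogeneous_def)
qed

lemma dehomogenize_homogenize: "dehomogenize (homogenize d p) = p"
  by (rule cpoly_eqI) (simp add: poly_at_dehomogenize poly_at_homogenize)

lemma vanishing_ideal_chart_iff: "p \<in> vanishing_ideal (affine_chart ` V) \<longleftrightarrow> dehomogenize p \<in> vanishing_ideal V"
  by (auto simp: vanishing_ideal_def poly_at_dehomogenize)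

lemma is_prime_vanishing_ideal_chart:
  assumes V: "is_prime (vanishing_ideal V)"
  shows "is_prime (vanishing_ideal (affine_chart ` V))"
  unfolding is_prime_def vanishing_ideal_chart_iff
  using is_prime_one[OF V] is_prime_multD[OF V]
  by (auto simp: is_ideal_vanishing_ideal dehomogenize_mult)

text \<open>The homogeneous components of \<open>p\<close> cut out a projective variety, which gives
  one inclusion. For the other, the closure contains all nonzero multiples of chart points, and
  vanishing at the multiple 0 follows because a polynomial in the scalar with infinitely many roots
  is 0.\<close>

lemma homogeneous_ideal_projective_closure:
  "homogeneous_ideal (projective_closure V) = vanishing_ideal (cone (affine_chart ` V))"
proof (intro subset_antisym subsetI)
  fix p assume p: "p \<in> vanishing_ideal (cone (affine_chart ` V))"
  define X where "X = {z. z \<noteq> 0 \<and> (\<forall>h\<in>range (\<lambda>t. hcomp t p). poly_at h z = 0)}"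
  have "projective_variety X"
    unfolding projective_variety_def X_def
    by (intro exI[of _ "range (\<lambda>t. hcomp t p)"] conjI refl) (auto intro: homogeneous_hcomp)
  moreover have "affine_chart ` V \<subseteq> X"
  proof
    fix z assume z: "z \<in> affine_chart ` V"
    then have "z $ None = 1" by (auto simp: affine_chart_def)
    then have "z \<noteq> 0" by auto
    then show "z \<in> X" using p z unfolding X_def vanishing_ideal_cone_iff by (auto simp: vanishing_ideal_def)
  qed
  ultimately have sub: "projective_closure V \<subseteq> X" unfolding projective_closure_def by blast
  show "p \<in> homogeneous_ideal (projective_closure V)"
    unfolding homogeneous_ideal_def
  proof (rule CollectI, rule ballI)
    fix z assume "z \<in> projective_closure V"
    then have "\<forall>t. poly_at (hcomp t p) z = 0" using sub by (auto simp: X_def)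
    moreover have "poly_at p z = poly_at (\<Sum>s\<le>total_degree p. hcomp (int s) p) z"
      by (simp only: sum_hcomp[OF order_refl, symmetric])
    ultimately show "poly_at p z = 0" by simp
  qed
next
  fix p assume p: "p \<in> homogeneous_ideal (projective_closure V)"
  have inX: "(\<chi> v. c * z $ v) \<in> projective_closure V" if cz: "c \<noteq> 0" "z \<in> affine_chart ` V" for c z
    unfolding projective_closure_def
  proof (rule InterI)
    fix X assume "X \<in> {X. projective_variety X \<and> affine_chart ` V \<subseteq> X}"
    then obtain H where H: "\<forall>h\<in>H. \<exists>t. homogeneous t h" "X = {z. z \<noteq> 0 \<and> (\<forall>h\<in>H. poly_at h z = 0)}" "z \<in> X"
      using cz(2) unfolding projective_variety_def by auto
    have "(\<chi> v. c * z $ v) \<noteq> 0" using H(2,3) cz(1) by (auto simp: vec_eq_iff)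
    moreover have "poly_at h (\<chi> v. c * z $ v) = 0" if hH: "h \<in> H" for h
    proof -
      obtain t where t: "homogeneous t h" using H(1) hH by blast
      have hz: "poly_at h z = 0" using H(2,3) hH by blast
      show ?thesis
      proof (cases "t < 0")
        case True
        then have "h = 0" using t hcomp_neg[OF True, of h] by (simp add: homogeneous_iff_hcomp)
        then show ?thesis by simp
      next
        case False
        then obtain s where "t = int s" by (metis nonneg_int_cases not_less)
        then show ?thesis using t hz by (simp add: poly_at_homogeneous_scale)
      qed
    qed
    ultimately show "(\<chi> v. c * z $ v) \<in> X" using H(2) by blast
  qed
  have "poly (radial_poly p z) c = 0" if "z \<in> affine_chart ` V" for z c
  proof -
    have "poly (radial_poly p z) c = 0" if "c \<noteq> 0" for c
      using p inX[OF that \<open>z \<in> affine_chart ` V\<close>] by (simp add: poly_radial_poly homogeneous_ideal_def)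
    then have "UNIV - {0} \<subseteq> {c. poly (radial_poly p z) c = 0}" by blast
    moreover have "infinite (UNIV - {0::complex})" by (simp add: infinite_UNIV_char_0)
    ultimately have "infinite {c. poly (radial_poly p z) c = 0}" using finite_subset by blast
    then have "radial_poly p z = 0" using poly_roots_finite by blast
    then show ?thesis by simp
  qed
  then show "p \<in> vanishing_ideal (cone (affine_chart ` V))"
    by (auto simp: vanishing_ideal_def cone_def poly_radial_poly)
qed

section \<open>Dimension of the affine cone\<close>

text \<open>Finitely many primes lie below all primes over \<open>vanishing_ideal V\<close>. Each
  has growth of order \<open>n\<close>, because variables independent modulo it give a chain of
  primes; their intersection vanishes on \<open>V\<close>, because the ideal of each point of
  \<open>V\<close> contains one of them.\<close>

lemma growth_vanishing_ideal:
  assumes V: "affine_variety V" "pure_dimensional V n"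
  shows "growth (vanishing_ideal V) n"
proof -
  from finite_primes_over[OF is_ideal_vanishing_ideal[of V]]
  obtain \<P> where P: "finite \<P>" "\<forall>P\<in>\<P>. is_prime P \<and> vanishing_ideal V \<subseteq> P"
    "\<forall>Q. is_prime Q \<and> vanishing_ideal V \<subseteq> Q \<longrightarrow> (\<exists>P\<in>\<P>. P \<subseteq> Q)"
    by (elim exE conjE)
  have "growth P n" if "P \<in> \<P>" for P
  proof (rule growth_prime)
    show "is_prime P" using P(2) that by blast
    fix B assume "P \<inter> poly_in B = {0}"
    from prime_chain_of_independent_variables[OF finite \<open>is_prime P\<close> this]
    obtain C where "prime_chain C (card B)" "C 0 = P" by blast
    then show "card B \<le> n" using prime_chain_le_dim[OF V, of C] P(2) that by blast
  qed
  then have "growth (\<Inter>\<P>) n" by (rule growth_Inter[OF P(1)])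
  moreover have "\<Inter>\<P> \<subseteq> vanishing_ideal V"
  proof
    fix p assume p: "p \<in> \<Inter>\<P>"
    have "poly_at p x = 0" if "x \<in> V" for x
    proof -
      have "vanishing_ideal V \<subseteq> vanishing_ideal {x}" using that by (intro vanishing_ideal_mono) simp
      then obtain P where "P \<in> \<P>" "P \<subseteq> vanishing_ideal {x}" using P(3) is_prime_point by blast
      then show ?thesis using p by (auto simp: vanishing_ideal_def)
    qed
    then show "p \<in> vanishing_ideal V" by (simp add: vanishing_ideal_def)
  qed
  ultimately show ?thesis using growth_mono by blast
qed

text \<open>A form on the cone is determined by its dehomogenization on \<open>V\<close>; testing
  the degrees 0 to \<open>T\<close> separately costs one more factor \<open>T + 1\<close>.\<close>

lemma growth_cone:
  fixes V :: "(complex^'n::finite) set"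
  assumes "growth (vanishing_ideal V) m"
  shows "growth (vanishing_ideal (cone (affine_chart ` V))) (Suc m)"
proof -
  obtain C :: nat where C: "\<forall>T. \<exists>\<Lambda>. finite \<Lambda> \<and> card \<Lambda> \<le> C * (T + 1) ^ m \<and> (\<forall>l\<in>\<Lambda>. clinear_form l) \<and>
     (\<forall>q. total_degree q \<le> T \<and> (\<forall>l\<in>\<Lambda>. l q = 0) \<longrightarrow> q \<in> vanishing_ideal V)"
    using assms unfolding growth_def by (elim exE)
  show ?thesis
    unfolding growth_def
  proof (rule exI[of _ C], rule allI)
    fix T
    obtain \<Lambda> where L: "finite \<Lambda>" "card \<Lambda> \<le> C * (T + 1) ^ m" "\<forall>l\<in>\<Lambda>. clinear_form l"
      "\<forall>q. total_degree q \<le> T \<and> (\<forall>l\<in>\<Lambda>. l q = 0) \<longrightarrow> q \<in> vanishing_ideal V"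
      using C[rule_format, of T] by (elim exE conjE)
    define h where "h = (\<lambda>(l, s) (q :: 'n option cpoly). l (dehomogenize (hcomp (int s) q)) :: complex)"
    define \<Lambda>' where "\<Lambda>' = h ` (\<Lambda> \<times> {..T})"
    have "card \<Lambda>' \<le> card (\<Lambda> \<times> {..T})" unfolding \<Lambda>'_def using L(1) by (intro card_image_le) simp
    also have "\<dots> = card \<Lambda> * (T + 1)" by (simp add: card_cartesian_product)
    also have "\<dots> \<le> C * (T + 1) ^ m * (T + 1)" using L(2) by (rule mult_le_mono1)
    finally have "card \<Lambda>' \<le> C * (T + 1) ^ Suc m" by (simp add: mult_ac)
    moreover have "clinear_form l'" if "l' \<in> \<Lambda>'" for l'
    proof -
      obtain l s where "l \<in> \<Lambda>" "l' = h (l, s)" using \<open>l' \<in> \<Lambda>'\<close> by (auto simp: \<Lambda>'_def)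
      then show ?thesis using L(3)
        by (simp add: clinear_form_def h_def dehomogenize_add dehomogenize_mult dehomogenize_Cst hcomp_Cst_mult)
    qed
    moreover have "q \<in> vanishing_ideal (cone (affine_chart ` V))"
      if q: "total_degree q \<le> T" "\<forall>l'\<in>\<Lambda>'. l' q = 0" for q
      unfolding vanishing_ideal_cone_iff vanishing_ideal_chart_iff
    proof
      fix t
      show "dehomogenize (hcomp t q) \<in> vanishing_ideal V"
      proof (cases "t < 0 \<or> t > int T")
        case True
        then have "hcomp t q = 0"
          by (intro poly_mapping_eqI) (use q(1) mon_degree_le_total_degree[of _ q] in \<open>fastforce simp: lookup_hcomp in_keys_iff\<close>)
        then show ?thesis by (simp add: vanishing_ideal_def)
      next
        case False
        then obtain s where s: "t = int s" "s \<le> T" by (metis nonneg_int_cases not_less of_nat_le_iff)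
        have "total_degree (dehomogenize (hcomp t q)) \<le> T"
          by (rule order_trans[OF total_degree_dehomogenize_le homogeneous_total_degree_le[OF homogeneous_hcomp]]) (use s in simp)
        moreover have "l (dehomogenize (hcomp t q)) = 0" if "l \<in> \<Lambda>" for l
        proof -
          have "h (l, s) \<in> \<Lambda>'" unfolding \<Lambda>'_def using that s by (intro imageI) simp
          then have "h (l, s) q = 0" using q(2) by blast
          then show ?thesis by (simp add: h_def s)
        qed
        ultimately show ?thesis using L(4) by blast
      qed
    qed
    moreover have "finite \<Lambda>'" unfolding \<Lambda>'_def using L(1) by simp
    ultimately show "\<exists>\<Lambda>. finite \<Lambda> \<and> card \<Lambda> \<le> C * (T + 1) ^ Suc m \<and> (\<forall>l\<in>\<Lambda>. clinear_form l) \<and>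
     (\<forall>q. total_degree q \<le> T \<and> (\<forall>l\<in>\<Lambda>. l q = 0) \<longrightarrow> q \<in> vanishing_ideal (cone (affine_chart ` V)))"
      by (intro exI[of _ \<Lambda>']) blast
  qed
qed

text \<open>The ideals of the cones over a chain for \<open>V\<close> are followed by the ideal of
  the origin, which adds one step; \<open>Var None\<close> separates the last two ideals.\<close>

lemma ex_prime_chain_cone:
  fixes V :: "(complex^'n::finite) set"
  assumes V: "affine_variety V" "pure_dimensional V n" "V \<noteq> {}"
  shows "\<exists>C. prime_chain C (Suc n) \<and> vanishing_ideal (cone (affine_chart ` V)) \<subseteq> C 0"
proof -
  obtain C where C: "prime_chain C n" "vanishing_ideal V \<subseteq> C 0"
    using ex_prime_chain_dim[OF V] by blast
  define Y where "Y i = zero_set (C i)" for i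
  define D where "D i = (if i \<le> n then vanishing_ideal (cone (affine_chart ` Y i)) else vanishing_ideal {0})" for i
  have pr: "is_prime (C i)" if "i \<le> n" for i using C(1) that by (auto simp: prime_chain_def)
  have YC: "vanishing_ideal (Y i) = C i" if "i \<le> n" for i
    unfolding Y_def by (rule vanishing_ideal_zero_set[OF pr[OF that]])
  have Yne: "Y i \<noteq> {}" if "i \<le> n" for i
    using irreducible_zero_set[OF pr[OF that]] unfolding Y_def irreducible_variety_def by blast
  have "prime_chain D (Suc n)"
    unfolding prime_chain_def
  proof (intro conjI allI impI)
    fix i assume "i \<le> Suc n"
    show "is_prime (D i)"
    proof (cases "i \<le> n")
      case True
      then show ?thesis unfolding D_def using pr YC
        by (simp add: is_prime_vanishing_ideal_cone is_prime_vanishing_ideal_chart)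
    next
      case False
      then show ?thesis by (simp add: D_def is_prime_point)
    qed
  next
    fix i assume i: "i < Suc n"
    show "D i \<subset> D (Suc i)"
    proof (cases "i = n")
      case True
      obtain y where y: "y \<in> Y n" using Yne by blast
      have "0 \<in> cone (affine_chart ` Y n)"
        unfolding cone_def using y by (intro CollectI exI[of _ "0::complex"] exI[of _ "affine_chart y"]) (simp add: vec_eq_iff imageI)
      then have "vanishing_ideal (cone (affine_chart ` Y n)) \<subseteq> vanishing_ideal {0}" by (intro vanishing_ideal_mono) simp
      moreover have "Var None \<in> vanishing_ideal {0}" by (simp add: vanishing_ideal_def)
      moreover have "Var None \<notin> vanishing_ideal (cone (affine_chart ` Y n))"
        unfolding homogeneous_in_vanishing_ideal_cone[OF homogeneous_Var]
        using y by (auto simp: vanishing_ideal_def affine_chart_def)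
      ultimately show ?thesis using True by (auto simp: D_def)
    next
      case False
      then have i': "i \<le> n" "Suc i \<le> n" using i by auto
      have CC: "C i \<subset> C (Suc i)" using C(1) i' by (auto simp: prime_chain_def)
      then have "Y (Suc i) \<subseteq> Y i" unfolding Y_def by (intro zero_set_mono) blast
      then have 1: "D i \<subseteq> D (Suc i)" using i' by (simp add: D_def vanishing_ideal_mono cone_mono image_mono)
      obtain p where p: "p \<in> C (Suc i)" "p \<notin> C i" using CC by blast
      have "homogenize (total_degree p) p \<in> vanishing_ideal (cone (affine_chart ` Y j)) \<longleftrightarrow> p \<in> C j" if "j \<le> n" for j
        unfolding homogeneous_in_vanishing_ideal_cone[OF homogeneous_homogenize[OF order_refl]]
          vanishing_ideal_chart_iff dehomogenize_homogenize YC[OF that] ..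
      then have "homogenize (total_degree p) p \<in> D (Suc i)" "homogenize (total_degree p) p \<notin> D i"
        using p i' by (simp_all add: D_def)
      with 1 show ?thesis by blast
    qed
  qed
  moreover have "vanishing_ideal (cone (affine_chart ` V)) \<subseteq> D 0"
  proof -
    have "Y 0 \<subseteq> V" unfolding Y_def using zero_set_mono[OF C(2)] zero_set_vanishing_ideal[OF V(1)] by simp
    then show ?thesis by (simp add: D_def vanishing_ideal_mono cone_mono image_mono)
  qed
  ultimately show ?thesis by blast
qed

section \<open>Systems of forms without common zeros\<close>

definition ideal_plus :: "'v cpoly set \<Rightarrow> (nat \<Rightarrow> 'v cpoly) \<Rightarrow> nat set \<Rightarrow> 'v cpoly set" where
  "ideal_plus J f K = {q + (\<Sum>j\<in>K. f j * h j) | q h. q \<in> J}"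

lemma is_ideal_ideal_plus:
  assumes J: "is_ideal J" shows "is_ideal (ideal_plus J f K)"
  unfolding is_ideal_def
proof (intro conjI ballI allI)
  have "0 = 0 + (\<Sum>j\<in>K. f j * 0)" by simp
  then show "0 \<in> ideal_plus J f K" unfolding ideal_plus_def using is_ideal_zero[OF J]
    by (intro CollectI exI[of _ 0] exI[of _ "\<lambda>_. 0"]) simp
next
  fix p q assume "p \<in> ideal_plus J f K" "q \<in> ideal_plus J f K"
  then obtain a b h k where "a \<in> J" "b \<in> J" "p = a + (\<Sum>j\<in>K. f j * h j)" "q = b + (\<Sum>j\<in>K. f j * k j)"
    by (auto simp: ideal_plus_def)
  then have "p + q = (a + b) + (\<Sum>j\<in>K. f j * (h j + k j))" "a + b \<in> J"
    by (simp_all add: distrib_left sum.distrib is_ideal_add[OF J])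
  then show "p + q \<in> ideal_plus J f K" unfolding ideal_plus_def by (intro CollectI exI[of _ "a + b"] exI[of _ "\<lambda>j. h j + k j"]) simp
next
  fix p c assume "p \<in> ideal_plus J f K"
  then obtain a h where "a \<in> J" "p = a + (\<Sum>j\<in>K. f j * h j)" by (auto simp: ideal_plus_def)
  then have "c * p = c * a + (\<Sum>j\<in>K. f j * (c * h j))" "c * a \<in> J"
    by (simp_all add: distrib_left sum_distrib_left is_ideal_mult[OF J] mult.left_commute)
  then show "c * p \<in> ideal_plus J f K" unfolding ideal_plus_def by (intro CollectI exI[of _ "c * a"] exI[of _ "\<lambda>j. c * h j"]) simp
qed

lemma ideal_plus_superset: "J \<subseteq> ideal_plus J f K"
  unfolding ideal_plus_def
proof
  fix p assume "p \<in> J"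
  then show "p \<in> {q + (\<Sum>j\<in>K. f j * h j) | q h. q \<in> J}" by (intro CollectI exI[of _ p] exI[of _ "\<lambda>_. 0"]) simp
qed

lemma ideal_plus_generator:
  assumes "is_ideal J" "finite K" "j \<in> K" shows "f j \<in> ideal_plus J f K"
proof -
  have "(\<Sum>i\<in>K. f i * (if i = j then 1 else 0)) = (\<Sum>i\<in>K. if i = j then f i else 0)"
    by (rule sum.cong) auto
  also have "\<dots> = f j" using assms by simp
  finally show ?thesis unfolding ideal_plus_def using is_ideal_zero[OF assms(1)]
    by (intro CollectI exI[of _ 0] exI[of _ "\<lambda>i. if i = j then 1 else 0"]) simp
qed

lemma ideal_plus_least: "is_ideal I \<Longrightarrow> J \<subseteq> I \<Longrightarrow> (\<And>j. j \<in> K \<Longrightarrow> f j \<in> I) \<Longrightarrow> ideal_plus J f K \<subseteq> I"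
  unfolding ideal_plus_def by (auto intro!: is_ideal_add is_ideal_sum is_ideal_mult_right)

text \<open>The Nullstellensatz puts a power of each variable into \<open>I\<close>; once the degree
  exceeds the sum of these exponents, one of these powers divides the monomial.\<close>

lemma contains_high_degree_monomials:
  fixes I :: "'v::finite cpoly set"
  assumes I: "is_ideal I" and z: "zero_set I \<subseteq> {0}"
  shows "\<exists>T\<ge>1. \<forall>a. mon_degree a = T \<longrightarrow> single a 1 \<in> I"
proof -
  have "\<forall>v. \<exists>k. Var v ^ k \<in> I"
    using z by (intro allI nullstellensatz[OF I]) auto
  then obtain k where k: "\<forall>v. Var v ^ k v \<in> I" by metis
  define T where "T = Suc (\<Sum>v\<in>UNIV. k v)"
  have "single a 1 \<in> I" if a: "mon_degree a = T" for a
  proof -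
    have "\<exists>v. k v \<le> lookup a v"
    proof (rule ccontr)
      assume "\<not> ?thesis"
      then have "mon_degree a \<le> (\<Sum>v\<in>UNIV. k v)" unfolding mon_degree_def by (intro sum_mono) (simp add: not_le less_imp_le)
      then show False using a by (simp add: T_def)
    qed
    then obtain v where v: "k v \<le> lookup a v" by blast
    have "single a 1 = Var v ^ lookup a v * (\<Prod>w\<in>UNIV - {v}. Var w ^ lookup a w)"
      unfolding single_eq_prod_Var by (rule prod.remove) auto
    also have "Var v ^ lookup a v = Var v ^ k v * Var v ^ (lookup a v - k v)"
      using v by (simp flip: power_add)
    finally show ?thesis using k by (simp add: is_ideal_mult_right[OF I] mult.assoc)
  qed
  then show ?thesis by (intro exI[of _ T]) (simp add: T_def)
qed

text \<open>As the forms have only the origin as common zero on the cone, its coordinate ring is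
  finite over the subring that they generate and has growth of order \<open>m\<close>. The cone
  carries a chain of \<open>n + 1\<close> steps, and growth bounds the length of chains.\<close>

lemma number_of_forms_ge:
  fixes V :: "(complex^'n::finite) set"
  assumes V: "affine_variety V" "pure_dimensional V n" "V \<noteq> {}"
    and J: "J = vanishing_ideal (cone (affine_chart ` V))"
    and f: "\<And>j. j \<in> {1..m} \<Longrightarrow> homogeneous (int (d j)) (f j)" "\<And>j. j \<in> {1..m} \<Longrightarrow> d j \<ge> 1"
    and z: "\<And>z. z \<in> zero_set J \<Longrightarrow> (\<forall>j\<in>{1..m}. poly_at (f j) z = 0) \<Longrightarrow> z = 0"
  shows "Suc n \<le> m"
proof -
  have idJ: "is_ideal J" unfolding J by (rule is_ideal_vanishing_ideal)
  have "zero_set (ideal_plus J f {1..m}) \<subseteq> {0}"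
  proof
    fix x assume x: "x \<in> zero_set (ideal_plus J f {1..m})"
    have "x \<in> zero_set J" using x zero_set_mono[OF ideal_plus_superset] by blast
    moreover have "\<forall>j\<in>{1..m}. poly_at (f j) x = 0"
      using x ideal_plus_generator[OF idJ finite_atLeastAtMost, of _ 1 m f] unfolding zero_set_def by blast
    ultimately show "x \<in> {0}" using z by blast
  qed
  from contains_high_degree_monomials[OF is_ideal_ideal_plus[OF idJ] this]
  obtain T where T: "T \<ge> 1" "\<forall>a. mon_degree a = T \<longrightarrow> single a 1 \<in> ideal_plus J f {1..m}" by (elim exE conjE)
  have "growth J (card {1..m})"
  proof (rule growth_of_finite_quotient[OF idJ finite_atLeastAtMost T(1)])
    fix a :: "'n option \<Rightarrow>\<^sub>0 nat" assume a: "mon_degree a = T"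
    then obtain q h where qh: "q \<in> J" "single a 1 = q + (\<Sum>j\<in>{1..m}. f j * h j)"
      using T(2) unfolding ideal_plus_def by blast
    \<comment> \<open>Passing to the components of degree \<open>T - d j\<close> makes the degrees
      small: \<open>d j \<ge> 1\<close> puts them below \<open>T\<close>.\<close>
    define h' where "h' j = hcomp (int T - int (d j)) (h j)" for j
    have "homogeneous (int T) (single a (1::complex))" using a by (simp add: homogeneous_def)
    then have "single a 1 = hcomp (int T) (single a (1::complex))" by (simp add: hcomp_homogeneous)
    also have "\<dots> = hcomp (int T) q + (\<Sum>j\<in>{1..m}. hcomp (int T) (f j * h j))"
      unfolding qh(2) by (simp add: hcomp_sum)
    also have "(\<Sum>j\<in>{1..m}. hcomp (int T) (f j * h j)) = (\<Sum>j\<in>{1..m}. f j * h' j)"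
      unfolding h'_def by (rule sum.cong[OF refl], rule hcomp_homogeneous_mult[OF f(1)])
    finally have "single a 1 - (\<Sum>j\<in>{1..m}. f j * h' j) = hcomp (int T) q" by simp
    also have "\<dots> \<in> J" using qh(1) unfolding J by (rule hcomp_in_vanishing_ideal_cone)
    finally have "single a 1 - (\<Sum>j\<in>{1..m}. f j * h' j) \<in> J" .
    moreover have "total_degree (h' j) < T" if "j \<in> {1..m}" for j
    proof -
      have "total_degree (h' j) \<le> T - 1" unfolding h'_def
        by (rule homogeneous_total_degree_le[OF homogeneous_hcomp]) (use f(2)[OF that] T(1) in simp)
      then show ?thesis using T(1) by simp
    qed
    ultimately show "\<exists>h. single a 1 - (\<Sum>j\<in>{1..m}. f j * h j) \<in> J \<and> (\<forall>j\<in>{1..m}. total_degree (h j) < T)"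
      by blast
  qed
  moreover obtain C where "prime_chain C (Suc n)" "J \<subseteq> C 0" using ex_prime_chain_cone[OF V] unfolding J by blast
  ultimately show ?thesis using prime_chain_le_growth by fastforce
qed

lemma homogeneous_in_ideal_of_variables:
  assumes I: "is_ideal I" "\<And>v. Var v \<in> I" and p: "homogeneous (int d) p" "d \<ge> 1"
  shows "p \<in> I"
proof -
  have "(\<Sum>a\<in>keys p. single a (lookup p a)) \<in> I"
  proof (rule is_ideal_sum[OF I(1)])
    fix a assume "a \<in> keys p"
    then have "a \<noteq> 0" using p by (auto simp: homogeneous_def)
    then obtain v a' where "single a 1 = Var v * single a' (1::complex)" using mon_decompose by blast
    then have "single a (lookup p a) = (Cst (lookup p a) * single a' 1) * Var v"
      by (subst single_eq_Cst_mult) (simp only: mult_ac)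
    then show "single a (lookup p a) \<in> I" by (simp only: is_ideal_mult[OF I(1) I(2)])
  qed
  then show ?thesis by (simp only: sum_single_keys_self[symmetric])
qed

text \<open>One prime is added at a time. If the form found so far lies in the new \<open>Q\<close>,
  a multiple of \<open>f l * x\<close> is added, where \<open>f l\<close> is outside
  \<open>Q\<close> and \<open>x\<close> is a power of a variable outside \<open>Q\<close>; it raises
  the degree from \<open>d l\<close> to \<open>d i\<close>, which is possible since
  \<open>d l \<le> d i\<close>. All but finitely many scalars keep the earlier primes
  avoided.\<close>

lemma homogeneous_prime_avoidance:
  fixes f :: "nat \<Rightarrow> 'v::finite cpoly"
  assumes fin: "finite \<Q>" and Q: "\<And>Q. Q \<in> \<Q> \<Longrightarrow> is_prime Q" "\<And>Q. Q \<in> \<Q> \<Longrightarrow> \<exists>l\<in>{i..m}. f l \<notin> Q"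
    and f: "\<And>j. j \<in> {i..m} \<Longrightarrow> homogeneous (int (d j)) (f j)" "\<And>j. j \<in> {i..m} \<Longrightarrow> 1 \<le> d j \<and> d j \<le> d i" and "i \<le> m"
  shows "\<exists>h. homogeneous (int (d i)) (f i + (\<Sum>l\<in>{Suc i..m}. f l * h l)) \<and>
    (\<forall>Q\<in>\<Q>. f i + (\<Sum>l\<in>{Suc i..m}. f l * h l) \<notin> Q)"
  using fin Q
proof (induction \<Q>)
  case empty
  then show ?case using f(1)[of i] \<open>i \<le> m\<close> by (intro exI[of _ "\<lambda>_. 0"]) simp
next
  case (insert Q \<Q>)
  then obtain h where h: "homogeneous (int (d i)) (f i + (\<Sum>l\<in>{Suc i..m}. f l * h l))"
    "\<forall>Q\<in>\<Q>. f i + (\<Sum>l\<in>{Suc i..m}. f l * h l) \<notin> Q" by auto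
  define g where "g = f i + (\<Sum>l\<in>{Suc i..m}. f l * h l)"
  have pQ: "is_prime Q" using insert.prems(1) by simp
  note idQ = is_prime_ideal[OF pQ]
  show ?case
  proof (cases "g \<in> Q")
    case False
    then show ?thesis using h by (intro exI[of _ h]) (auto simp: g_def)
  next
    case True
    have "\<exists>l\<in>{Suc i..m}. f l \<notin> Q"
    proof (rule ccontr)
      assume all: "\<not> ?thesis"
      then have "(\<Sum>l\<in>{Suc i..m}. f l * h l) \<in> Q" by (intro is_ideal_sum[OF idQ] is_ideal_mult_right[OF idQ]) blast
      then have "f i \<in> Q" using True unfolding g_def by (simp add: is_ideal_add_iff[OF idQ])
      obtain l where "l \<in> {i..m}" "f l \<notin> Q" using insert.prems(2)[of Q] by blast
      then show False using all \<open>f i \<in> Q\<close> by (cases "l = i") auto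
    qed
    then obtain l where l: "l \<in> {Suc i..m}" "f l \<notin> Q" by blast
    \<comment> \<open>A prime with all variables would contain every form of positive degree, in
      particular \<open>f l\<close>.\<close>
    have "\<exists>v. Var v \<notin> Q"
    proof (rule ccontr)
      assume "\<not> ?thesis"
      then have "Var v \<in> Q" for v by blast
      moreover have "l \<in> {i..m}" using l(1) by simp
      ultimately have "f l \<in> Q" by (intro homogeneous_in_ideal_of_variables[OF idQ _ f(1)]) (use f(2) in blast)+
      then show False using l(2) by simp
    qed
    then obtain v where v: "Var v \<notin> Q" by blast
    define x where "x = Var v ^ (d i - d l)"
    define e where "e = f l * x"
    have eQ: "e \<notin> Q" unfolding e_def x_def using is_prime_multD[OF pQ] is_prime_powerD[OF pQ] l(2) v by blast
    have "homogeneous (int (d l) + int (d i - d l) * 1) e"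
      unfolding e_def x_def using l(1) by (intro homogeneous_mult homogeneous_power homogeneous_Var f(1)) simp
    moreover have "int (d l) + int (d i - d l) * 1 = int (d i)" using l(1) f(2)[of l] by simp
    ultimately have he: "homogeneous (int (d i)) e" by simp
    \<comment> \<open>Each earlier prime rules out at most one scalar: two of them would put
      \<open>e\<close> and then \<open>g\<close> into it.\<close>
    define Bad where "Bad = (\<Union>Q\<in>\<Q>. {s. g + Cst s * e \<in> Q})"
    have "finite {s. g + Cst s * e \<in> Q'}" if Q': "Q' \<in> \<Q>" for Q'
    proof -
      have pQ': "is_prime Q'" using insert.prems(1) Q' by simp
      note id' = is_prime_ideal[OF pQ']
      have "s = t" if st: "g + Cst s * e \<in> Q'" "g + Cst t * e \<in> Q'" for s t
      proof (rule ccontr)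
        assume "s \<noteq> t"
        have "(g + Cst s * e) - (g + Cst t * e) = Cst (s - t) * e"
          by (simp add: diff_conv_add_uminus[of s t] Cst_add Cst_uminus left_diff_distrib del: diff_conv_add_uminus add_uminus_conv_diff)
            (simp add: algebra_simps)
        then have "Cst (s - t) * e \<in> Q'" using is_ideal_diff[OF id' st] by simp
        then have "e \<in> Q'" using is_prime_multD[OF pQ'] is_prime_CstD[OF pQ', of "s - t"] \<open>s \<noteq> t\<close> by auto
        then have "g \<in> Q'" using st(1) is_ideal_add_iff[OF id' is_ideal_mult[OF id']] by blast
        then show False using h(2) Q' by (auto simp: g_def)
      qed
      then have "\<exists>s. {s. g + Cst s * e \<in> Q'} \<subseteq> {s}" by blast
      then show ?thesis using finite_subset by blast
    qed
    then have "finite (insert 0 Bad)" unfolding Bad_def using insert.hyps(1) by blast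
    from ex_new_if_finite[OF infinite_UNIV_char_0 this] obtain s :: complex where s: "s \<noteq> 0" "s \<notin> Bad" by auto
    define h' where "h' j = h j + (if j = l then Cst s * x else 0)" for j
    have "(\<Sum>j\<in>{Suc i..m}. f j * (if j = l then Cst s * x else 0)) = (\<Sum>j\<in>{Suc i..m}. if j = l then Cst s * e else 0)"
      by (rule sum.cong) (auto simp: e_def mult_ac)
    also have "\<dots> = Cst s * e" using l(1) by simp
    finally have se: "(\<Sum>j\<in>{Suc i..m}. f j * (if j = l then Cst s * x else 0)) = Cst s * e" .
    have g': "f i + (\<Sum>j\<in>{Suc i..m}. f j * h' j) = g + Cst s * e"
      by (simp only: h'_def g_def distrib_left sum.distrib add.assoc se)
    have "homogeneous (0 + int (d i)) (Cst s * e)" by (intro homogeneous_mult homogeneous_Cst he)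
    then have "homogeneous (int (d i)) (g + Cst s * e)" using h(1) unfolding g_def[symmetric] by (intro homogeneous_add) simp_all
    moreover have "g + Cst s * e \<notin> Q"
    proof
      assume "g + Cst s * e \<in> Q"
      then have "Cst s * e \<in> Q" using is_ideal_add_iff[OF idQ True, of "Cst s * e"] by (simp only: add.commute)
      then show False using is_prime_multD[OF pQ] is_prime_CstD[OF pQ, of s] s(1) eQ by auto
    qed
    moreover have "\<forall>Q\<in>\<Q>. g + Cst s * e \<notin> Q" using s(2) by (auto simp: Bad_def)
    ultimately show ?thesis by (intro exI[of _ h']) (simp add: g')
  qed
qed

text \<open>Invariant: a prime over \<open>J\<close> containing the first \<open>i\<close> forms
  \<open>g k\<close> either contains all \<open>f j\<close> or lies over a chain with
  \<open>i\<close> steps above \<open>J\<close>. For a nonzero common zero \<open>x\<close> of the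
  final system, the ideal of the line through \<open>x\<close> is of the second kind, and the ideal
  of the origin on top gives a chain with \<open>N + 1\<close> steps, which is too long.\<close>

theorem ex_system_of_parameters:
  fixes f :: "nat \<Rightarrow> 'v::finite cpoly"
  assumes J: "J = vanishing_ideal (cone Z)"
    and f: "\<And>j. j \<in> {1..m} \<Longrightarrow> homogeneous (int (d j)) (f j)" "\<And>j. j \<in> {1..m} \<Longrightarrow> d j \<ge> 1"
      "\<And>i j. 1 \<le> i \<Longrightarrow> i \<le> j \<Longrightarrow> j \<le> m \<Longrightarrow> d j \<le> d i"
    and z: "\<And>z. z \<in> zero_set J \<Longrightarrow> (\<forall>j\<in>{1..m}. poly_at (f j) z = 0) \<Longrightarrow> z = 0"
    and N: "N \<le> m" "\<And>C k. prime_chain C k \<Longrightarrow> J \<subseteq> C 0 \<Longrightarrow> k \<le> N"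
  shows "\<exists>g. (\<forall>i\<in>{1..N}. homogeneous (int (d i)) (g i) \<and> g i \<in> ideal_plus {0} f {1..m}) \<and>
    zero_set (ideal_plus J g {1..N}) \<subseteq> {0}"
proof -
  have idJ: "is_ideal J" unfolding J by (rule is_ideal_vanishing_ideal)
  have "\<exists>g. (\<forall>k\<in>{1..i}. homogeneous (int (d k)) (g k) \<and> (\<exists>h. g k = f k + (\<Sum>l\<in>{Suc k..m}. f l * h l))) \<and>
     (\<forall>P. is_prime P \<and> J \<subseteq> P \<and> (\<forall>k\<in>{1..i}. g k \<in> P) \<longrightarrow>
        (\<forall>j\<in>{1..m}. f j \<in> P) \<or> (\<exists>C. prime_chain C i \<and> J \<subseteq> C 0 \<and> C i \<subseteq> P))" if "i \<le> N" for i
    using that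
  proof (induction i)
    case 0
    have "prime_chain (\<lambda>_. P) 0" if "is_prime P" for P :: "'v cpoly set" using that by (simp add: prime_chain_def)
    then show ?case by (intro exI[of _ f]) auto
  next
    case (Suc i)
    from Suc.IH[OF Suc_leD[OF Suc.prems]] obtain g where g: "\<forall>k\<in>{1..i}. homogeneous (int (d k)) (g k) \<and> (\<exists>h. g k = f k + (\<Sum>l\<in>{Suc k..m}. f l * h l))"
      "\<forall>P. is_prime P \<and> J \<subseteq> P \<and> (\<forall>k\<in>{1..i}. g k \<in> P) \<longrightarrow>
        (\<forall>j\<in>{1..m}. f j \<in> P) \<or> (\<exists>C. prime_chain C i \<and> J \<subseteq> C 0 \<and> C i \<subseteq> P)" by (elim exE conjE)
    have im: "Suc i \<le> m" using Suc.prems N(1) by simp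
    from finite_primes_over[OF is_ideal_ideal_plus[OF idJ, of g "{1..i}"]]
    obtain \<P> where P: "finite \<P>" "\<forall>P\<in>\<P>. is_prime P \<and> ideal_plus J g {1..i} \<subseteq> P"
      "\<forall>Q. is_prime Q \<and> ideal_plus J g {1..i} \<subseteq> Q \<longrightarrow> (\<exists>P\<in>\<P>. P \<subseteq> Q)"
      by (elim exE conjE)
    \<comment> \<open>Primes that contain all \<open>f j\<close> cannot be avoided by combinations
      of them; only the others are considered.\<close>
    define \<Q> where "\<Q> = {Q\<in>\<P>. \<not> (\<forall>j\<in>{1..m}. f j \<in> Q)}"
    have finQ: "finite \<Q>" using P(1) by (simp add: \<Q>_def)
    have QJ: "is_prime Q" "J \<subseteq> Q" "\<forall>k\<in>{1..i}. g k \<in> Q" if "Q \<in> \<P>" for Q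
    proof -
      show "is_prime Q" "J \<subseteq> Q" using P(2) that ideal_plus_superset by blast+
      show "\<forall>k\<in>{1..i}. g k \<in> Q"
        using P(2) that ideal_plus_generator[OF idJ finite_atLeastAtMost, of _ 1 i g] by blast
    qed
    have ex: "\<exists>l\<in>{Suc i..m}. f l \<notin> Q" if Q: "Q \<in> \<Q>" for Q
    proof (rule ccontr)
      assume all: "\<not> ?thesis"
      have QP: "Q \<in> \<P>" using Q by (simp add: \<Q>_def)
      note idQ = is_prime_ideal[OF QJ(1)[OF QP]]
      \<comment> \<open>The system is triangular: \<open>g j\<close> is \<open>f j\<close> plus a
        combination of later forms, so membership is recovered downwards from
        \<open>j = m\<close>.\<close>
      have "f j \<in> Q" if "1 \<le> j" "j \<le> m" for j
        using that
      proof (induction "m - j" arbitrary: j rule: less_induct)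
        case less
        show ?case
        proof (cases "j \<le> i")
          case False
          then show ?thesis using all less.prems by auto
        next
          case True
          then have "j \<in> {1..i}" using less.prems by simp
          then obtain h where gj: "g j = f j + (\<Sum>l\<in>{Suc j..m}. f l * h l)" "g j \<in> Q" using g(1) QJ(3)[OF QP] by blast
          have "(\<Sum>l\<in>{Suc j..m}. f l * h l) \<in> Q"
            using less.hyps less.prems by (intro is_ideal_sum[OF idQ] is_ideal_mult_right[OF idQ]) auto
          then show ?thesis using gj by (simp add: is_ideal_add_iff[OF idQ])
        qed
      qed
      then show False using Q by (auto simp: \<Q>_def)
    qed
    have "\<exists>h. homogeneous (int (d (Suc i))) (f (Suc i) + (\<Sum>l\<in>{Suc (Suc i)..m}. f l * h l)) \<and>
      (\<forall>Q\<in>\<Q>. f (Suc i) + (\<Sum>l\<in>{Suc (Suc i)..m}. f l * h l) \<notin> Q)"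
      by (rule homogeneous_prime_avoidance[OF finQ _ ex]) (use QJ(1) f im in \<open>auto simp: \<Q>_def\<close>)
    then obtain h where h: "homogeneous (int (d (Suc i))) (f (Suc i) + (\<Sum>l\<in>{Suc (Suc i)..m}. f l * h l))"
      "\<forall>Q\<in>\<Q>. f (Suc i) + (\<Sum>l\<in>{Suc (Suc i)..m}. f l * h l) \<notin> Q" by (elim exE conjE)
    define g' where "g' = g(Suc i := f (Suc i) + (\<Sum>l\<in>{Suc (Suc i)..m}. f l * h l))"
    have "homogeneous (int (d k)) (g' k) \<and> (\<exists>h. g' k = f k + (\<Sum>l\<in>{Suc k..m}. f l * h l))" if "k \<in> {1..Suc i}" for k
    proof (cases "k = Suc i")
      case True
      then show ?thesis using h(1) by (auto simp: g'_def)
    next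
      case False
      then have "k \<in> {1..i}" using that by auto
      then show ?thesis using g(1) False by (auto simp: g'_def)
    qed
    moreover have "(\<forall>j\<in>{1..m}. f j \<in> P) \<or> (\<exists>C. prime_chain C (Suc i) \<and> J \<subseteq> C 0 \<and> C (Suc i) \<subseteq> P)"
      if pP: "is_prime P" "J \<subseteq> P" "\<forall>k\<in>{1..Suc i}. g' k \<in> P" for P
    proof -
      have gP: "g k \<in> P" if "k \<in> {1..i}" for k
        using pP(3)[rule_format, of k] that by (auto simp: g'_def split: if_splits)
      have "ideal_plus J g {1..i} \<subseteq> P" by (rule ideal_plus_least[OF is_prime_ideal[OF pP(1)] pP(2) gP])
      then obtain Q where Q: "Q \<in> \<P>" "Q \<subseteq> P" using P(3) pP(1) by blast
      show ?thesis
      proof (cases "\<forall>j\<in>{1..m}. f j \<in> Q")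
        case True
        then show ?thesis using Q(2) by blast
      next
        case False
        then have "Q \<in> \<Q>" using Q(1) by (simp add: \<Q>_def)
        obtain C where C: "prime_chain C i" "J \<subseteq> C 0" "C i \<subseteq> Q"
          using g(2) QJ[OF Q(1)] False by blast
        \<comment> \<open>The new form lies in \<open>P\<close> but was chosen outside
          \<open>Q\<close>, which makes the inclusion strict and lengthens the chain.\<close>
        have "g' (Suc i) \<in> P" using pP(3) by (rule bspec) simp
        moreover have "g' (Suc i) \<notin> Q" using h(2) \<open>Q \<in> \<Q>\<close> by (simp add: g'_def)
        ultimately have "C i \<subset> P" using C(3) Q(2) by blast
        then have "prime_chain (C(Suc i := P)) (Suc i)"
          using C(1) pP(1) by (auto simp: prime_chain_def less_Suc_eq le_Suc_eq)
        then show ?thesis using C(2) by (intro disjI2 exI[of _ "C(Suc i := P)"]) simp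
      qed
    qed
    ultimately show ?case by (intro exI[of _ g']) blast
  qed
  from this[OF order_refl] obtain g where
    g: "\<forall>k\<in>{1..N}. homogeneous (int (d k)) (g k) \<and> (\<exists>h. g k = f k + (\<Sum>l\<in>{Suc k..m}. f l * h l))"
      "\<forall>P. is_prime P \<and> J \<subseteq> P \<and> (\<forall>k\<in>{1..N}. g k \<in> P) \<longrightarrow>
        (\<forall>j\<in>{1..m}. f j \<in> P) \<or> (\<exists>C. prime_chain C N \<and> J \<subseteq> C 0 \<and> C N \<subseteq> P)" by (elim exE conjE)
  have id0: "is_ideal ({0} :: 'v cpoly set)" by (simp add: is_ideal_def)
  have "g k \<in> ideal_plus {0} f {1..m}" if k: "k \<in> {1..N}" for k
  proof -
    note idp = is_ideal_ideal_plus[OF id0]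
    have fI: "f j \<in> ideal_plus {0} f {1..m}" if "j \<in> {1..m}" for j
      by (rule ideal_plus_generator[OF id0 finite_atLeastAtMost that])
    obtain h where "g k = f k + (\<Sum>l\<in>{Suc k..m}. f l * h l)" using g(1) k by blast
    also have "\<dots> \<in> ideal_plus {0} f {1..m}"
      using k N(1) by (intro is_ideal_add[OF idp] is_ideal_sum[OF idp] is_ideal_mult_right[OF idp] fI) auto
    finally show ?thesis .
  qed
  moreover have "x = 0" if x: "x \<in> zero_set (ideal_plus J g {1..N})" for x
  proof (rule ccontr)
    assume "x \<noteq> 0"
    have xJ: "x \<in> zero_set J" using x zero_set_mono[OF ideal_plus_superset] by blast
    have gx: "poly_at (g k) x = 0" if "k \<in> {1..N}" for k
      using x ideal_plus_generator[OF idJ finite_atLeastAtMost that, of g] unfolding zero_set_def by blast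
    define P where "P = vanishing_ideal (cone {x})"
    have pP: "is_prime P" unfolding P_def by (intro is_prime_vanishing_ideal_cone is_prime_point)
    have JP: "J \<subseteq> P"
    proof
      fix p assume "p \<in> J"
      then have "hcomp t p \<in> J" for t unfolding J by (rule hcomp_in_vanishing_ideal_cone)
      then show "p \<in> P" using xJ unfolding P_def vanishing_ideal_cone_iff by (auto simp: vanishing_ideal_def zero_set_def)
    qed
    have homP: "p \<in> P \<longleftrightarrow> poly_at p x = 0" if "homogeneous t p" for p t
      unfolding P_def homogeneous_in_vanishing_ideal_cone[OF that] by (simp add: vanishing_ideal_def)
    have "\<forall>k\<in>{1..N}. g k \<in> P" using g(1) homP gx by blast
    moreover have "\<not> (\<forall>j\<in>{1..m}. f j \<in> P)" using z[OF xJ] \<open>x \<noteq> 0\<close> homP f(1) by blast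
    ultimately obtain C where C: "prime_chain C N" "J \<subseteq> C 0" "C N \<subseteq> P" using g(2) pP JP by blast
    obtain v where v: "x $ v \<noteq> 0" using \<open>x \<noteq> 0\<close> by (auto simp: vec_eq_iff)
    have "Var v \<notin> P" using homP[OF homogeneous_Var] v by simp
    moreover have "Var v \<in> vanishing_ideal {0}" by (simp add: vanishing_ideal_def)
    moreover have "P \<subseteq> vanishing_ideal {0}"
      unfolding P_def by (rule vanishing_ideal_mono) (auto simp: cone_def vec_eq_iff intro: exI[of _ 0])
    ultimately have "C N \<subset> vanishing_ideal {0}" using C(3) by blast
    then have "prime_chain (C(Suc N := vanishing_ideal {0})) (Suc N)"
      using C(1) is_prime_point by (auto simp: prime_chain_def less_Suc_eq le_Suc_eq)
    then have "Suc N \<le> N" using C(2) by (intro N(2)[of "C(Suc N := vanishing_ideal {0})"]) simp_all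
    then show False by simp
  qed
  ultimately show ?thesis using g(1) by (intro exI[of _ g]) blast
qed

section \<open>Ideals generated by variables\<close>

text \<open>The ideal generated by the variables in \<open>B\<close>, described through divisibility
  of each monomial by one of them.\<close>

definition var_ideal :: "'v set \<Rightarrow> 'v cpoly set" where
  "var_ideal B = {p. \<forall>a\<in>keys p. \<exists>v\<in>B. lookup a v > 0}"

lemma is_ideal_var_ideal: "is_ideal (var_ideal B)"
  unfolding is_ideal_def var_ideal_def
proof (intro conjI ballI allI CollectI)
  show "\<exists>v\<in>B. lookup a v > 0" if "a \<in> keys (0 :: 'a cpoly)" for a using that by simp
next
  fix p q :: "'a cpoly" and a
  assume "p \<in> {p. \<forall>a\<in>keys p. \<exists>v\<in>B. lookup a v > 0}" "q \<in> {p. \<forall>a\<in>keys p. \<exists>v\<in>B. lookup a v > 0}" "a \<in> keys (p + q)"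
  then show "\<exists>v\<in>B. lookup a v > 0" by (auto dest: keys_addD)
next
  fix p c :: "'a cpoly" and a
  assume p: "p \<in> {p. \<forall>a\<in>keys p. \<exists>v\<in>B. lookup a v > 0}" and a: "a \<in> keys (c * p)"
  from a obtain k l where "k \<in> keys c" "l \<in> keys p" "a = k + l" by (rule keys_multD)
  then obtain v where "v \<in> B" "lookup l v > 0" using p by blast
  then show "\<exists>v\<in>B. lookup a v > 0" using \<open>a = k + l\<close> by (intro bexI[of _ v]) (simp_all add: lookup_add)
qed

lemma var_ideal_empty: "var_ideal {} = {0}"
  by (auto simp: var_ideal_def)

lemma var_ideal_mono: "B \<subseteq> B' \<Longrightarrow> var_ideal B \<subseteq> var_ideal B'"
  unfolding var_ideal_def by blast

lemma Var_in_var_ideal: "v \<in> B \<Longrightarrow> Var v \<in> var_ideal B"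
  by (auto simp: var_ideal_def Var_def intro!: bexI[of _ v])

lemma var_ideal_hcomp: "p \<in> var_ideal B \<Longrightarrow> hcomp t p \<in> var_ideal B"
  by (auto simp: var_ideal_def keys_hcomp)

lemma homogeneous_in_var_ideal_UNIV: "homogeneous t p \<Longrightarrow> t > 0 \<Longrightarrow> p \<in> var_ideal UNIV"
proof -
  assume p: "homogeneous t p" "t > 0"
  have "\<exists>v. lookup a v > 0" if "a \<in> keys p" for a
  proof -
    have "mon_degree a \<noteq> 0" using p that by (auto simp: homogeneous_def)
    then show ?thesis unfolding mon_degree_def by (metis gr0I sum.neutral)
  qed
  then show ?thesis by (simp add: var_ideal_def)
qed

text \<open>Multiplication by \<open>Var x\<close> changes exponents only at \<open>x\<close>, so it
  is injective modulo variables other than \<open>x\<close>.\<close>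

lemma var_ideal_cancel:
  assumes "Var x * p \<in> var_ideal B" "x \<notin> B"
  shows "p \<in> var_ideal B"
  unfolding var_ideal_def
proof (intro CollectI ballI)
  fix a assume a: "a \<in> keys p"
  have "lookup (Var x * p) (single x 1 + a) = lookup p a" unfolding Var_def by (simp add: lookup_single_mult)
  then have "single x 1 + a \<in> keys (Var x * p)" using a by (simp add: in_keys_iff)
  then obtain v where v: "v \<in> B" "lookup (single x 1 + a) v > 0" using assms(1) by (auto simp: var_ideal_def)
  then have "v \<noteq> x" using assms(2) by blast
  then show "\<exists>v\<in>B. lookup a v > 0" using v by (auto simp: lookup_add lookup_single when_def)
qed

text \<open>The terms divisible by \<open>Var x\<close> are collected in the first summand. The
  clause on \<open>p = 0\<close> preserves supports when vectors are decomposed coordinate by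
  coordinate.\<close>

lemma var_ideal_insert_decompose:
  assumes "p \<in> var_ideal (insert x B)"
  shows "\<exists>q b. p = Var x * q + b \<and> b \<in> var_ideal B \<and> (p = 0 \<longrightarrow> q = 0 \<and> b = 0)"
proof -
  define K where "K = {a\<in>keys p. lookup a x > 0}"
  define q where "q = (\<Sum>a\<in>K. single (a - single x 1) (lookup p a))"
  define b where "b = (\<Sum>a\<in>keys p - K. single a (lookup p a))"
  have "single x 1 + (a - single x 1) = a" if "a \<in> K" for a
    by (rule poly_mapping_eqI) (use that in \<open>auto simp: K_def lookup_add lookup_minus lookup_single when_def\<close>)
  then have "Var x * q = (\<Sum>a\<in>K. single a (lookup p a))"
    by (simp add: q_def Var_def sum_distrib_left mult_single)
  moreover have "p = (\<Sum>a\<in>keys p - K. single a (lookup p a)) + (\<Sum>a\<in>K. single a (lookup p a))"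
    by (subst sum.subset_diff[symmetric]) (auto simp: K_def sum_single_keys_self[symmetric])
  ultimately have "p = Var x * q + b" by (simp add: b_def add.commute)
  moreover have "b \<in> var_ideal B"
    unfolding b_def
  proof (rule is_ideal_sum[OF is_ideal_var_ideal])
    fix a assume "a \<in> keys p - K"
    then show "single a (lookup p a) \<in> var_ideal B" using assms by (auto simp: K_def var_ideal_def)
  qed
  moreover have "p = 0 \<longrightarrow> q = 0 \<and> b = 0" by (simp add: q_def b_def K_def)
  ultimately show ?thesis by blast
qed

section \<open>Graded differential modules\<close>

definition supported :: "nat set \<Rightarrow> (nat \<Rightarrow> 'v cpoly) set" where
  "supported E = {u. \<forall>e. e \<notin> E \<longrightarrow> u e = 0}"

definition graded_part :: "(nat \<Rightarrow> int) \<Rightarrow> int \<Rightarrow> (nat \<Rightarrow> 'v::finite cpoly) \<Rightarrow> (nat \<Rightarrow> 'v cpoly)" where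
  "graded_part \<delta> t u = (\<lambda>e. hcomp (t - \<delta> e) (u e))"

definition var_multiples :: "'v set \<Rightarrow> (nat \<Rightarrow> 'v cpoly) set" where
  "var_multiples B = {u. \<forall>e. u e \<in> var_ideal B}"

lemma supported_0: "0 \<in> supported E"
  and supported_add: "u \<in> supported E \<Longrightarrow> w \<in> supported E \<Longrightarrow> u + w \<in> supported E"
  and supported_diff: "u \<in> supported E \<Longrightarrow> w \<in> supported E \<Longrightarrow> u - w \<in> supported E"
  and supported_uminus: "u \<in> supported E \<Longrightarrow> - u \<in> supported E"
  and supported_smul: "u \<in> supported E \<Longrightarrow> smul p u \<in> supported E"
  and supported_graded_part: "w' \<in> supported E \<Longrightarrow> graded_part \<delta> t w' \<in> supported E"
  by (auto simp: supported_def smul_apply graded_part_def)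

lemma var_multiples_0: "0 \<in> var_multiples B"
  and var_multiples_add: "u \<in> var_multiples B \<Longrightarrow> w \<in> var_multiples B \<Longrightarrow> u + w \<in> var_multiples B"
  and var_multiples_diff: "u \<in> var_multiples B \<Longrightarrow> w \<in> var_multiples B \<Longrightarrow> u - w \<in> var_multiples B"
  and var_multiples_smul: "u \<in> var_multiples B \<Longrightarrow> smul p u \<in> var_multiples B"
  and var_multiples_graded_part: "w' \<in> var_multiples B \<Longrightarrow> graded_part \<delta> t w' \<in> var_multiples B"
  by (auto simp: var_multiples_def smul_apply graded_part_def var_ideal_hcomp is_ideal_zero[OF is_ideal_var_ideal]
      is_ideal_add[OF is_ideal_var_ideal] is_ideal_diff[OF is_ideal_var_ideal] is_ideal_mult[OF is_ideal_var_ideal])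

lemma var_multiples_mono: "B \<subseteq> B' \<Longrightarrow> var_multiples B \<subseteq> var_multiples B'"
  using var_ideal_mono[of B B'] by (auto simp: var_multiples_def)

lemma var_multiples_Var: "v \<in> B \<Longrightarrow> smul (Var v) u \<in> var_multiples B"
  by (simp add: var_multiples_def smul_apply is_ideal_mult_right[OF is_ideal_var_ideal Var_in_var_ideal])

lemma var_multiples_cancel: "smul (Var x) u \<in> var_multiples B \<Longrightarrow> x \<notin> B \<Longrightarrow> u \<in> var_multiples B"
  by (auto simp: var_multiples_def smul_apply intro: var_ideal_cancel)

lemma var_multiples_empty: "var_multiples {} = {0}"
  by (auto simp: var_multiples_def var_ideal_empty fun_eq_iff)

lemma var_multiples_insert_decompose:
  assumes "u \<in> var_multiples (insert x B)" "u \<in> supported E"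
  shows "\<exists>q b. u = smul (Var x) q + b \<and> b \<in> var_multiples B \<and> q \<in> supported E \<and> b \<in> supported E"
proof -
  have "\<forall>e. \<exists>q b. u e = Var x * q + b \<and> b \<in> var_ideal B \<and> (u e = 0 \<longrightarrow> q = 0 \<and> b = 0)"
    using assms(1) by (auto simp: var_multiples_def intro!: var_ideal_insert_decompose)
  then obtain q b where qb: "\<forall>e. u e = Var x * q e + b e \<and> b e \<in> var_ideal B \<and> (u e = 0 \<longrightarrow> q e = 0 \<and> b e = 0)"
    unfolding choice_iff by (elim exE)
  have "u e = (smul (Var x) q + b) e" for e
    unfolding plus_fun_apply smul_apply using qb by blast
  then have "u = smul (Var x) q + b" by (rule ext)
  moreover have "b \<in> var_multiples B" unfolding var_multiples_def using qb by blast
  moreover have "q \<in> supported E" "b \<in> supported E" using qb assms(2) unfolding supported_def by blast+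
  ultimately show ?thesis by blast
qed

lemma smul_smul: "smul p (smul q u) = smul (p * q) u"
  by (simp add: fun_eq_iff smul_apply mult_ac)

lemma smul_add: "smul p (u + w) = smul p u + smul p w"
  and smul_diff: "smul p (u - w) = smul p u - smul p w"
  and smul_add_left: "smul (p + q) u = smul p u + smul q u"
  and smul_0: "smul p 0 = 0"
  and smul_0_left: "smul 0 u = 0"
  and smul_1: "smul 1 u = u"
  and smul_uminus: "smul p (- u) = - smul p u"
  by (simp_all add: fun_eq_iff smul_apply algebra_simps)

lemma graded_part_smul: "homogeneous s p \<Longrightarrow> graded_part \<delta> t (smul p u) = smul p (graded_part \<delta> (t - s) u)"
  by (simp add: fun_eq_iff graded_part_def smul_apply hcomp_homogeneous_mult algebra_simps)

lemma graded_part_add: "graded_part \<delta> t (u + w) = graded_part \<delta> t u + graded_part \<delta> t w"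
  and graded_part_diff: "graded_part \<delta> t (u - w) = graded_part \<delta> t u - graded_part \<delta> t w"
  and graded_part_uminus: "graded_part \<delta> t (- u) = - graded_part \<delta> t u"
  by (simp_all add: fun_eq_iff graded_part_def)

lemma graded_part_idem: "graded_part \<delta> t (graded_part \<delta> t u) = graded_part \<delta> t u"
  by (simp add: fun_eq_iff graded_part_def hcomp_hcomp)

text \<open>A complex of graded free modules, with its homological degree subtracted from the internal degree
  and all terms collected into one module: the differential then raises the degree by one.\<close>
locale differential_module =
  fixes E :: "nat set" and \<delta> :: "nat \<Rightarrow> int" and D :: "(nat \<Rightarrow> 'v::finite cpoly) \<Rightarrow> (nat \<Rightarrow> 'v cpoly)"
  assumes D_add: "D (u + w) = D u + D w"
    and D_smul: "D (smul p u) = smul p (D u)"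
    and D_supported: "u \<in> supported E \<Longrightarrow> D u \<in> supported E"
    and D_D: "u \<in> supported E \<Longrightarrow> D (D u) = 0"
    and D_graded: "D (graded_part \<delta> t u) = graded_part \<delta> (t + 1) (D u)"
begin

lemma D_0: "D 0 = 0"
  using D_add[of 0 0] by simp

lemma D_uminus: "D (- u) = - D u"
  using D_add[of u "- u"] D_0 by (simp add: eq_neg_iff_add_eq_0 add.commute)

lemma D_diff: "D (u - w) = D u - D w"
  using D_add[of u "- w"] D_uminus by simp

lemma D_var_multiples:
  assumes "finite B" "u \<in> var_multiples B" "u \<in> supported E"
  shows "D u \<in> var_multiples B"
  using assms
proof (induction B arbitrary: u)
  case empty
  then show ?case using D_0 by (simp only: var_multiples_empty singleton_iff)
next
  case (insert x B)
  obtain q b where qb: "u = smul (Var x) q + b" "b \<in> var_multiples B" "q \<in> supported E" "b \<in> supported E"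
    using var_multiples_insert_decompose[OF insert.prems] by blast
  have "D b \<in> var_multiples B" by (rule insert.IH[OF qb(2,4)])
  then have "D b \<in> var_multiples (insert x B)" using var_multiples_mono[of B "insert x B"] by blast
  moreover have "D u = smul (Var x) (D q) + D b" by (simp only: qb(1) D_add D_smul)
  ultimately show ?case by (simp only: var_multiples_add var_multiples_Var insertI1)
qed

text \<open>The polynomials that act as 0 on the homology, the quotient of the cycles by the
  boundaries.\<close>

definition annihilator :: "'v cpoly set" where
  "annihilator = {q. \<forall>u\<in>supported E. D u = 0 \<longrightarrow> (\<exists>w\<in>supported E. smul q u = D w)}"

text \<open>The cycles of the complex modulo the variables in \<open>B\<close> are the
  \<open>u\<close> with \<open>D u\<close> in \<open>var_multiples B\<close>. Their homology is
  torsion with respect to all variables, not only those in \<open>B\<close>.\<close>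

definition torsion :: "'v set \<Rightarrow> bool" where
  "torsion B \<longleftrightarrow> (\<forall>u\<in>supported E. D u \<in> var_multiples B \<longrightarrow>
     (\<forall>v. \<exists>s. \<exists>w\<in>supported E. smul (Var v ^ s) u - D w \<in> var_multiples B))"

text \<open>In the normalized degrees, vanishing above \<open>R\<close> means that the homology in
  homological degree \<open>k\<close> vanishes in internal degrees above
  \<open>R + k\<close>.\<close>

definition acyclic_above :: "real \<Rightarrow> 'v set \<Rightarrow> bool" where
  "acyclic_above R B \<longleftrightarrow> (\<forall>t u. of_int t > R \<longrightarrow> u \<in> supported E \<longrightarrow> graded_part \<delta> t u = u \<longrightarrow>
     D u \<in> var_multiples B \<longrightarrow> (\<exists>w\<in>supported E. u - D w \<in> var_multiples B))"

lemma is_ideal_annihilator: "is_ideal annihilator"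
  unfolding is_ideal_def
proof (intro conjI ballI allI)
  show "0 \<in> annihilator" unfolding annihilator_def using supported_0 D_0 smul_0_left by force
next
  fix p q assume pq: "p \<in> annihilator" "q \<in> annihilator"
  show "p + q \<in> annihilator"
    unfolding annihilator_def
  proof (intro CollectI ballI impI)
    fix u assume "u \<in> supported E" "D u = 0"
    then obtain w w' where "w \<in> supported E" "w' \<in> supported E" "smul p u = D w" "smul q u = D w'"
      using pq unfolding annihilator_def by blast
    then show "\<exists>w\<in>supported E. smul (p + q) u = D w"
      by (intro bexI[of _ "w + w'"]) (simp_all only: smul_add_left D_add supported_add)
  qed
next
  fix p c assume p: "p \<in> annihilator"
  show "c * p \<in> annihilator"
    unfolding annihilator_def
  proof (intro CollectI ballI impI)
    fix u assume "u \<in> supported E" "D u = 0"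
    then obtain w where "w \<in> supported E" "smul p u = D w" using p unfolding annihilator_def by blast
    then show "\<exists>w\<in>supported E. smul (c * p) u = D w"
      by (intro bexI[of _ "smul c w"]) (simp_all only: smul_smul[symmetric] D_smul supported_smul)
  qed
qed

text \<open>The long exact sequence for multiplication by \<open>Var x\<close>, by hand. Modulo
  \<open>B\<close> the boundary of \<open>u\<close> is \<open>x\<close> times some \<open>a\<close>,
  again a cycle; a power of \<open>v\<close> makes \<open>a\<close> a boundary, which corrects the
  multiple of \<open>u\<close> to a cycle modulo \<open>B\<close>, and a second power makes that one
  a boundary.\<close>

lemma torsion_insert:
  assumes T: "torsion B"
  shows "torsion (insert x B)"
  unfolding torsion_def
proof (intro ballI impI allI)
  fix u v assume u: "u \<in> supported E" and Du: "D u \<in> var_multiples (insert x B)"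
  obtain a b where ab: "D u = smul (Var x) a + b" "b \<in> var_multiples B" "a \<in> supported E" "b \<in> supported E"
    using var_multiples_insert_decompose[OF Du D_supported[OF u]] by blast
  show "\<exists>s. \<exists>w\<in>supported E. smul (Var v ^ s) u - D w \<in> var_multiples (insert x B)"
  proof (cases "x \<in> B")
    case True
    then show ?thesis using T u Du unfolding torsion_def by (simp add: insert_absorb)
  next
    case x: False
    have "0 = smul (Var x) (D a) + D b" using D_D[OF u] unfolding ab(1) D_add D_smul by simp
    then have "smul (Var x) (D a) = - D b" by (simp only: eq_neg_iff_add_eq_0)
    moreover have "D b \<in> var_multiples B" by (rule D_var_multiples[OF finite ab(2,4)])
    ultimately have "smul (Var x) (D a) \<in> var_multiples B"
      using var_multiples_diff[OF var_multiples_0] by fastforce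
    then have "D a \<in> var_multiples B" using x by (rule var_multiples_cancel)
    then obtain s c where c: "c \<in> supported E" "smul (Var v ^ s) a - D c \<in> var_multiples B"
      using T ab(3) unfolding torsion_def by blast
    define u' where "u' = smul (Var v ^ s) u - smul (Var x) c"
    have u': "u' \<in> supported E" unfolding u'_def using u c(1) by (intro supported_diff supported_smul)
    have "D u' = smul (Var x) (smul (Var v ^ s) a - D c) + smul (Var v ^ s) b"
      unfolding u'_def D_diff D_smul ab(1) by (simp add: fun_eq_iff smul_apply algebra_simps)
    then have "D u' \<in> var_multiples B"
      using c(2) ab(2) by (simp only: var_multiples_add var_multiples_smul)
    then obtain s' e where e: "e \<in> supported E" "smul (Var v ^ s') u' - D e \<in> var_multiples B"
      using T u' unfolding torsion_def by blast
    have eq: "smul (Var v ^ (s + s')) u - D e = (smul (Var v ^ s') u' - D e) + smul (Var x) (smul (Var v ^ s') c)"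
      unfolding u'_def by (simp add: fun_eq_iff smul_apply algebra_simps power_add)
    have "smul (Var v ^ (s + s')) u - D e \<in> var_multiples (insert x B)"
      unfolding eq
      using e(2) var_multiples_mono[of B "insert x B"] by (intro var_multiples_add var_multiples_Var) auto
    then show ?thesis using e(1) by blast
  qed
qed

text \<open>\<open>Var x\<close> is injective on the homology modulo \<open>B\<close> above
  \<open>R\<close>: if \<open>x * u\<close> is the boundary of \<open>w\<close> modulo
  \<open>B\<close>, then \<open>w\<close> is a cycle modulo \<open>insert x B\<close>, hence a
  boundary up to \<open>x * c\<close>, and cancelling \<open>x\<close> shows that \<open>u\<close>
  is the boundary of \<open>c\<close> modulo \<open>B\<close>.\<close>

lemma acyclic_step:
  assumes A: "acyclic_above R (insert x B)" and x: "x \<notin> B" and t: "of_int t > R"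
    and u: "u \<in> supported E" "graded_part \<delta> t u = u"
    and w: "w \<in> supported E" "smul (Var x) u - D w \<in> var_multiples B"
  shows "\<exists>w\<in>supported E. u - D w \<in> var_multiples B"
proof -
  \<comment> \<open>The part of degree \<open>t\<close> is enough: \<open>D\<close> raises degrees
    by one, as does \<open>Var x\<close>.\<close>
  define w' where "w' = graded_part \<delta> t w"
  define b where "b = smul (Var x) u - D w'"
  have w': "w' \<in> supported E" "graded_part \<delta> t w' = w'"
    unfolding w'_def using w(1) by (simp_all only: supported_graded_part graded_part_idem)
  have "graded_part \<delta> (t + 1) (smul (Var x) u - D w) = b"
    unfolding b_def w'_def D_graded graded_part_diff graded_part_smul[OF homogeneous_Var] using u(2) by simp
  then have b: "b \<in> var_multiples B" using var_multiples_graded_part[OF w(2)] by metis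
  have Dw': "D w' = smul (Var x) u - b" by (simp add: b_def)
  have "b \<in> var_multiples (insert x B)" using b var_multiples_mono[of B "insert x B"] by blast
  then have "D w' \<in> var_multiples (insert x B)" unfolding Dw' by (intro var_multiples_diff var_multiples_Var) auto
  then obtain y where y: "y \<in> supported E" "w' - D y \<in> var_multiples (insert x B)"
    using A t w' unfolding acyclic_above_def by blast
  obtain c e where ce: "w' - D y = smul (Var x) c + e" "e \<in> var_multiples B" "c \<in> supported E" "e \<in> supported E"
    using var_multiples_insert_decompose[OF y(2) supported_diff[OF w'(1) D_supported[OF y(1)]]] by blast
  have "D w' = D (w' - D y)" by (simp only: D_diff D_D[OF y(1)] diff_zero)
  also have "\<dots> = smul (Var x) (D c) + D e" by (simp only: ce(1) D_add D_smul)
  finally have "smul (Var x) (u - D c) = b + D e" using Dw' by (simp add: smul_diff algebra_simps)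
  moreover have "b + D e \<in> var_multiples B" by (intro var_multiples_add b D_var_multiples[OF finite ce(2,4)])
  ultimately have "u - D c \<in> var_multiples B" using var_multiples_cancel[of x "u - D c" B] x by simp
  then show ?thesis using ce(3) by blast
qed

text \<open>Torsion makes \<open>x ^ s * u\<close> a boundary modulo \<open>B\<close>; the factors
  \<open>x\<close> are then removed one by one, in degrees that all stay above
  \<open>R\<close>.\<close>

lemma acyclic_above_step:
  assumes A: "acyclic_above R (insert x B)" and x: "x \<notin> B" and T: "torsion B"
  shows "acyclic_above R B"
  unfolding acyclic_above_def
proof (intro allI impI)
  fix t u assume t: "of_int t > R" and u: "u \<in> supported E" "graded_part \<delta> t u = u" "D u \<in> var_multiples B"
  obtain s w where sw: "w \<in> supported E" "smul (Var x ^ s) u - D w \<in> var_multiples B"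
    using T u(1,3) unfolding torsion_def by blast
  then show "\<exists>w\<in>supported E. u - D w \<in> var_multiples B"
  proof (induction s arbitrary: w)
    case 0
    then show ?case by (auto simp: smul_1)
  next
    case (Suc s)
    define u' where "u' = smul (Var x ^ s) u"
    have "homogeneous (int s) (Var x ^ s)" using homogeneous_power[OF homogeneous_Var, of s x] by simp
    then have "graded_part \<delta> (t + int s) u' = u'"
      unfolding u'_def using u(2) by (simp add: graded_part_smul)
    moreover have "u' \<in> supported E" unfolding u'_def using u(1) by (rule supported_smul)
    moreover have "smul (Var x) u' - D w \<in> var_multiples B" using Suc.prems(2) by (simp only: u'_def smul_smul power_Suc)
    moreover have "of_int (t + int s) > R" using t by simp
    ultimately obtain w' where "w' \<in> supported E" "u' - D w' \<in> var_multiples B"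
      using acyclic_step[OF A x] Suc.prems(1) by blast
    then show ?case using Suc.IH unfolding u'_def by blast
  qed
qed

theorem acyclic_above_bound:
  assumes R: "\<And>e. e \<in> E \<Longrightarrow> of_int (\<delta> e) \<le> R" and T: "torsion {}"
  shows "acyclic_above R {}"
proof -
  have T': "torsion B" if "finite B" for B
    using that by induction (simp_all add: T torsion_insert)
  have "acyclic_above R B" for B
  proof (induction "card (- B)" arbitrary: B)
    case 0
    \<comment> \<open>Base case: coordinates of degree \<open>t - \<delta> e > 0\<close> have no
      constant term, so they vanish modulo all the variables.\<close>
    then have B: "B = UNIV" by auto
    show ?case
      unfolding acyclic_above_def
    proof (intro allI impI)
      fix t and u :: "nat \<Rightarrow> 'v cpoly"
      assume t: "of_int t > R" and u: "u \<in> supported E" "graded_part \<delta> t u = u"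
      have "u e \<in> var_ideal UNIV" for e
      proof (cases "e \<in> E")
        case True
        have "real_of_int (t - \<delta> e) > 0" using R[OF True] t by simp
        then have "t - \<delta> e > 0" by linarith
        moreover have "homogeneous (t - \<delta> e) (u e)"
          unfolding homogeneous_iff_hcomp using fun_cong[OF u(2), of e] by (simp add: graded_part_def)
        ultimately show ?thesis by (intro homogeneous_in_var_ideal_UNIV)
      next
        case False
        then show ?thesis using u(1) is_ideal_zero[OF is_ideal_var_ideal] by (simp add: supported_def)
      qed
      then show "\<exists>w\<in>supported E. u - D w \<in> var_multiples B"
        using B by (intro bexI[of _ 0] supported_0) (simp add: D_0 var_multiples_def)
    qed
  next
    case (Suc k)
    then have "- B \<noteq> {}" by auto
    then obtain x where x: "x \<notin> B" by blast
    have "- insert x B = - B - {x}" by blast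
    then have "k = card (- insert x B)" using Suc.hyps(2) x by simp
    then have "acyclic_above R (insert x B)" by (rule Suc.hyps(1))
    then show ?case using x T'[OF finite] by (rule acyclic_above_step)
  qed
  then show ?thesis .
qed

text \<open>The Nullstellensatz puts a power of each variable into the annihilator.\<close>

lemma torsion_empty_of_annihilator:
  assumes "zero_set annihilator \<subseteq> {0}"
  shows "torsion {}"
  unfolding torsion_def var_multiples_empty
proof (intro ballI impI allI)
  fix u v assume u: "u \<in> supported E" "D u \<in> {0}"
  have "\<exists>k. Var v ^ k \<in> annihilator"
    using assms by (intro nullstellensatz[OF is_ideal_annihilator]) auto
  then obtain k where "Var v ^ k \<in> annihilator" by blast
  then show "\<exists>s. \<exists>w\<in>supported E. smul (Var v ^ s) u - D w \<in> {0}"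
    using u unfolding annihilator_def by fastforce
qed

end

section \<open>Mapping cones\<close>

definition even_part :: "(nat \<Rightarrow> 'b) \<Rightarrow> nat \<Rightarrow> 'b" where "even_part u = (\<lambda>i. u (2 * i))"
definition odd_part :: "(nat \<Rightarrow> 'b) \<Rightarrow> nat \<Rightarrow> 'b" where "odd_part u = (\<lambda>i. u (2 * i + 1))"
text \<open>The direct sum of two modules indexed by naturals, again indexed by naturals: the
  original copy sits at even places, the shifted one at odd places.\<close>

definition interleave :: "(nat \<Rightarrow> 'b) \<Rightarrow> (nat \<Rightarrow> 'b) \<Rightarrow> nat \<Rightarrow> 'b" where
  "interleave a b = (\<lambda>e. if even e then a (e div 2) else b (e div 2))"

definition cone_index :: "nat set \<Rightarrow> nat set" where
  "cone_index E = {e. e div 2 \<in> E}"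

text \<open>The second copy is shifted by \<open>d\<close> in internal degree and by one in
  homological degree.\<close>

definition cone_degree :: "int \<Rightarrow> (nat \<Rightarrow> int) \<Rightarrow> nat \<Rightarrow> int" where
  "cone_degree d \<delta> = interleave \<delta> (\<lambda>i. \<delta> i + d - 1)"

text \<open>The mapping cone of multiplication by \<open>g\<close>; the sign on the second copy
  makes the square vanish.\<close>

definition cone_differential ::
  "'v cpoly \<Rightarrow> ((nat \<Rightarrow> 'v cpoly) \<Rightarrow> (nat \<Rightarrow> 'v cpoly)) \<Rightarrow> (nat \<Rightarrow> 'v cpoly) \<Rightarrow> (nat \<Rightarrow> 'v cpoly)" where
  "cone_differential g D u = interleave (D (even_part u) + smul g (odd_part u)) (- D (odd_part u))"

lemma even_part_interleave [simp]: "even_part (interleave a b) = a"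
  and odd_part_interleave [simp]: "odd_part (interleave a b) = b"
  by (simp_all add: fun_eq_iff even_part_def odd_part_def interleave_def)

lemma interleave_parts [simp]: "interleave (even_part u) (odd_part u) = u"
  by (auto simp: fun_eq_iff even_part_def odd_part_def interleave_def elim: oddE)

lemma interleave_eqI: "even_part u = even_part w \<Longrightarrow> odd_part u = odd_part w \<Longrightarrow> u = w"
  by (metis interleave_parts)

lemma even_part_add: "even_part (u + w) = even_part u + even_part w"
  and odd_part_add: "odd_part (u + w) = odd_part u + odd_part w"
  and even_part_0: "even_part 0 = 0"
  and odd_part_0: "odd_part 0 = 0"
  by (simp_all add: even_part_def odd_part_def fun_eq_iff)

lemma even_part_smul: "even_part (smul p u) = smul p (even_part u)"
  and odd_part_smul: "odd_part (smul p u) = smul p (odd_part u)"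
  by (simp_all add: even_part_def odd_part_def fun_eq_iff smul_apply)

lemma even_part_graded_part: "even_part (graded_part (cone_degree d \<delta>) t u) = graded_part \<delta> t (even_part u)"
  and odd_part_graded_part: "odd_part (graded_part (cone_degree d \<delta>) t u) = graded_part \<delta> (t - d + 1) (odd_part u)"
  by (simp_all add: even_part_def odd_part_def fun_eq_iff graded_part_def cone_degree_def interleave_def algebra_simps)

lemma supported_cone_iff: "u \<in> supported (cone_index E) \<longleftrightarrow> even_part u \<in> supported E \<and> odd_part u \<in> supported E"
proof
  assume "u \<in> supported (cone_index E)"
  then show "even_part u \<in> supported E \<and> odd_part u \<in> supported E"
    by (auto simp: supported_def cone_index_def even_part_def odd_part_def)
next
  assume h: "even_part u \<in> supported E \<and> odd_part u \<in> supported E"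
  have "u e = 0" if "e div 2 \<notin> E" for e
  proof (cases "even e")
    case True
    then have "u e = even_part u (e div 2)" by (simp add: even_part_def)
    then show ?thesis using h that by (simp add: supported_def)
  next
    case False
    then have "u e = odd_part u (e div 2)" by (simp add: odd_part_def)
    then show ?thesis using h that by (simp add: supported_def)
  qed
  then show "u \<in> supported (cone_index E)" by (simp add: supported_def cone_index_def)
qed

lemma differential_module_cone:
  assumes "differential_module E \<delta> D" and g: "homogeneous d g"
  shows "differential_module (cone_index E) (cone_degree d \<delta>) (cone_differential g D)"
proof -
  interpret differential_module E \<delta> D by fact
  show ?thesis
  proof
    show "cone_differential g D (u + w) = cone_differential g D u + cone_differential g D w" for u w
      by (rule interleave_eqI)
        (simp_all add: cone_differential_def even_part_add odd_part_add D_add smul_add)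
    show "cone_differential g D (smul p u) = smul p (cone_differential g D u)" for p u
      by (rule interleave_eqI)
        (simp_all add: cone_differential_def even_part_smul odd_part_smul D_smul smul_add smul_smul smul_uminus mult.commute)
    show "cone_differential g D u \<in> supported (cone_index E)" if "u \<in> supported (cone_index E)" for u
      using that by (simp add: supported_cone_iff cone_differential_def supported_add supported_smul supported_uminus D_supported)
    show "cone_differential g D (cone_differential g D u) = 0" if "u \<in> supported (cone_index E)" for u
      by (rule interleave_eqI)
        (use that in \<open>simp_all add: supported_cone_iff cone_differential_def even_part_0 odd_part_0 D_add D_smul D_uminus D_D smul_uminus\<close>)
    show "cone_differential g D (graded_part (cone_degree d \<delta>) t u)
        = graded_part (cone_degree d \<delta>) (t + 1) (cone_differential g D u)" for t u
    proof (rule interleave_eqI)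
      have "graded_part \<delta> (t + 1) (smul g (odd_part u)) = smul g (graded_part \<delta> (t - d + 1) (odd_part u))"
        by (simp add: graded_part_smul[OF g] algebra_simps)
      then show "even_part (cone_differential g D (graded_part (cone_degree d \<delta>) t u))
          = even_part (graded_part (cone_degree d \<delta>) (t + 1) (cone_differential g D u))"
        by (simp add: cone_differential_def even_part_graded_part odd_part_graded_part D_graded graded_part_add)
      show "odd_part (cone_differential g D (graded_part (cone_degree d \<delta>) t u))
          = odd_part (graded_part (cone_degree d \<delta>) (t + 1) (cone_differential g D u))"
        by (simp add: cone_differential_def even_part_graded_part odd_part_graded_part D_graded graded_part_uminus algebra_simps)
    qed
  qed
qed

text \<open>Multiplication by \<open>g\<close> is null-homotopic on the cone: the homotopy moves the
  first copy into the second.\<close>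

lemma cone_annihilator_new:
  assumes "differential_module E \<delta> D" and g: "homogeneous d g"
  shows "g \<in> differential_module.annihilator (cone_index E) (cone_differential g D)"
proof -
  interpret differential_module E \<delta> D by fact
  interpret C: differential_module "cone_index E" "cone_degree d \<delta>" "cone_differential g D"
    by (rule differential_module_cone[OF assms])
  show ?thesis
    unfolding C.annihilator_def
  proof (intro CollectI ballI impI)
    fix u assume u: "u \<in> supported (cone_index E)" "cone_differential g D u = 0"
    have "D (even_part u) + smul g (odd_part u) = 0"
      using arg_cong[OF u(2), of even_part] by (simp add: cone_differential_def even_part_0)
    then have odd: "smul g (odd_part u) = - D (even_part u)" by (metis add.commute eq_neg_iff_add_eq_0)
    have "smul g u = cone_differential g D (interleave 0 (even_part u))"
    proof (rule interleave_eqI)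
      show "even_part (smul g u) = even_part (cone_differential g D (interleave 0 (even_part u)))"
        unfolding cone_differential_def even_part_interleave odd_part_interleave even_part_smul D_0 by simp
      show "odd_part (smul g u) = odd_part (cone_differential g D (interleave 0 (even_part u)))"
        unfolding cone_differential_def odd_part_interleave odd_part_smul by (rule odd)
    qed
    moreover have "interleave 0 (even_part u) \<in> supported (cone_index E)"
      using u(1) by (simp add: supported_cone_iff supported_0)
    ultimately show "\<exists>w\<in>supported (cone_index E). smul g u = cone_differential g D w" by blast
  qed
qed

text \<open>The long exact sequence of the cone: one factor \<open>q\<close> makes the second
  component of a cycle a boundary, and after the correction a second factor does the same for the
  first.\<close>

lemma cone_annihilator_old:
  assumes "differential_module E \<delta> D" and g: "homogeneous d g"
    and q: "q \<in> differential_module.annihilator E D"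
  shows "q ^ 2 \<in> differential_module.annihilator (cone_index E) (cone_differential g D)"
proof -
  interpret differential_module E \<delta> D by fact
  interpret C: differential_module "cone_index E" "cone_degree d \<delta>" "cone_differential g D"
    by (rule differential_module_cone[OF assms(1,2)])
  show ?thesis
    unfolding C.annihilator_def
  proof (intro CollectI ballI impI)
    fix u assume u: "u \<in> supported (cone_index E)" "cone_differential g D u = 0"
    define a where "a = even_part u"
    define b where "b = odd_part u"
    have ab: "a \<in> supported E" "b \<in> supported E" using u(1) by (simp_all add: supported_cone_iff a_def b_def)
    have 1: "D a + smul g b = 0"
      using arg_cong[OF u(2), of even_part] by (simp add: cone_differential_def even_part_0 a_def b_def)
    have "- D b = 0"
      using arg_cong[OF u(2), of odd_part] by (simp add: cone_differential_def odd_part_0 b_def)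
    then have 2: "D b = 0" by simp
    obtain c where c: "c \<in> supported E" "smul q b = D c" using q ab(2) 2 unfolding annihilator_def by blast
    have "D (smul q a + smul g c) = smul q (D a + smul g b)"
      by (simp add: D_add D_smul c(2)[symmetric] smul_add smul_smul mult.commute)
    also have "\<dots> = 0" by (simp add: 1 smul_0)
    finally have "D (smul q a + smul g c) = 0" .
    moreover have "smul q a + smul g c \<in> supported E" using ab c by (intro supported_add supported_smul)
    ultimately obtain e where e: "e \<in> supported E" "smul q (smul q a + smul g c) = D e"
      using q unfolding annihilator_def by blast
    have "smul (q ^ 2) u = cone_differential g D (interleave e (- smul q c))"
    proof (rule interleave_eqI)
      show "even_part (smul (q ^ 2) u) = even_part (cone_differential g D (interleave e (- smul q c)))"
        using e(2) by (simp add: cone_differential_def even_part_smul a_def[symmetric] smul_add smul_smul smul_uminus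
            power2_eq_square mult.commute algebra_simps flip: e(2))
      show "odd_part (smul (q ^ 2) u) = odd_part (cone_differential g D (interleave e (- smul q c)))"
        by (simp add: cone_differential_def odd_part_smul b_def[symmetric] D_uminus D_smul smul_smul
            power2_eq_square flip: c(2))
    qed
    moreover have "interleave e (- smul q c) \<in> supported (cone_index E)"
      using e(1) c(1) by (simp add: supported_cone_iff supported_uminus supported_smul)
    ultimately show "\<exists>w\<in>supported (cone_index E). smul (q ^ 2) u = cone_differential g D w" by blast
  qed
qed

section \<open>Regularity and Artinian quotients\<close>

text \<open>Here \<open>\<epsilon>\<close> is the augmentation, read off the part in homological degree \<open>0\<close>.\<close>
definition resolves :: "nat set \<Rightarrow> (nat \<Rightarrow> int) \<Rightarrow> ((nat \<Rightarrow> 'v::finite cpoly) \<Rightarrow> (nat \<Rightarrow> 'v cpoly)) \<Rightarrow>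
    real \<Rightarrow> ((nat \<Rightarrow> 'v cpoly) \<Rightarrow> 'v cpoly) \<Rightarrow> 'v cpoly set \<Rightarrow> bool" where
  "resolves E \<delta> D R \<epsilon> I \<longleftrightarrow> differential_module E \<delta> D \<and> (\<forall>e\<in>E. of_int (\<delta> e) \<le> R) \<and>
     (\<forall>u w. \<epsilon> (u + w) = \<epsilon> u + \<epsilon> w) \<and> (\<forall>p u. \<epsilon> (smul p u) = p * \<epsilon> u) \<and>
     (\<forall>w\<in>supported E. \<epsilon> (D w) \<in> I) \<and>
     (\<forall>t p. homogeneous t p \<longrightarrow> (\<exists>u\<in>supported E. D u = 0 \<and> graded_part \<delta> t u = u \<and> p - \<epsilon> u \<in> I)) \<and>
     (\<forall>q\<in>I. \<exists>s. q ^ s \<in> differential_module.annihilator E D)"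

lemma ideal_plus_Suc:
  assumes "is_ideal J"
  shows "ideal_plus J g {1..N} \<subseteq> ideal_plus J g {1..Suc N}"
  by (rule ideal_plus_least[OF is_ideal_ideal_plus[OF assms] ideal_plus_superset])
    (use ideal_plus_generator[OF assms, of "{1..Suc N}"] in auto)

text \<open>The second copy reaches degree at most \<open>R + d - 1\<close>; since
  \<open>d \<ge> 1\<close>, the first copy obeys the same bound.\<close>

lemma resolves_cone:
  fixes J :: "'v::finite cpoly set"
  assumes J: "is_ideal J" and res: "resolves E \<delta> D R \<epsilon> (ideal_plus J g {1..N})"
    and g: "homogeneous d (g (Suc N))" "d \<ge> 1"
  shows "\<exists>E \<delta> D \<epsilon>. resolves E \<delta> D (R + of_int (d - 1)) \<epsilon> (ideal_plus J g {1..Suc N})"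
proof -
  let ?I = "ideal_plus J g {1..N}" and ?I' = "ideal_plus J g {1..Suc N}"
  let ?g = "g (Suc N)"
  have dm: "differential_module E \<delta> D" and R: "\<forall>e\<in>E. of_int (\<delta> e) \<le> R"
    and \<epsilon>: "\<forall>u w. \<epsilon> (u + w) = \<epsilon> u + \<epsilon> w" "\<forall>p u. \<epsilon> (smul p u) = p * \<epsilon> u" "\<forall>w\<in>supported E. \<epsilon> (D w) \<in> ?I"
    and lift: "\<forall>t p. homogeneous t p \<longrightarrow> (\<exists>u\<in>supported E. D u = 0 \<and> graded_part \<delta> t u = u \<and> p - \<epsilon> u \<in> ?I)"
    and ann: "\<forall>q\<in>?I. \<exists>s. q ^ s \<in> differential_module.annihilator E D"
    using res unfolding resolves_def by blast+
  interpret differential_module E \<delta> D by (rule dm)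
  interpret C: differential_module "cone_index E" "cone_degree d \<delta>" "cone_differential ?g D"
    by (rule differential_module_cone[OF dm g(1)])
  have id': "is_ideal ?I'" by (rule is_ideal_ideal_plus[OF J])
  have sub: "?I \<subseteq> ?I'" by (rule ideal_plus_Suc[OF J])
  have gI: "?g \<in> ?I'" by (rule ideal_plus_generator[OF J]) simp_all
  \<comment> \<open>Comparing zero sets replaces the bookkeeping of exponents; the Nullstellensatz
    gives back a power of each element of the larger ideal.\<close>
  have zann: "zero_set C.annihilator \<subseteq> zero_set ?I'"
  proof
    fix x assume x: "x \<in> zero_set C.annihilator"
    have zero: "poly_at q x = 0" if "q ^ s \<in> C.annihilator" for q s
    proof -
      have "poly_at (q ^ s) x = 0" using x that unfolding zero_set_def by blast
      then show ?thesis by simp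
    qed
    have "?I' \<subseteq> vanishing_ideal {x}"
    proof (rule ideal_plus_least[OF is_ideal_vanishing_ideal])
      have I: "q \<in> vanishing_ideal {x}" if q: "q \<in> ?I" for q
      proof -
        obtain s where "q ^ s \<in> annihilator" using ann q by blast
        then have "(q ^ s) ^ 2 \<in> C.annihilator" by (rule cone_annihilator_old[OF dm g(1)])
        then have "q ^ (s * 2) \<in> C.annihilator" by (simp only: power_mult)
        then show ?thesis using zero by (simp add: vanishing_ideal_def)
      qed
      then show "J \<subseteq> vanishing_ideal {x}" using ideal_plus_superset[of J g "{1..N}"] by blast
      fix j assume j: "j \<in> {1..Suc N}"
      show "g j \<in> vanishing_ideal {x}"
      proof (cases "j = Suc N")
        case True
        have "?g ^ 1 \<in> C.annihilator" using cone_annihilator_new[OF dm g(1)] by simp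
        then have "poly_at ?g x = 0" by (rule zero)
        then show ?thesis using True by (simp add: vanishing_ideal_def)
      next
        case False
        then show ?thesis using j by (intro I ideal_plus_generator[OF J]) auto
      qed
    qed
    then show "x \<in> zero_set ?I'" by (auto simp: vanishing_ideal_def zero_set_def)
  qed
  have "resolves (cone_index E) (cone_degree d \<delta>) (cone_differential ?g D) (R + of_int (d - 1)) (\<lambda>u. \<epsilon> (even_part u)) ?I'"
    unfolding resolves_def
  proof (intro conjI allI ballI impI)
    show "differential_module (cone_index E) (cone_degree d \<delta>) (cone_differential ?g D)"
      by (rule C.differential_module_axioms)
    fix e assume "e \<in> cone_index E"
    then have "of_int (\<delta> (e div 2)) \<le> R" using R by (auto simp: cone_index_def)
    then show "of_int (cone_degree d \<delta> e) \<le> R + of_int (d - 1)"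
      using g(2) by (auto simp: cone_degree_def interleave_def)
  next
    fix u w
    show "\<epsilon> (even_part (u + w)) = \<epsilon> (even_part u) + \<epsilon> (even_part w)" using \<epsilon>(1) by (simp add: even_part_add)
  next
    fix p u
    show "\<epsilon> (even_part (smul p u)) = p * \<epsilon> (even_part u)" using \<epsilon>(2) by (simp add: even_part_smul)
  next
    fix w :: "nat \<Rightarrow> 'v cpoly" assume w: "w \<in> supported (cone_index E)"
    have "\<epsilon> (even_part (cone_differential ?g D w)) = \<epsilon> (D (even_part w)) + \<epsilon> (odd_part w) * ?g"
      using \<epsilon>(1,2) by (simp add: cone_differential_def mult.commute)
    also have "\<dots> \<in> ?I'"
      using \<epsilon>(3) w sub gI by (intro is_ideal_add[OF id'] is_ideal_mult[OF id']) (auto simp: supported_cone_iff)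
    finally show "\<epsilon> (even_part (cone_differential ?g D w)) \<in> ?I'" .
  next
    fix t p assume "homogeneous t (p :: 'v cpoly)"
    then obtain u where u: "u \<in> supported E" "D u = 0" "graded_part \<delta> t u = u" "p - \<epsilon> u \<in> ?I" using lift by blast
    have "interleave u 0 \<in> supported (cone_index E)" using u(1) by (simp add: supported_cone_iff supported_0)
    moreover have "cone_differential ?g D (interleave u 0) = 0"
      by (rule interleave_eqI) (simp_all add: cone_differential_def u(2) D_0 smul_0 even_part_0 odd_part_0)
    moreover have "graded_part (cone_degree d \<delta>) t (interleave u 0) = interleave u 0"
    proof (rule interleave_eqI)
      have "graded_part \<delta> s 0 = 0" for s by (simp add: fun_eq_iff graded_part_def)
      then show "odd_part (graded_part (cone_degree d \<delta>) t (interleave u 0)) = odd_part (interleave u 0)"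
        by (simp add: odd_part_graded_part)
    qed (simp add: even_part_graded_part u(3))
    moreover have "p - \<epsilon> (even_part (interleave u 0)) \<in> ?I'" using u(4) sub by auto
    ultimately show "\<exists>u\<in>supported (cone_index E). cone_differential ?g D u = 0 \<and>
        graded_part (cone_degree d \<delta>) t u = u \<and> p - \<epsilon> (even_part u) \<in> ?I'" by blast
  next
    fix q assume q: "q \<in> ?I'"
    show "\<exists>s. q ^ s \<in> C.annihilator"
    proof (rule nullstellensatz[OF C.is_ideal_annihilator])
      fix x assume "x \<in> zero_set C.annihilator"
      then show "poly_at q x = 0" using zann q unfolding zero_set_def by blast
    qed
  qed
  then show ?thesis by blast
qed

text \<open>A form of degree above \<open>R\<close> lifts to a cycle of the same degree; in that
  degree all cycles are boundaries, and the augmentation sends boundaries into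
  \<open>I\<close>.\<close>

theorem resolves_degree_bound:
  assumes res: "resolves E \<delta> D R \<epsilon> I" and I: "is_ideal I" and z: "zero_set I \<subseteq> {0}"
    and p: "homogeneous t p" "of_int t > R"
  shows "p \<in> I"
proof -
  have dm: "differential_module E \<delta> D" and R: "\<forall>e\<in>E. of_int (\<delta> e) \<le> R"
    and \<epsilon>: "\<forall>w\<in>supported E. \<epsilon> (D w) \<in> I"
    and lift: "\<forall>t p. homogeneous t p \<longrightarrow> (\<exists>u\<in>supported E. D u = 0 \<and> graded_part \<delta> t u = u \<and> p - \<epsilon> u \<in> I)"
    and ann: "\<forall>q\<in>I. \<exists>s. q ^ s \<in> differential_module.annihilator E D"
    using res unfolding resolves_def by blast+
  interpret differential_module E \<delta> D by (rule dm)
  have "zero_set annihilator \<subseteq> zero_set I"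
  proof
    fix x assume x: "x \<in> zero_set annihilator"
    have "poly_at q x = 0" if q: "q \<in> I" for q
    proof -
      obtain s where "q ^ s \<in> annihilator" using ann q by blast
      then have "poly_at (q ^ s) x = 0" using x unfolding zero_set_def by blast
      then show ?thesis by simp
    qed
    then show "x \<in> zero_set I" by (simp add: zero_set_def)
  qed
  then have "torsion {}" using z by (intro torsion_empty_of_annihilator) blast
  then have ac: "acyclic_above R {}" using R by (intro acyclic_above_bound) blast
  obtain u where u: "u \<in> supported E" "D u = 0" "graded_part \<delta> t u = u" "p - \<epsilon> u \<in> I" using lift p(1) by blast
  have "D u \<in> var_multiples {}" by (simp add: u(2) var_multiples_0)
  then obtain w where w: "w \<in> supported E" "u - D w \<in> var_multiples {}"
    using ac u(1,3) p(2) unfolding acyclic_above_def by blast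
  then have "u = D w" by (simp add: var_multiples_empty)
  then have "\<epsilon> u \<in> I" using \<epsilon> w(1) by blast
  then show ?thesis using is_ideal_add[OF I u(4)] by fastforce
qed

theorem degree_bound_of_parameters:
  assumes J: "is_ideal J" and res: "resolves E \<delta> D R \<epsilon> J"
    and g: "\<And>i. i \<in> {1..N} \<Longrightarrow> homogeneous (int (d i)) (g i)" "\<And>i. i \<in> {1..N} \<Longrightarrow> d i \<ge> 1"
    and z: "zero_set (ideal_plus J g {1..N}) \<subseteq> {0}"
    and p: "homogeneous t p" "of_int t > R + (\<Sum>i=1..N. real (d i) - 1)"
  shows "p \<in> ideal_plus J g {1..N}"
proof -
  have "\<exists>E \<delta> D \<epsilon>. resolves E \<delta> D (R + (\<Sum>i=1..k. real (d i) - 1)) \<epsilon> (ideal_plus J g {1..k})" if "k \<le> N" for k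
    using that
  proof (induction k)
    case 0
    have "ideal_plus J g {1..0} = J" by (simp add: ideal_plus_def)
    then show ?case using res by auto
  next
    case (Suc k)
    then obtain E \<delta> D \<epsilon> where k: "resolves E \<delta> D (R + (\<Sum>i=1..k. real (d i) - 1)) \<epsilon> (ideal_plus J g {1..k})"
      by (meson Suc_leD)
    have "\<exists>E \<delta> D \<epsilon>. resolves E \<delta> D (R + (\<Sum>i=1..k. real (d i) - 1) + of_int (int (d (Suc k)) - 1)) \<epsilon> (ideal_plus J g {1..Suc k})"
      by (rule resolves_cone[OF J k]) (use g[of "Suc k"] Suc.prems in auto)
    moreover have "R + (\<Sum>i=1..k. real (d i) - 1) + of_int (int (d (Suc k)) - 1) = R + (\<Sum>i=1..Suc k. real (d i) - 1)"
      by simp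
    ultimately show ?case by (simp only:)
  qed
  from this[OF order_refl] obtain E' \<delta>' D' \<epsilon>' where
    "resolves E' \<delta>' D' (R + (\<Sum>i=1..N. real (d i) - 1)) \<epsilon>' (ideal_plus J g {1..N})" by blast
  from resolves_degree_bound[OF this is_ideal_ideal_plus[OF J] z p] show ?thesis .
qed

section \<open>Minimal graded free resolutions\<close>

definition column_sum :: "nat \<Rightarrow> (nat \<Rightarrow> nat \<Rightarrow> 'v cpoly) \<Rightarrow> (nat \<Rightarrow> 'v cpoly) \<Rightarrow> (nat \<Rightarrow> 'v cpoly)" where
  "column_sum s c u = (\<lambda>i. \<Sum>j<s. c j i * u j)"

lemma column_sum_eq: "column_sum s c u = (\<Sum>j<s. smul (u j) (c j))"
  by (rule ext) (simp only: column_sum_def sum_fun_apply smul_apply mult.commute)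

lemma sum_graded_parts:
  fixes u :: "nat \<Rightarrow> 'v::finite cpoly"
  assumes "\<And>i. i \<ge> r \<Longrightarrow> u i = 0"
  shows "\<exists>T. finite T \<and> u = (\<Sum>t\<in>T. graded_part tw t u)"
proof -
  define m where "m = Max (insert 0 ((\<lambda>i. total_degree (u i)) ` {..<r}))"
  define T where "T = (\<lambda>(s, i). int s + tw i) ` ({..m} \<times> {..<r})"
  have fin: "finite T" by (simp add: T_def)
  have "u i = (\<Sum>t\<in>T. hcomp (t - tw i) (u i))" for i
  proof (cases "i < r")
    case False
    then show ?thesis using assms by simp
  next
    case True
    show ?thesis
    proof (rule poly_mapping_eqI)
      fix a
      have "lookup (\<Sum>t\<in>T. hcomp (t - tw i) (u i)) a = (\<Sum>t\<in>T. if t = int (mon_degree a) + tw i then lookup (u i) a else 0)"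
        unfolding lookup_sum lookup_hcomp by (rule sum.cong) auto
      also have "\<dots> = lookup (u i) a"
      proof (cases "a \<in> keys (u i)")
        case in_keys: True
        have "total_degree (u i) \<le> m" unfolding m_def using True by (intro Max_ge) auto
        then have "mon_degree a \<le> m" using mon_degree_le_total_degree[OF in_keys] by simp
        then have "int (mon_degree a) + tw i \<in> T" unfolding T_def using True by force
        then show ?thesis using fin by simp
      next
        case False
        then have "lookup (u i) a = 0" by (simp add: in_keys_iff)
        then show ?thesis by (simp only: if_cancel sum.neutral_const)
      qed
      finally show "lookup (u i) a = lookup (\<Sum>t\<in>T. hcomp (t - tw i) (u i)) a" ..
    qed
  qed
  then have "u = (\<Sum>t\<in>T. graded_part tw t u)" by (intro ext) (simp add: graded_part_def)
  then show ?thesis using fin by blast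
qed

text \<open>A homogeneous generating set of least cardinality does it. The last clause is its
  minimality: a relation with a nonzero constant coefficient would express one generator through the
  others.\<close>

lemma minimal_homogeneous_generators:
  fixes K :: "(nat \<Rightarrow> 'v::finite cpoly) set"
  assumes K: "fmod.subspace K" "\<And>u i. u \<in> K \<Longrightarrow> r \<le> i \<Longrightarrow> u i = 0" "\<And>u t. u \<in> K \<Longrightarrow> graded_part tw t u \<in> K"
  shows "\<exists>s tw' c. (\<forall>j<s. c j \<in> K \<and> graded_part tw (tw' j) (c j) = c j) \<and> range (column_sum s c) = K \<and>
     (\<forall>u i a. column_sum s c u = 0 \<longrightarrow> i < s \<longrightarrow> u i = Cst a \<longrightarrow> a = 0)"
proof -
  define H where "H = {v\<in>K. \<exists>t. graded_part tw t v = v}"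
  define good where "good G \<longleftrightarrow> finite G \<and> G \<subseteq> H \<and> K \<subseteq> fmod.span G" for G
  have "\<exists>B. finite B \<and> B \<subseteq> K \<and> K \<subseteq> fmod.span B"
    by (rule submodule_finitely_generated[where r = r, OF K(1)]) (rule K(2))
  then obtain B where B: "finite B" "B \<subseteq> K" "K \<subseteq> fmod.span B" by blast
  \<comment> \<open>Splitting finitely many generators into their graded parts gives homogeneous
    generators, since \<open>K\<close> is a graded submodule.\<close>
  have "\<forall>b\<in>B. \<exists>T. finite T \<and> b = (\<Sum>t\<in>T. graded_part tw t b)"
    using sum_graded_parts[of r] K(2) B(2) by blast
  then obtain T where T: "\<forall>b\<in>B. finite (T b) \<and> b = (\<Sum>t\<in>T b. graded_part tw t b)"
    unfolding bchoice_iff by (elim exE)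
  define G where "G = (\<Union>b\<in>B. (\<lambda>t. graded_part tw t b) ` T b)"
  have "good G"
    unfolding good_def
  proof (intro conjI)
    show "finite G" unfolding G_def using B(1) T by blast
    show "G \<subseteq> H" unfolding G_def H_def using B(2) K(3) graded_part_idem by blast
    have "b \<in> fmod.span G" if "b \<in> B" for b
    proof -
      have "(\<Sum>t\<in>T b. graded_part tw t b) \<in> fmod.span G"
        using that by (intro fmod.span_sum fmod.span_base) (auto simp: G_def)
      then show ?thesis using T that by metis
    qed
    then have "fmod.span B \<subseteq> fmod.span G" by (intro fmod.span_minimal) auto
    then show "K \<subseteq> fmod.span G" using B(3) by blast
  qed
  from ex_has_least_nat[of good, OF this, of card]
  obtain M where M: "good M" "\<forall>G. good G \<longrightarrow> card M \<le> card G" by blast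
  have Mf: "finite M" "M \<subseteq> H" "K \<subseteq> fmod.span M" using M(1) by (auto simp: good_def)
  have spanM: "fmod.span M = K"
    using Mf fmod.span_minimal[OF _ K(1), of M] by (auto simp: H_def)
  define s where "s = card M"
  obtain c where c: "bij_betw c {..<s} M"
    using ex_bij_betw_nat_finite[OF Mf(1)] unfolding s_def lessThan_atLeast0 by blast
  have cM: "c j \<in> M" if "j < s" for j using c that by (auto simp: bij_betw_def)
  have "\<forall>j. \<exists>t. j < s \<longrightarrow> graded_part tw t (c j) = c j" using cM Mf(2) unfolding H_def by blast
  then obtain tw' where tw': "\<forall>j. j < s \<longrightarrow> graded_part tw (tw' j) (c j) = c j" unfolding choice_iff by (elim exE)
  have inK: "c j \<in> K" if "j < s" for j using cM[OF that] Mf(2) by (auto simp: H_def)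
  have rng: "range (column_sum s c) = K"
  proof (intro subset_antisym subsetI)
    fix x assume "x \<in> range (column_sum s c)"
    then obtain u where "x = (\<Sum>j<s. smul (u j) (c j))" by (auto simp: column_sum_eq)
    then show "x \<in> K" using inK K(1) by (simp only:) (intro fmod.subspace_sum fmod.subspace_scale, auto)
  next
    fix x assume "x \<in> K"
    then have "x \<in> range (\<lambda>u. \<Sum>v\<in>M. smul (u v) v)" using spanM fmod.span_finite[OF Mf(1)] by blast
    then obtain u where "x = (\<Sum>v\<in>M. smul (u v) v)" by blast
    also have "\<dots> = (\<Sum>j<s. smul (u (c j)) (c j))" by (rule sum.reindex_bij_betw[OF c, symmetric])
    finally have "x = column_sum s c (\<lambda>j. u (c j))" by (simp only: column_sum_eq)
    then show "x \<in> range (column_sum s c)" by blast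
  qed
  have min: "a = 0" if u: "column_sum s c u = 0" "i < s" "u i = Cst a" for u i a
  proof (rule ccontr)
    assume a: "a \<noteq> 0"
    have "0 = smul (u i) (c i) + (\<Sum>j\<in>{..<s} - {i}. smul (u j) (c j))"
      using u(1,2) unfolding column_sum_eq by (subst (asm) sum.remove[of _ i]) auto
    then have 1: "smul (u i) (c i) = - (\<Sum>j\<in>{..<s} - {i}. smul (u j) (c j))" by (simp only: eq_neg_iff_add_eq_0)
    have "c i = smul (Cst (1 / a)) (smul (u i) (c i))"
      unfolding smul_smul u(3) Cst_mult[symmetric] using a by (simp add: smul_1)
    also have "\<dots> \<in> fmod.span (M - {c i})"
      unfolding 1
    proof (intro fmod.span_scale fmod.span_neg fmod.span_sum fmod.span_base)
      fix j assume j: "j \<in> {..<s} - {i}"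
      have "c j \<noteq> c i" using c j u(2) by (auto simp: bij_betw_def inj_on_def)
      then show "c j \<in> M - {c i}" using cM j by auto
    qed
    finally have ci: "c i \<in> fmod.span (M - {c i})" .
    have "M \<subseteq> fmod.span (M - {c i})"
    proof
      fix x assume "x \<in> M"
      then show "x \<in> fmod.span (M - {c i})" using ci fmod.span_base[of x "M - {c i}"] by (cases "x = c i") auto
    qed
    then have "fmod.span M \<subseteq> fmod.span (M - {c i})" by (intro fmod.span_minimal) auto
    then have "good (M - {c i})" using Mf unfolding good_def by auto
    then have "card M \<le> card (M - {c i})" using M(2) by blast
    moreover have "card (M - {c i}) < card M" using Mf(1) cM[OF u(2)] by (intro card_Diff1_less)
    ultimately show False by simp
  qed
  have "\<forall>j<s. c j \<in> K \<and> graded_part tw (tw' j) (c j) = c j" using inK tw' by simp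
  moreover have "\<forall>u i a. column_sum s c u = 0 \<longrightarrow> i < s \<longrightarrow> u i = Cst a \<longrightarrow> a = 0"
    by (intro allI impI) (rule min)
  ultimately show ?thesis using rng by (intro exI[of _ s] exI[of _ tw'] exI[of _ c] conjI)
qed

lemma graded_part_column_sum:
  assumes "\<And>j. j < s \<Longrightarrow> graded_part tw (tw' j) (c j) = c j"
  shows "graded_part tw t (column_sum s c u) = column_sum s c (graded_part tw' t u)"
proof (rule ext)
  fix i
  have h: "homogeneous (tw' j - tw i) (c j i)" if "j < s" for j
    using fun_cong[OF assms[OF that], of i] by (simp add: homogeneous_iff_hcomp graded_part_def)
  have "graded_part tw t (column_sum s c u) i = (\<Sum>j<s. hcomp (t - tw i) (c j i * u j))"
    by (simp add: graded_part_def column_sum_def hcomp_sum)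
  also have "\<dots> = (\<Sum>j<s. c j i * hcomp (t - tw' j) (u j))"
    by (rule sum.cong[OF refl]) (use hcomp_homogeneous_mult[OF h] in \<open>simp add: algebra_simps\<close>)
  finally show "graded_part tw t (column_sum s c u) i = column_sum s c (graded_part tw' t u) i"
    by (simp add: graded_part_def column_sum_def)
qed

lemma column_sum_add: "column_sum s c (u + w) = column_sum s c u + column_sum s c w"
  and column_sum_smul: "column_sum s c (smul p u) = smul p (column_sum s c u)"
  by (auto simp: fun_eq_iff column_sum_def smul_apply distrib_left sum.distrib sum_distrib_left mult_ac)

text \<open>A nonzero constant term forces degree 0. This links minimality of generators, stated for
  constant coefficients of relations, to matrix entries without constant term.\<close>

lemma homogeneous_nonzero_constant:
  assumes "homogeneous t p" "lookup p 0 \<noteq> 0"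
  shows "p = Cst (lookup p 0)"
proof (rule poly_mapping_eqI)
  fix a
  have "t = 0" using assms by (force simp: homogeneous_def in_keys_iff)
  then have "a \<noteq> 0 \<Longrightarrow> lookup p a = 0" using assms(1) by (fastforce simp: homogeneous_def in_keys_iff)
  then show "lookup p a = lookup (Cst (lookup p 0)) a"
    by (cases "a = 0") (auto simp: Cst_def lookup_single when_def)
qed

definition syzygies :: "nat \<Rightarrow> (nat \<Rightarrow> nat \<Rightarrow> 'v cpoly) \<Rightarrow> (nat \<Rightarrow> 'v cpoly) set" where
  "syzygies s c = {u. (\<forall>j\<ge>s. u j = 0) \<and> column_sum s c u = 0}"

text \<open>One stage of a resolution: the columns \<open>c\<close> have length \<open>r\<close>, degrees \<open>tw'\<close>, and are a minimal
  system of generators.\<close>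
definition stage :: "nat \<times> (nat \<Rightarrow> int) \<times> nat \<times> (nat \<Rightarrow> int) \<times> (nat \<Rightarrow> nat \<Rightarrow> 'v::finite cpoly) \<Rightarrow> bool" where
  "stage = (\<lambda>(r, tw, s, tw', c). (\<forall>j<s. (\<forall>i\<ge>r. c j i = 0) \<and> graded_part tw (tw' j) (c j) = c j \<and> (\<forall>i<r. lookup (c j i) 0 = 0)) \<and>
     (\<forall>u i a. column_sum s c u = 0 \<longrightarrow> i < s \<longrightarrow> u i = Cst a \<longrightarrow> a = 0))"

definition next_stage where
  "next_stage = (\<lambda>(r, tw, s, tw', c) (r2, tw2, s2, tw2', c2). r2 = s \<and> tw2 = tw' \<and> range (column_sum s2 c2) = syzygies s c)"

text \<open>Minimal generators of the syzygies form the next matrix. An entry with a constant term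
  would be a nonzero constant coefficient in a relation between the previous columns, which their
  minimality excludes.\<close>

lemma ex_next_stage:
  assumes "stage (r, tw, s, tw', c)"
  shows "\<exists>s2 tw2 c2. stage (s, tw', s2, tw2, c2) \<and> range (column_sum s2 c2) = syzygies s c"
proof -
  have c: "\<And>j. j < s \<Longrightarrow> graded_part tw (tw' j) (c j) = c j"
    and min: "\<forall>u i a. column_sum s c u = 0 \<longrightarrow> i < s \<longrightarrow> u i = Cst a \<longrightarrow> a = 0"
    using assms by (auto simp: stage_def)
  have sub: "fmod.subspace (syzygies s c)"
    unfolding fmod.subspace_def
  proof (intro conjI ballI allI)
    show "0 \<in> syzygies s c" by (simp add: syzygies_def column_sum_def fun_eq_iff)
    show "x + y \<in> syzygies s c" if "x \<in> syzygies s c" "y \<in> syzygies s c" for x y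
      using that by (auto simp: syzygies_def column_sum_add)
    show "smul a x \<in> syzygies s c" if "x \<in> syzygies s c" for a x
      using that by (auto simp: syzygies_def column_sum_smul smul_0 smul_apply)
  qed
  have gr: "graded_part tw' t u \<in> syzygies s c" if "u \<in> syzygies s c" for u t
  proof -
    have "column_sum s c (graded_part tw' t u) = graded_part tw t 0"
      using graded_part_column_sum[of s tw tw' c t u, OF c] that by (simp add: syzygies_def)
    also have "\<dots> = 0" by (simp add: graded_part_def fun_eq_iff)
    finally show ?thesis using that by (simp add: syzygies_def graded_part_def)
  qed
  have "\<exists>s2 tw2 c2. (\<forall>j<s2. c2 j \<in> syzygies s c \<and> graded_part tw' (tw2 j) (c2 j) = c2 j) \<and>
      range (column_sum s2 c2) = syzygies s c \<and>
      (\<forall>u i a. column_sum s2 c2 u = 0 \<longrightarrow> i < s2 \<longrightarrow> u i = Cst a \<longrightarrow> a = 0)"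
    by (rule minimal_homogeneous_generators[OF sub _ gr]) (auto simp: syzygies_def)
  then obtain s2 tw2 c2 where g: "\<forall>j<s2. c2 j \<in> syzygies s c \<and> graded_part tw' (tw2 j) (c2 j) = c2 j"
    "range (column_sum s2 c2) = syzygies s c"
    "\<forall>u i a. column_sum s2 c2 u = 0 \<longrightarrow> i < s2 \<longrightarrow> u i = Cst a \<longrightarrow> a = 0" by (elim exE conjE)
  have "lookup (c2 j i) 0 = 0" if "j < s2" "i < s" for i j
  proof (rule ccontr)
    assume ne: "lookup (c2 j i) 0 \<noteq> 0"
    have "homogeneous (tw2 j - tw' i) (c2 j i)"
      using fun_cong[of _ _ i] g(1) that(1) by (simp add: homogeneous_iff_hcomp graded_part_def) metis
    then have "c2 j i = Cst (lookup (c2 j i) 0)" using ne by (rule homogeneous_nonzero_constant)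
    moreover have "column_sum s c (c2 j) = 0" using g(1) that(1) by (auto simp: syzygies_def)
    ultimately have "lookup (c2 j i) 0 = 0" using min that(2) by blast
    with ne show False ..
  qed
  then have "stage (s, tw', s2, tw2, c2)" using g(1,3) by (auto simp: stage_def syzygies_def)
  then show ?thesis using g(2) by blast
qed

text \<open>\<open>J\<close> is treated as a submodule of the free module of rank 1; the entries
  have no constant term because \<open>J\<close> is a proper homogeneous ideal.\<close>

lemma ex_first_stage:
  fixes J :: "'v::finite cpoly set"
  assumes J: "is_ideal J" "1 \<notin> J" "\<And>p t. p \<in> J \<Longrightarrow> hcomp t p \<in> J"
  shows "\<exists>s tw' c. stage (1, \<lambda>_. 0, s, tw', c) \<and> range (column_sum s c) = {u. u 0 \<in> J \<and> (\<forall>i\<ge>1. u i = 0)}"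
proof -
  define K where "K = {u :: nat \<Rightarrow> 'v cpoly. u 0 \<in> J \<and> (\<forall>i\<ge>1. u i = 0)}"
  have sub: "fmod.subspace K"
    unfolding fmod.subspace_def
  proof (intro conjI ballI allI)
    show "0 \<in> K" by (simp add: K_def is_ideal_zero[OF J(1)])
    show "x + y \<in> K" if "x \<in> K" "y \<in> K" for x y
      using that by (auto simp: K_def is_ideal_add[OF J(1)])
    show "smul a x \<in> K" if "x \<in> K" for a x
      using that by (auto simp: K_def smul_apply is_ideal_mult[OF J(1)])
  qed
  have "\<exists>s tw' c. (\<forall>j<s. c j \<in> K \<and> graded_part (\<lambda>_. 0) (tw' j) (c j) = c j) \<and>
      range (column_sum s c) = K \<and>
      (\<forall>u i a. column_sum s c u = 0 \<longrightarrow> i < s \<longrightarrow> u i = Cst a \<longrightarrow> a = 0)"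
    by (rule minimal_homogeneous_generators[OF sub, of 1]) (auto simp: K_def graded_part_def J(3))
  then obtain s tw' c where g: "\<forall>j<s. c j \<in> K \<and> graded_part (\<lambda>_. 0) (tw' j) (c j) = c j"
    "range (column_sum s c) = K"
    "\<forall>u i a. column_sum s c u = 0 \<longrightarrow> i < s \<longrightarrow> u i = Cst a \<longrightarrow> a = 0" by (elim exE conjE)
  have "lookup (c j 0) 0 = 0" if "j < s" for j
  proof (rule ccontr)
    assume ne: "lookup (c j 0) 0 \<noteq> 0"
    have "homogeneous (tw' j) (c j 0)"
      using fun_cong[of _ _ 0] g(1) that(1) by (simp add: homogeneous_iff_hcomp graded_part_def) metis
    then have "c j 0 = Cst (lookup (c j 0) 0)" using ne by (rule homogeneous_nonzero_constant)
    moreover have "c j 0 \<in> J" using g(1) that by (auto simp: K_def)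
    ultimately have "J = UNIV" using is_ideal_Cst[OF J(1)] ne by metis
    then show False using J(2) by simp
  qed
  then have "stage (1, \<lambda>_. 0, s, tw', c)" using g(1,3) by (auto simp: stage_def K_def)
  then show ?thesis using g(2) unfolding K_def by blast
qed

text \<open>The regularity is defined through an arbitrary choice of a minimal resolution; existence
  guarantees that the choice is one.\<close>

theorem ex_minimal_resolution:
  fixes J :: "'v::finite cpoly set"
  assumes J: "is_ideal J" "1 \<notin> J" "\<And>p t. p \<in> J \<Longrightarrow> hcomp t p \<in> J"
  shows "\<exists>R. minimal_resolution R J"
proof -
  obtain s0 tw0 c0 where st0: "stage (1, \<lambda>_. 0, s0, tw0, c0)"
    "range (column_sum s0 c0) = {u. u 0 \<in> J \<and> (\<forall>i\<ge>1. u i = 0)}" using ex_first_stage[OF J] by blast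
  define x0 where "x0 = (1::nat, \<lambda>_::nat. 0::int, s0, tw0, c0)"
  \<comment> \<open>The side condition at \<open>n = 0\<close> pins the start of the sequence
    obtained by dependent choice.\<close>
  have "\<exists>F. \<forall>n. (stage (F n) \<and> (n = 0 \<longrightarrow> F n = x0)) \<and> next_stage (F n) (F (Suc n))"
  proof (rule dependent_nat_choice)
    show "\<exists>x. stage x \<and> (0 = (0::nat) \<longrightarrow> x = x0)" using st0(1) by (auto simp: x0_def)
    fix x and n :: nat assume x: "stage x \<and> (n = 0 \<longrightarrow> x = x0)"
    obtain r tw s tw' c where xe: "x = (r, tw, s, tw', c)" by (metis surj_pair)
    obtain s2 tw2 c2 where "stage (s, tw', s2, tw2, c2)" "range (column_sum s2 c2) = syzygies s c"
      using ex_next_stage x unfolding xe by blast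
    then show "\<exists>y. (stage y \<and> (Suc n = 0 \<longrightarrow> y = x0)) \<and> next_stage x y"
      by (intro exI[of _ "(s, tw', s2, tw2, c2)"]) (simp add: xe next_stage_def)
  qed
  then obtain F where F: "\<forall>n. (stage (F n) \<and> (n = 0 \<longrightarrow> F n = x0)) \<and> next_stage (F n) (F (Suc n))" by (elim exE)
  define rr where "rr n = fst (F n)" for n
  define tt where "tt n = fst (snd (F n))" for n
  define cc where "cc n = snd (snd (snd (snd (F n))))" for n
  have Fe: "F n = (rr n, tt n, rr (Suc n), tt (Suc n), cc n)" for n
    using F[rule_format, of n] by (auto simp: next_stage_def rr_def tt_def cc_def split: prod.splits)
  have st: "stage (rr n, tt n, rr (Suc n), tt (Suc n), cc n)" for n using F Fe by metis
  have nx: "range (column_sum (rr (Suc (Suc n))) (cc (Suc n))) = syzygies (rr (Suc n)) (cc n)" for n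
    using F[rule_format, of n] unfolding Fe next_stage_def by simp
  have F0: "rr 0 = 1" "tt 0 = (\<lambda>_. 0)" "rr (Suc 0) = s0" "cc 0 = c0"
    using F[rule_format, of 0] Fe[of 0] by (auto simp: x0_def)
  \<comment> \<open>Stage \<open>k - 1\<close> holds the matrix from homological degree
    \<open>k\<close> to \<open>k - 1\<close>, by columns; hence the shift and the exchanged
    indices.\<close>
  define R where "R = \<lparr>rk = rr, twist = tt, dmat = (\<lambda>k i j. cc (k - 1) j i), augm = (\<lambda>_. 1)\<rparr>"
  have czero: "cc k j i = 0" if "j < rr (Suc k)" "i \<ge> rr k" for k i j
    using st[of k] that by (auto simp: stage_def)
  have cgr: "graded_part (tt k) (tt (Suc k) j) (cc k j) = cc k j" if "j < rr (Suc k)" for k j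
    using st[of k] that by (auto simp: stage_def)
  have cmin: "lookup (cc k j i) 0 = 0" if "j < rr (Suc k)" "i < rr k" for k i j
    using st[of k] that by (auto simp: stage_def)
  have diff: "differential R (Suc k) u = column_sum (rr (Suc k)) (cc k) u" for k u
    by (rule ext) (auto simp: differential_def R_def column_sum_def czero not_less intro!: sum.neutral[symmetric])
  have trunc: "\<exists>u'\<in>chain_module R k. column_sum (rr k) c u' = column_sum (rr k) c u" for k c u
    by (intro bexI[of _ "\<lambda>j. if j < rr k then u j else 0"])
      (auto simp: chain_module_def R_def column_sum_def)
  have im: "differential R (Suc k) ` chain_module R (Suc k) = range (column_sum (rr (Suc k)) (cc k))" for k
  proof (intro subset_antisym subsetI)
    fix x assume "x \<in> range (column_sum (rr (Suc k)) (cc k))"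
    then obtain u where "x = column_sum (rr (Suc k)) (cc k) u" by blast
    then show "x \<in> differential R (Suc k) ` chain_module R (Suc k)"
      using trunc[of "Suc k" "cc k" u] unfolding diff by (metis image_eqI)
  qed (auto simp: diff)
  have aug: "augmentation R u = u 0" for u by (simp add: augmentation_def R_def F0)
  have "graded_free_resolution R J"
    unfolding graded_free_resolution_def
  proof (intro conjI allI impI)
    show "homogeneous (twist R 0 i) (augm R i)" for i by (simp add: R_def F0 homogeneous_one)
  next
    fix k i j assume k: "k \<ge> (1::nat)" "i < rk R (k - 1)" "j < rk R k"
    then obtain k' where k': "k = Suc k'" by (cases k) auto
    have "j < rr (Suc k')" using k(3) by (simp add: R_def k')
    from fun_cong[OF cgr[OF this], of i]
    have "homogeneous (tt (Suc k') j - tt k' i) (cc k' j i)" by (simp add: homogeneous_iff_hcomp graded_part_def)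
    then show "homogeneous (twist R k j - twist R (k - 1) i) (dmat R k i j)" by (simp add: R_def k')
  next
    fix p
    show "\<exists>u\<in>chain_module R 0. p - augmentation R u \<in> J"
      by (intro bexI[of _ "\<lambda>i. if i = 0 then p else 0"])
        (simp add: aug is_ideal_zero[OF J(1)], simp add: chain_module_def R_def F0)
  next
    have "{u \<in> chain_module R 0. augmentation R u \<in> J} = {u. u 0 \<in> J \<and> (\<forall>i\<ge>1. u i = 0)}"
      unfolding aug by (auto simp: chain_module_def R_def F0)
    also have "\<dots> = differential R 1 ` chain_module R 1"
      using im[of 0] st0(2) by (simp add: F0)
    finally show "{u \<in> chain_module R 0. augmentation R u \<in> J} = differential R 1 ` chain_module R 1" .
  next
    fix k :: nat assume "k \<ge> 1"
    then obtain k' where k': "k = Suc k'" by (cases k) auto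
    show "{u \<in> chain_module R k. differential R k u = (\<lambda>_. 0)} = differential R (Suc k) ` chain_module R (Suc k)"
      unfolding im k' nx diff by (auto simp: syzygies_def chain_module_def R_def fun_eq_iff)
  qed
  moreover have "lookup (dmat R k i j) 0 = 0" if "k \<ge> 1" "i < rk R (k - 1)" "j < rk R k" for k i j
    using that cmin[of j "k - 1" i] by (simp add: R_def)
  ultimately show ?thesis unfolding minimal_resolution_def by blast
qed

section \<open>The differential module of a resolution\<close>

text \<open>All modules of the resolution are put into one by pairing the homological degree with
  the index of the basis element.\<close>

definition chain_part :: "nat \<Rightarrow> (nat \<Rightarrow> 'b) \<Rightarrow> (nat \<Rightarrow> 'b)" where
  "chain_part k u = (\<lambda>j. u (prod_encode (k, j)))"

definition resolution_index :: "'v resolution \<Rightarrow> nat set" where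
  "resolution_index R = {e. snd (prod_decode e) < rk R (fst (prod_decode e))}"

definition resolution_degree :: "'v resolution \<Rightarrow> nat \<Rightarrow> int" where
  "resolution_degree R e = twist R (fst (prod_decode e)) (snd (prod_decode e)) - int (fst (prod_decode e))"

definition resolution_differential :: "'v::finite resolution \<Rightarrow> (nat \<Rightarrow> 'v cpoly) \<Rightarrow> (nat \<Rightarrow> 'v cpoly)" where
  "resolution_differential R u =
     (\<lambda>e. differential R (Suc (fst (prod_decode e))) (chain_part (Suc (fst (prod_decode e))) u) (snd (prod_decode e)))"

lemma chain_part_eqI: "(\<And>k. chain_part k u = chain_part k w) \<Longrightarrow> u = w"
proof (rule ext)
  fix e assume *: "\<And>k. chain_part k u = chain_part k w"
  obtain k j where "e = prod_encode (k, j)" by (metis prod_decode_inverse surj_pair)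
  then show "u e = w e" using fun_cong[OF *[of k], of j] by (simp add: chain_part_def)
qed

lemma chain_part_resolution_differential:
  "chain_part k (resolution_differential R u) = differential R (Suc k) (chain_part (Suc k) u)"
  by (simp add: chain_part_def resolution_differential_def)

lemma supported_resolution_iff: "u \<in> supported (resolution_index R) \<longleftrightarrow> (\<forall>k. chain_part k u \<in> chain_module R k)"
proof
  assume u: "u \<in> supported (resolution_index R)"
  then show "\<forall>k. chain_part k u \<in> chain_module R k"
    by (auto simp: supported_def resolution_index_def chain_part_def chain_module_def)
next
  assume h: "\<forall>k. chain_part k u \<in> chain_module R k"
  have "u e = 0" if "e \<notin> resolution_index R" for e
  proof -
    obtain k j where e: "e = prod_encode (k, j)" by (metis prod_decode_inverse surj_pair)
    then have "rk R k \<le> j" using that by (simp add: resolution_index_def)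
    then have "chain_part k u j = 0" using h by (simp add: chain_module_def)
    then show ?thesis by (simp add: e chain_part_def)
  qed
  then show "u \<in> supported (resolution_index R)" by (simp add: supported_def)
qed

lemma chain_part_add: "chain_part k (u + w) = chain_part k u + chain_part k w"
  and chain_part_0: "chain_part k 0 = 0"
  by (simp_all add: chain_part_def fun_eq_iff)

lemma chain_part_smul: "chain_part k (smul p u) = smul p (chain_part k u)"
  by (simp add: chain_part_def fun_eq_iff smul_apply)

lemma chain_part_graded_part:
  "chain_part k (graded_part (resolution_degree R) t u) = graded_part (twist R k) (t + int k) (chain_part k u)"
  by (simp add: chain_part_def fun_eq_iff graded_part_def resolution_degree_def algebra_simps)

lemma differential_add: "differential R k (u + w) = differential R k u + differential R k w"
  and differential_smul: "differential R k (smul p u) = smul p (differential R k u)"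
  and differential_0: "differential R k 0 = 0"
  by (auto simp: differential_def fun_eq_iff smul_apply distrib_left sum.distrib sum_distrib_left mult_ac)

lemma differential_in_chain_module: "differential R (Suc k) u \<in> chain_module R k"
  by (simp add: differential_def chain_module_def)

lemma augmentation_add: "augmentation R (u + w) = augmentation R u + augmentation R w"
  and augmentation_smul: "augmentation R (smul p u) = p * augmentation R u"
  by (auto simp: augmentation_def smul_apply distrib_left sum.distrib sum_distrib_left mult_ac)

text \<open>Exactness says that the homology sits in homological degree 0 and equals
  \<open>S/J\<close>, so each element of \<open>J\<close> annihilates it; the exponent 1 suffices in
  the last clause of \<open>resolves\<close>.\<close>

theorem resolves_of_resolution:
  fixes J :: "'v::finite cpoly set"
  assumes J: "is_ideal J" "\<And>p t. p \<in> J \<Longrightarrow> hcomp t p \<in> J" and res: "graded_free_resolution R J"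
    and r: "\<And>k i. i < rk R k \<Longrightarrow> real_of_int (twist R k i - int k) \<le> r"
  shows "resolves (resolution_index R) (resolution_degree R) (resolution_differential R) r
     (\<lambda>u. augmentation R (chain_part 0 u)) J"
proof -
  let ?E = "resolution_index R" and ?\<delta> = "resolution_degree R" and ?D = "resolution_differential R"
  have augh: "\<forall>i<rk R 0. homogeneous (twist R 0 i) (augm R i)"
    and dh: "\<forall>k\<ge>1. \<forall>i<rk R (k - 1). \<forall>j<rk R k. homogeneous (twist R k j - twist R (k - 1) i) (dmat R k i j)"
    and augs: "\<forall>p. \<exists>u\<in>chain_module R 0. p - augmentation R u \<in> J"
    and ex0: "{u \<in> chain_module R 0. augmentation R u \<in> J} = differential R 1 ` chain_module R 1"
    and ex: "\<forall>k\<ge>1. {u \<in> chain_module R k. differential R k u = (\<lambda>_. 0)} = differential R (Suc k) ` chain_module R (Suc k)"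
    using res unfolding graded_free_resolution_def by - (elim conjE, assumption)+
  have zero_fun: "(\<lambda>_. 0) = (0 :: nat \<Rightarrow> 'v cpoly)" by (simp add: fun_eq_iff)
  have ex': "differential R k u = 0 \<longleftrightarrow> u \<in> differential R (Suc k) ` chain_module R (Suc k)"
    if "k \<ge> 1" "u \<in> chain_module R k" for k u
    using ex that unfolding zero_fun by blast
  have diff_graded: "graded_part (twist R k) t (differential R (Suc k) u) = differential R (Suc k) (graded_part (twist R (Suc k)) t u)" for k t u
  proof (rule ext)
    fix i
    show "graded_part (twist R k) t (differential R (Suc k) u) i = differential R (Suc k) (graded_part (twist R (Suc k)) t u) i"
    proof (cases "i < rk R k")
      case True
      have "hcomp (t - twist R k i) (dmat R (Suc k) i j * u j) = dmat R (Suc k) i j * hcomp (t - twist R (Suc k) j) (u j)"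
        if "j < rk R (Suc k)" for j
      proof -
        have "homogeneous (twist R (Suc k) j - twist R k i) (dmat R (Suc k) i j)"
          using dh[rule_format, of "Suc k" i j] True that by simp
        from hcomp_homogeneous_mult[OF this] show ?thesis by (simp add: algebra_simps)
      qed
      then show ?thesis using True by (simp add: graded_part_def differential_def hcomp_sum)
    next
      case False
      then show ?thesis by (simp add: graded_part_def differential_def)
    qed
  qed
  have dm: "differential_module ?E ?\<delta> ?D"
  proof
    show "?D (u + w) = ?D u + ?D w" for u w
      by (rule chain_part_eqI) (simp only: chain_part_resolution_differential chain_part_add differential_add)
    show "?D (smul p u) = smul p (?D u)" for p u
      by (rule chain_part_eqI) (simp only: chain_part_resolution_differential chain_part_smul differential_smul)
    show "?D u \<in> supported ?E" if "u \<in> supported ?E" for u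
      by (simp only: supported_resolution_iff chain_part_resolution_differential differential_in_chain_module) simp
    show "?D (?D u) = 0" if u: "u \<in> supported ?E" for u
    proof (rule chain_part_eqI)
      fix k
      have "chain_part (Suc (Suc k)) u \<in> chain_module R (Suc (Suc k))" using u unfolding supported_resolution_iff by blast
      then have "differential R (Suc k) (differential R (Suc (Suc k)) (chain_part (Suc (Suc k)) u)) = 0"
        using ex'[of "Suc k" "differential R (Suc (Suc k)) (chain_part (Suc (Suc k)) u)"] differential_in_chain_module by auto
      then show "chain_part k (?D (?D u)) = chain_part k 0"
        by (simp only: chain_part_resolution_differential chain_part_0)
    qed
    show "?D (graded_part ?\<delta> t u) = graded_part ?\<delta> (t + 1) (?D u)" for t u
    proof (rule chain_part_eqI)
      fix k
      have "t + int (Suc k) = t + 1 + int k" by simp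
      then show "chain_part k (?D (graded_part ?\<delta> t u)) = chain_part k (graded_part ?\<delta> (t + 1) (?D u))"
        by (simp only: chain_part_resolution_differential chain_part_graded_part diff_graded)
    qed
  qed
  interpret differential_module ?E ?\<delta> ?D by (rule dm)
  show ?thesis
    unfolding resolves_def
  proof (intro conjI allI ballI impI dm)
    show "real_of_int (?\<delta> e) \<le> r" if "e \<in> ?E" for e
      using r that by (simp add: resolution_degree_def resolution_index_def)
  next
    fix u w
    show "augmentation R (chain_part 0 (u + w)) = augmentation R (chain_part 0 u) + augmentation R (chain_part 0 w)"
      by (simp only: chain_part_add augmentation_add)
  next
    fix p u
    show "augmentation R (chain_part 0 (smul p u)) = p * augmentation R (chain_part 0 u)"
      by (simp only: chain_part_smul augmentation_smul)
  next
    fix w :: "nat \<Rightarrow> 'v cpoly" assume "w \<in> supported ?E"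
    then have "chain_part 1 w \<in> chain_module R 1" unfolding supported_resolution_iff by blast
    then have "differential R 1 (chain_part 1 w) \<in> {u \<in> chain_module R 0. augmentation R u \<in> J}" using ex0 by blast
    then show "augmentation R (chain_part 0 (?D w)) \<in> J" by (simp add: chain_part_resolution_differential)
  next
    fix t and p :: "'v cpoly" assume p: "homogeneous t p"
    obtain u0 where u0: "u0 \<in> chain_module R 0" "p - augmentation R u0 \<in> J" using augs by blast
    \<comment> \<open>An arbitrary lift is replaced by its part of degree \<open>t\<close>, which
      still lifts \<open>p\<close> modulo \<open>J\<close> because \<open>J\<close> is
      homogeneous.\<close>
    define u1 where "u1 = graded_part (twist R 0) t u0"
    define u where "u = (\<lambda>e. if fst (prod_decode e) = 0 then u1 (snd (prod_decode e)) else 0)"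
    have cp: "chain_part k u = (if k = 0 then u1 else 0)" for k
      by (auto simp: chain_part_def u_def fun_eq_iff)
    have u1: "u1 \<in> chain_module R 0" using u0(1) by (simp add: u1_def graded_part_def chain_module_def)
    have "augmentation R u1 = hcomp t (augmentation R u0)"
      unfolding augmentation_def u1_def graded_part_def hcomp_sum
    proof (rule sum.cong[OF refl])
      fix i assume "i \<in> {..<rk R 0}"
      then have "homogeneous (twist R 0 i) (augm R i)" using augh by simp
      then show "augm R i * hcomp (t - twist R 0 i) (u0 i) = hcomp t (augm R i * u0 i)"
        by (simp only: hcomp_homogeneous_mult)
    qed
    then have "p - augmentation R u1 = hcomp t (p - augmentation R u0)"
      using p by (simp add: homogeneous_iff_hcomp)
    then have "p - augmentation R (chain_part 0 u) \<in> J" using J(2)[OF u0(2), of t] by (simp add: cp)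
    moreover have "u \<in> supported ?E"
      unfolding supported_resolution_iff cp using u1 by (simp add: chain_module_def)
    moreover have "?D u = 0"
      by (rule chain_part_eqI) (simp only: chain_part_resolution_differential cp nat.distinct if_False differential_0 chain_part_0)
    moreover have "graded_part ?\<delta> t u = u"
    proof (rule chain_part_eqI)
      fix k
      have "graded_part \<delta>' s (0 :: nat \<Rightarrow> 'v cpoly) = 0" for \<delta>' s by (simp add: graded_part_def fun_eq_iff)
      then show "chain_part k (graded_part ?\<delta> t u) = chain_part k u"
        unfolding chain_part_graded_part cp by (simp add: u1_def graded_part_idem)
    qed
    ultimately show "\<exists>u\<in>supported ?E. ?D u = 0 \<and> graded_part ?\<delta> t u = u \<and> p - augmentation R (chain_part 0 u) \<in> J"
      by blast
  next
    fix q assume q: "q \<in> J"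
    have "q \<in> annihilator"
      unfolding annihilator_def
    proof (intro CollectI ballI impI)
      fix u assume u: "u \<in> supported ?E" "?D u = 0"
      have uk: "chain_part k u \<in> chain_module R k" for k using u(1) unfolding supported_resolution_iff by blast
      \<comment> \<open>In homological degree 0 the factor \<open>q\<close> from \<open>J\<close>
        gives the preimage; in higher degrees the cycle itself is already a boundary.\<close>
      have "\<exists>w\<in>chain_module R (Suc k). smul q (chain_part k u) = differential R (Suc k) w" for k
      proof (cases k)
        case 0
        have "augmentation R (smul q (chain_part 0 u)) \<in> J"
          unfolding augmentation_smul using q by (rule is_ideal_mult_right[OF J(1)])
        moreover have "smul q (chain_part 0 u) \<in> chain_module R 0" using uk[of 0] by (simp add: chain_module_def smul_apply)
        ultimately have "smul q (chain_part 0 u) \<in> differential R 1 ` chain_module R 1" using ex0 by blast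
        then show ?thesis using 0 by auto
      next
        case (Suc k')
        have "differential R (Suc k') (chain_part (Suc k') u) = chain_part k' (?D u)"
          by (simp only: chain_part_resolution_differential)
        also have "\<dots> = 0" by (simp only: u(2) chain_part_0)
        finally have "chain_part (Suc k') u \<in> differential R (Suc (Suc k')) ` chain_module R (Suc (Suc k'))"
          using ex'[of "Suc k'"] uk by simp
        then obtain w where "w \<in> chain_module R (Suc k)" "chain_part k u = differential R (Suc k) w" using Suc by auto
        moreover from this have "smul q w \<in> chain_module R (Suc k)" by (simp add: chain_module_def smul_apply)
        ultimately show ?thesis by (intro bexI[of _ "smul q w"]) (simp_all only: differential_smul)
      qed
      then have "\<forall>k. \<exists>w. w \<in> chain_module R (Suc k) \<and> smul q (chain_part k u) = differential R (Suc k) w" by blast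
      then obtain w where w: "\<forall>k. w k \<in> chain_module R (Suc k) \<and> smul q (chain_part k u) = differential R (Suc k) (w k)"
        unfolding choice_iff by (elim exE)
      define y where "y = (\<lambda>e. case fst (prod_decode e) of 0 \<Rightarrow> 0 | Suc k \<Rightarrow> w k (snd (prod_decode e)))"
      have y: "chain_part (Suc k) y = w k" "chain_part 0 y = 0" for k
        by (simp_all add: chain_part_def y_def fun_eq_iff)
      have "y \<in> supported ?E"
        unfolding supported_resolution_iff
      proof
        fix k show "chain_part k y \<in> chain_module R k"
          using w by (cases k) (simp_all add: y chain_module_def)
      qed
      moreover have "smul q u = ?D y"
      proof (rule chain_part_eqI)
        fix k
        show "chain_part k (smul q u) = chain_part k (?D y)"
          unfolding chain_part_smul chain_part_resolution_differential y using w by blast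
      qed
      ultimately show "\<exists>w\<in>supported ?E. smul q u = ?D w" by blast
    qed
    then have "q ^ 1 \<in> annihilator" by simp
    then show "\<exists>s. q ^ s \<in> annihilator" by blast
  qed
qed

section \<open>The degree bound\<close>

text \<open>The equations of any projective variety that contains \<open>V\<close> belong to the
  ideal of the closure, so a nonzero zero of that ideal lies in every such variety.\<close>

lemma zero_set_homogeneous_ideal_subset:
  assumes "z \<in> zero_set (homogeneous_ideal (projective_closure V))" "z \<noteq> 0"
  shows "z \<in> projective_closure V"
  unfolding projective_closure_def
proof (rule InterI)
  fix Y assume Y: "Y \<in> {X. projective_variety X \<and> affine_chart ` V \<subseteq> X}"
  then obtain H where H: "\<forall>h\<in>H. \<exists>t. homogeneous t h" "Y = {z. z \<noteq> 0 \<and> (\<forall>h\<in>H. poly_at h z = 0)}"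
    unfolding projective_variety_def by auto
  have "poly_at h z = 0" if h: "h \<in> H" for h
  proof -
    obtain t where t: "homogeneous t h" using H(1) h by blast
    have "h \<in> vanishing_ideal (affine_chart ` V)" using Y H(2) h by (auto simp: vanishing_ideal_def)
    then have "h \<in> homogeneous_ideal (projective_closure V)"
      unfolding homogeneous_ideal_projective_closure homogeneous_in_vanishing_ideal_cone[OF t] .
    then show ?thesis using assms(1) by (simp add: zero_set_def)
  qed
  then show "z \<in> Y" using H(2) assms(2) by blast
qed

lemma affine_chart_nonzero: "affine_chart x \<noteq> 0"
proof
  assume "affine_chart x = 0"
  then have "affine_chart x $ None = 0" by simp
  then show False by (simp add: affine_chart_def)
qed

lemma affine_chart_in_zero_set: "x \<in> V \<Longrightarrow> affine_chart x \<in> zero_set (vanishing_ideal (cone (affine_chart ` V)))"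
proof -
  assume x: "x \<in> V"
  have "affine_chart x \<in> cone (affine_chart ` V)"
    unfolding cone_def using x by (intro CollectI exI[of _ "1::complex"] exI[of _ "affine_chart x"]) (simp add: imageI)
  then show ?thesis by (auto simp: zero_set_def vanishing_ideal_def)
qed

lemma total_degree_eq_0: "total_degree p = 0 \<Longrightarrow> p = Cst (lookup p 0)"
proof (rule poly_mapping_eqI)
  fix a assume "total_degree p = 0"
  then have "a \<in> keys p \<Longrightarrow> a = 0" using mon_degree_le_total_degree[of a p] by simp
  then show "lookup p a = lookup (Cst (lookup p 0)) a"
    by (cases "a = 0") (auto simp: Cst_def lookup_single when_def in_keys_iff)
qed

text \<open>The representation of the homogenized polynomial is cut down to degree \<open>t\<close>
  and dehomogenized; the cofactor of the form with index \<open>j\<close> then has degree at most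
  \<open>t - d j\<close>.\<close>

lemma membership_of_vanishing_in_degree:
  fixes V :: "(complex^'n::finite) set" and F :: "nat \<Rightarrow> 'n cpoly"
  assumes d: "\<And>j. j \<in> {1..m} \<Longrightarrow> total_degree (F j) \<le> d j" and t: "total_degree \<Phi> \<le> t"
    and mem: "homogenize t \<Phi> \<in> ideal_plus (vanishing_ideal (cone (affine_chart ` V))) (\<lambda>j. homogenize (d j) (F j)) {1..m}"
  shows "\<exists>Q. (\<forall>x\<in>V. poly_at (\<Sum>j=1..m. F j * Q j) x = poly_at \<Phi> x) \<and> (\<forall>j\<in>{1..m}. total_degree (F j * Q j) \<le> t)"
proof -
  let ?J = "vanishing_ideal (cone (affine_chart ` V))" and ?f = "\<lambda>j. homogenize (d j) (F j)"
  obtain q h where qh: "q \<in> ?J" "homogenize t \<Phi> = q + (\<Sum>j\<in>{1..m}. ?f j * h j)"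
    using mem unfolding ideal_plus_def by blast
  define h' where "h' j = hcomp (int t - int (d j)) (h j)" for j
  define Q where "Q j = dehomogenize (h' j)" for j
  have "homogenize t \<Phi> = hcomp (int t) (homogenize t \<Phi>)"
    using homogeneous_homogenize[OF t] by (simp add: homogeneous_iff_hcomp)
  also have "\<dots> = hcomp (int t) q + (\<Sum>j\<in>{1..m}. hcomp (int t) (?f j * h j))"
    unfolding qh(2) by (simp add: hcomp_sum)
  also have "(\<Sum>j\<in>{1..m}. hcomp (int t) (?f j * h j)) = (\<Sum>j\<in>{1..m}. ?f j * h' j)"
    unfolding h'_def by (rule sum.cong[OF refl], rule hcomp_homogeneous_mult[OF homogeneous_homogenize[OF d]])
  finally have eq: "homogenize t \<Phi> = hcomp (int t) q + (\<Sum>j\<in>{1..m}. ?f j * h' j)" .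
  have "poly_at (\<Sum>j=1..m. F j * Q j) x = poly_at \<Phi> x" if x: "x \<in> V" for x
  proof -
    have "hcomp (int t) q \<in> ?J" using qh(1) by (rule hcomp_in_vanishing_ideal_cone)
    then have "poly_at (hcomp (int t) q) (affine_chart x) = 0"
      using affine_chart_in_zero_set[OF x] by (simp add: zero_set_def)
    then have "poly_at (homogenize t \<Phi>) (affine_chart x) = (\<Sum>j\<in>{1..m}. poly_at (F j) x * poly_at (Q j) x)"
      unfolding eq by (simp add: poly_at_homogenize Q_def poly_at_dehomogenize)
    then show ?thesis by (simp add: poly_at_homogenize)
  qed
  moreover have "total_degree (F j * Q j) \<le> t" if j: "j \<in> {1..m}" for j
  proof (cases "d j \<le> t")
    case True
    have "total_degree (h' j) \<le> t - d j"
      unfolding h'_def by (rule homogeneous_total_degree_le[OF homogeneous_hcomp]) (use True in simp)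
    then have "total_degree (Q j) \<le> t - d j" using total_degree_dehomogenize_le[of "h' j"] by (simp add: Q_def)
    then show ?thesis using total_degree_mult_le[of "F j" "Q j"] d[OF j] True by simp
  next
    case False
    \<comment> \<open>For \<open>d j > t\<close> the cofactor is a form of negative degree.\<close>
    then have "Q j = 0" by (simp add: Q_def h'_def hcomp_neg)
    then show ?thesis by simp
  qed
  ultimately show ?thesis by blast
qed

theorem theorem1p1:
  fixes V :: "(complex^'n::finite) set"
    and X :: "(complex^('n option)) set"
    and F :: "nat \<Rightarrow> 'n cpoly"
    and d :: "nat \<Rightarrow> nat"
    and f :: "nat \<Rightarrow> 'n option cpoly"
    and \<Phi> :: "'n cpoly"
    and m n :: nat
  assumes "affine_variety V"
    and "pure_dimensional V n"
    and "X = projective_closure V"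
    and "\<forall>j\<in>{1..m}. F j \<noteq> 0"
    and "\<forall>j\<in>{1..m}. d j = total_degree (F j)"
    and "\<forall>j>m. d j = 0"
    and "\<forall>i\<in>{1..m}. \<forall>j\<in>{1..m}. i \<le> j \<longrightarrow> d j \<le> d i"
    and "\<forall>j\<in>{1..m}. f j = homogenize (d j) (F j)"
    and "\<not> (\<exists>z\<in>X. \<forall>j\<in>{1..m}. poly_at (f j) z = 0)"
  shows "\<exists>Q :: nat \<Rightarrow> 'n cpoly.
    (\<forall>x\<in>V. poly_at (\<Sum>j=1..m. F j * Q j) x = poly_at \<Phi> x) \<and>
    (\<forall>j\<in>{1..m}. ereal (real (total_degree (F j * Q j)))
       \<le> max (ereal (real (total_degree \<Phi>)))
           (ereal (real (\<Sum>j=1..n+1. d j) - real (n + 1)) + projective_regularity X))"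
proof -
  define J where "J = homogeneous_ideal X"
  have J: "J = vanishing_ideal (cone (affine_chart ` V))"
    unfolding J_def assms(3) by (rule homogeneous_ideal_projective_closure)
  have idJ: "is_ideal J" unfolding J by (rule is_ideal_vanishing_ideal)
  have grJ: "hcomp t p \<in> J" if "p \<in> J" for p t using that unfolding J by (rule hcomp_in_vanishing_ideal_cone)
  \<comment> \<open>For empty \<open>V\<close> the ideal is the whole ring and any cofactors do; a
    constant \<open>F j0\<close> is nonzero and divides \<open>\<Phi>\<close>. Fewer than
    \<open>n + 1\<close> polynomials are possible only in these two cases.\<close>
  consider (empty) "V = {}" | (const) j0 where "j0 \<in> {1..m}" "d j0 = 0"
    | (main) "V \<noteq> {}" "\<And>j. j \<in> {1..m} \<Longrightarrow> d j \<ge> 1" by force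
  then show ?thesis
  proof cases
    case empty
    then show ?thesis by (intro exI[of _ "\<lambda>_. 0"]) (simp add: le_max_iff_disj)
  next
    case const
    define a where "a = lookup (F j0) 0"
    have Fj: "F j0 = Cst a" unfolding a_def using assms(5) const by (intro total_degree_eq_0) simp
    have a: "a \<noteq> 0" using assms(4) const(1) Fj by auto
    define Q where "Q j = (if j = j0 then Cst (1 / a) * \<Phi> else 0)" for j
    have FQ: "F j * Q j = (if j = j0 then \<Phi> else 0)" for j
    proof -
      have "Cst a * (Cst (1 / a) * \<Phi>) = Cst (a * (1 / a)) * \<Phi>" by (simp only: Cst_mult mult.assoc)
      also have "\<dots> = \<Phi>" using a by simp
      finally show ?thesis by (simp add: Q_def Fj)
    qed
    show ?thesis
      using const(1) by (intro exI[of _ Q]) (simp add: FQ le_max_iff_disj)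
  next
    case main
    have fh: "homogeneous (int (d j)) (f j)" if "j \<in> {1..m}" for j
      using assms(5,8) that homogeneous_homogenize[of "F j" "d j"] by simp
    have noz: "z = 0" if z: "z \<in> zero_set J" "\<forall>j\<in>{1..m}. poly_at (f j) z = 0" for z
    proof (rule ccontr)
      assume "z \<noteq> 0"
      then have "z \<in> X" using zero_set_homogeneous_ideal_subset z(1) unfolding J_def assms(3) by blast
      then show False using assms(9) z(2) by blast
    qed
    have nm: "Suc n \<le> m"
      by (rule number_of_forms_ge[OF assms(1,2) main(1) J fh main(2) noz])
    have "growth J (Suc n)" unfolding J by (intro growth_cone growth_vanishing_ideal assms(1,2))
    then have bound: "k \<le> Suc n" if "prime_chain C k" "J \<subseteq> C 0" for C k
      using prime_chain_le_growth that by blast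
    have "\<exists>g. (\<forall>i\<in>{1..Suc n}. homogeneous (int (d i)) (g i) \<and> g i \<in> ideal_plus {0} f {1..m}) \<and>
      zero_set (ideal_plus J g {1..Suc n}) \<subseteq> {0}"
      by (rule ex_system_of_parameters[OF J fh main(2) _ noz nm bound]) (use assms(7) in auto)
    then obtain g where g: "\<forall>i\<in>{1..Suc n}. homogeneous (int (d i)) (g i) \<and> g i \<in> ideal_plus {0} f {1..m}"
      "zero_set (ideal_plus J g {1..Suc n}) \<subseteq> {0}" by blast
    have gf: "ideal_plus J g {1..Suc n} \<subseteq> ideal_plus J f {1..m}"
    proof (rule ideal_plus_least[OF is_ideal_ideal_plus[OF idJ] ideal_plus_superset])
      fix i assume "i \<in> {1..Suc n}"
      moreover have "ideal_plus {0} f {1..m} \<subseteq> ideal_plus J f {1..m}"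
        using is_ideal_zero[OF idJ] unfolding ideal_plus_def by blast
      ultimately show "g i \<in> ideal_plus J f {1..m}" using g(1) by blast
    qed
    obtain x0 where x0: "x0 \<in> V" using main(1) by blast
    have oneJ: "1 \<notin> J"
    proof
      assume "1 \<in> J"
      then have "poly_at 1 (affine_chart x0) = 0" using affine_chart_in_zero_set[OF x0] unfolding J[symmetric] zero_set_def by blast
      then show False by simp
    qed
    define R where "R = (SOME R. minimal_resolution R J)"
    have "minimal_resolution R J" unfolding R_def by (rule someI_ex[OF ex_minimal_resolution[OF idJ oneJ grJ]])
    then have res: "graded_free_resolution R J" by (simp add: minimal_resolution_def)
    define reg where "reg = (SUP (k, i)\<in>{(k, i). i < rk R k}. ereal (real_of_int (twist R k i - int k)))"
    have regX: "projective_regularity X = reg + 1"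
      by (simp add: projective_regularity_def ideal_regularity_def quotient_regularity_def J_def[symmetric] R_def[symmetric] reg_def Let_def)
    have le_reg: "ereal (real_of_int (twist R k i - int k)) \<le> reg" if "i < rk R k" for k i
      unfolding reg_def using that by (intro SUP_upper2[of "(k, i)"]) auto
    \<comment> \<open>For the supremum \<open>\<infinity>\<close> the claimed bound is void and any
      representation of \<open>\<Phi>\<close> will do; \<open>-\<infinity>\<close> is excluded since
      \<open>1 \<notin> J\<close> forces a generator in homological degree 0.\<close>
    show ?thesis
    proof (cases reg)
      case (real r)
      have r: "real_of_int (twist R k i - int k) \<le> r" if "i < rk R k" for k i
        using le_reg[OF that] real by simp
      note resv = resolves_of_resolution[OF idJ grJ res r]
      define b where "b = r + (\<Sum>i=1..Suc n. real (d i) - 1)"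
      \<comment> \<open>The least degree above \<open>b\<close> into which \<open>\<Phi>\<close> can
        be homogenized; \<open>nat\<close> turns a negative value into 0.\<close>
      define t where "t = max (total_degree \<Phi>) (nat (\<lfloor>b\<rfloor> + 1))"
      have tb: "real_of_int (int t) > b" unfolding t_def by linarith
      have deg\<Phi>: "total_degree \<Phi> \<le> t" by (simp add: t_def)
      have "homogenize t \<Phi> \<in> ideal_plus J g {1..Suc n}"
        by (rule degree_bound_of_parameters[OF idJ resv _ _ g(2) homogeneous_homogenize[OF deg\<Phi>] tb[unfolded b_def]])
          (use g(1) main(2) nm in auto)
      then have "homogenize t \<Phi> \<in> ideal_plus J f {1..m}" using gf by blast
      moreover have "ideal_plus J f {1..m} = ideal_plus J (\<lambda>j. homogenize (d j) (F j)) {1..m}"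
        using assms(8) by (simp add: ideal_plus_def)
      ultimately obtain Q where Q: "\<forall>x\<in>V. poly_at (\<Sum>j=1..m. F j * Q j) x = poly_at \<Phi> x"
        "\<forall>j\<in>{1..m}. total_degree (F j * Q j) \<le> t"
        using membership_of_vanishing_in_degree[of m F d \<Phi> t V] deg\<Phi> assms(5) J by auto
      \<comment> \<open>The passage to an integer above \<open>b\<close> costs at most 1, and this 1
        is exactly the difference between the regularities of \<open>S/J\<close> and of
        \<open>X\<close>.\<close>
      have b1: "b + 1 = real (\<Sum>j=1..n+1. d j) - real (n + 1) + (r + 1)"
        by (simp add: b_def sum_subtractf)
      have bt: "real t \<le> max (real (total_degree \<Phi>)) (b + 1)"
      proof -
        have "real (nat (\<lfloor>b\<rfloor> + 1)) \<le> max 0 (b + 1)" by linarith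
        then show ?thesis unfolding t_def of_nat_max by linarith
      qed
      have "ereal (real (\<Sum>j=1..n+1. d j) - real (n + 1)) + projective_regularity X = ereal (b + 1)"
        unfolding b1 regX real one_ereal_def plus_ereal.simps ..
      then have "ereal (real t) \<le> max (ereal (real (total_degree \<Phi>)))
           (ereal (real (\<Sum>j=1..n+1. d j) - real (n + 1)) + projective_regularity X)"
        using bt by (simp only: le_max_iff_disj ereal_less_eq)
      then show ?thesis using Q by (intro exI[of _ Q]) (auto intro: order_trans[rotated])
    next
      case PInf
      \<comment> \<open>The \<open>F j\<close> have no common zero on \<open>V\<close>, so 1 is a
        combination of them on \<open>V\<close>; multiplying by \<open>\<Phi>\<close> gives the
        cofactors.\<close>
      define I where "I = ideal_plus (vanishing_ideal V) F {1..m}"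
      have "zero_set I = {}"
      proof (rule equals0I)
        fix x assume x: "x \<in> zero_set I"
        have "x \<in> V"
          using x zero_set_mono[OF ideal_plus_superset] zero_set_vanishing_ideal[OF assms(1)] unfolding I_def by blast
        have "poly_at (F j) x = 0" if "j \<in> {1..m}" for j
          using x ideal_plus_generator[OF is_ideal_vanishing_ideal finite_atLeastAtMost that, of F V] unfolding I_def zero_set_def by blast
        then have "\<forall>j\<in>{1..m}. poly_at (f j) (affine_chart x) = 0" using assms(8) by (simp add: poly_at_homogenize)
        then have "affine_chart x = 0" using affine_chart_in_zero_set[OF \<open>x \<in> V\<close>] noz unfolding J by blast
        then show False using affine_chart_nonzero by blast
      qed
      then have "\<exists>k. 1 ^ k \<in> I"
        by (intro nullstellensatz) (simp_all add: I_def is_ideal_ideal_plus is_ideal_vanishing_ideal)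
      then obtain q h where qh: "q \<in> vanishing_ideal V" "1 = q + (\<Sum>j\<in>{1..m}. F j * h j)"
        unfolding I_def ideal_plus_def by auto
      have "poly_at (\<Sum>j=1..m. F j * (h j * \<Phi>)) x = poly_at \<Phi> x" if "x \<in> V" for x
      proof -
        have "poly_at (q + (\<Sum>j\<in>{1..m}. F j * h j)) x = 1" unfolding qh(2)[symmetric] by simp
        then have "(\<Sum>j\<in>{1..m}. poly_at (F j) x * poly_at (h j) x) = 1"
          using qh(1) that by (simp add: vanishing_ideal_def)
        then show ?thesis by (simp add: mult.assoc[symmetric] sum_distrib_right[symmetric])
      qed
      moreover have "reg + 1 = \<infinity>" using PInf by simp
      ultimately show ?thesis
        by (intro exI[of _ "\<lambda>j. h j * \<Phi>"]) (simp add: regX)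
    next
      case MInf
      have "\<exists>i. i < rk R 0"
      proof (rule ccontr)
        assume "\<not> ?thesis"
        then have "{..<rk R 0} = {}" by auto
        then have "augmentation R u = 0" for u by (simp only: augmentation_def sum.empty)
        moreover have "\<forall>p. \<exists>u\<in>chain_module R 0. p - augmentation R u \<in> J"
          using res by (simp add: graded_free_resolution_def)
        ultimately show False using oneJ by (metis diff_zero)
      qed
      then show ?thesis using le_reg[of _ 0] MInf by auto
    qed
  qed
qed

end
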